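(* Let $F:\mathbb{R}^n\rightrightarrows\mathbb{R}^n$ be upper semicontinuous and locally Lipschitz, with $F(x)$ compact and convex for every $x\in\mathbb{R}^n$, and suppose the system $\dot x\in F(x)$ is backward complete. Let $X_o,X_u\subset\mathbb{R}^n$ with $X_o$ closed and $X_o\cap X_u=\emptyset$. Then the system $\dot x\in F(x)$ is safe with respect to $(X_o,X_u)$ if and only if there exists a locally Lipschitz time-varying barrier function candidate $B:\mathbb{R}_{\geq0}\times\mathbb{R}^n\to\mathbb{R}$ for safety with respect to $(X_o,X_u)$ that satisfies property $(\star\star)$.
   Context: A solution of $\dot x\in F(x)$ starting from $x_o$ is a locally absolutely continuous function $\phi:\operatorname{dom}\phi\to\mathbb{R}^n$, where $\operatorname{dom}\phi$ is $[0,T]$ or $[0,T)$ for some $T\in[0,\infty]$, with $\phi(0)=x_o$ and $\dot\phi(t)\in F(\phi(t))$ for almost all $t\in\operatorname{dom}\phi$. A solution is maximal if it cannot be extended to a solution with strictly larger domain; a system is forward complete if every maximal solution has unbounded domain. The system $\dot x\in F(x)$ is backward complete if $\dot x\in -F(x)$ is forward complete. Safety with respect to $(X_o,X_u)$: every solution starting in $X_o$ never takes values in $X_u$. A time-varying barrier function candidate for safety with respect to $(X_o,X_u)$ is $B:\mathbb{R}_{\geq0}\times\mathbb{R}^n\to\mathbb{R}$ with $B>0$ on $\mathbb{R}_{\geq0}\times X_u$ and $B\le 0$ on $\mathbb{R}_{\geq0}\times X_o$. Let $K:=\{(t,x): B(t,x)\le 0\}$ (interior taken in $\mathbb{R}_{\geq0}\times\mathbb{R}^n$).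 Property $(\star\star)$: there is an open neighborhood $U(K)$ of $K$ such that, along each solution of $(\dot t,\dot x)\in\{1\}\times F(x)$ starting from a point of $U(K)\setminus\operatorname{int}(K)$ and remaining in $U(K)\setminus\operatorname{int}(K)$ on a time interval, the map $t\mapsto B(t,\phi(t))$ is nonincreasing on that interval. $F$ is upper semicontinuous if for each $x$, $\epsilon>0$ there is a neighborhood $U$ of $x$ with $F(y)\subset F(x)+\epsilon\mathbb{B}$ for $y\in U$. $F$ is locally Lipschitz if for each compact $K_o\subset\mathbb{R}^n$ there is $k>0$ with $F(x_1)\subset F(x_2)+k|x_1-x_2|\mathbb{B}$ for all $x_1,x_2\in K_o$. *)

theory Defs
  imports "HOL-Analysis.Analysis"
begin

definition abs_cont_on :: "real \<Rightarrow> real \<Rightarrow> (real \<Rightarrow> 'a::real_normed_vector) \<Rightarrow> bool" where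
  "abs_cont_on s t \<phi> \<longleftrightarrow>
     (\<forall>\<epsilon>>0. \<exists>\<delta>>0. \<forall>(n::nat) (a::nat \<Rightarrow> real) (b::nat \<Rightarrow> real).
        (\<forall>k<n. s \<le> a k \<and> a k \<le> b k \<and> b k \<le> t) \<and>
        (\<forall>i<n. \<forall>j<n. i \<noteq> j \<longrightarrow> b i \<le> a j \<or> b j \<le> a i) \<and>
        (\<Sum>k<n. b k - a k) < \<delta>
        \<longrightarrow> (\<Sum>k<n. norm (\<phi> (b k) - \<phi> (a k))) < \<epsilon>)"

definition loc_abs_cont_on :: "real set \<Rightarrow> (real \<Rightarrow> 'a::real_normed_vector) \<Rightarrow> bool" where
  "loc_abs_cont_on D \<phi> \<longleftrightarrow> (\<forall>s t. s \<le> t \<and> {s..t} \<subseteq> D \<longrightarrow> abs_cont_on s t \<phi>)"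

definition sol_domain :: "real set \<Rightarrow> bool" where
  "sol_domain D \<longleftrightarrow> (\<exists>T\<ge>0. D = {0..T}) \<or> (\<exists>T\<ge>0. D = {0..<T}) \<or> D = {0..}"

definition is_solution ::
  "('a::euclidean_space \<Rightarrow> 'a set) \<Rightarrow> 'a \<Rightarrow> real set \<Rightarrow> (real \<Rightarrow> 'a) \<Rightarrow> bool" where
  "is_solution F x0 D \<phi> \<longleftrightarrow>
     sol_domain D \<and> 0 \<in> D \<and> loc_abs_cont_on D \<phi> \<and> \<phi> 0 = x0 \<and>
     (\<exists>N. negligible N \<and>
        (\<forall>t\<in>D - N. \<exists>v. (\<phi> has_vector_derivative v) (at t within D) \<and> v \<in> F (\<phi> t)))"

definition is_maximal_solution ::
  "('a::euclidean_space \<Rightarrow> 'a set) \<Rightarrow> 'a \<Rightarrow> real set \<Rightarrow> (real \<Rightarrow> 'a) \<Rightarrow> bool" where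
  "is_maximal_solution F x0 D \<phi> \<longleftrightarrow>
     is_solution F x0 D \<phi> \<and>
     \<not> (\<exists>D' \<psi>. is_solution F x0 D' \<psi> \<and> D \<subset> D' \<and> (\<forall>t\<in>D. \<psi> t = \<phi> t))"

definition forward_complete :: "('a::euclidean_space \<Rightarrow> 'a set) \<Rightarrow> bool" where
  "forward_complete F \<longleftrightarrow>
     (\<forall>x0 D \<phi>. is_maximal_solution F x0 D \<phi> \<longrightarrow> \<not> bounded D)"

definition backward_complete :: "('a::euclidean_space \<Rightarrow> 'a set) \<Rightarrow> bool" where
  "backward_complete F \<longleftrightarrow> forward_complete (\<lambda>x. uminus ` F x)"

definition safe :: "('a::euclidean_space \<Rightarrow> 'a set) \<Rightarrow> 'a set \<Rightarrow> 'a set \<Rightarrow> bool" where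
  "safe F Xo Xu \<longleftrightarrow>
     (\<forall>x0 D \<phi>. x0 \<in> Xo \<and> is_solution F x0 D \<phi> \<longrightarrow> (\<forall>t\<in>D. \<phi> t \<notin> Xu))"

definition enlarge :: "'a::real_normed_vector set \<Rightarrow> real \<Rightarrow> 'a set" where
  "enlarge A r = {a + b | a b. a \<in> A \<and> b \<in> cball 0 r}"

definition usc_setvalued :: "('a::euclidean_space \<Rightarrow> 'a set) \<Rightarrow> bool" where
  "usc_setvalued F \<longleftrightarrow>
     (\<forall>x. \<forall>\<epsilon>>0. \<exists>U. open U \<and> x \<in> U \<and> (\<forall>y\<in>U. F y \<subseteq> enlarge (F x) \<epsilon>))"

definition loc_lipschitz_setvalued :: "('a::euclidean_space \<Rightarrow> 'a set) \<Rightarrow> bool" where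
  "loc_lipschitz_setvalued F \<longleftrightarrow>
     (\<forall>Ko. compact Ko \<longrightarrow> (\<exists>k>0. \<forall>x1\<in>Ko. \<forall>x2\<in>Ko. F x1 \<subseteq> enlarge (F x2) (k * norm (x1 - x2))))"

definition barrier_candidate :: "(real \<Rightarrow> 'a \<Rightarrow> real) \<Rightarrow> 'a set \<Rightarrow> 'a set \<Rightarrow> bool" where
  "barrier_candidate B Xo Xu \<longleftrightarrow>
     (\<forall>t\<ge>0. \<forall>x\<in>Xu. B t x > 0) \<and> (\<forall>t\<ge>0. \<forall>x\<in>Xo. B t x \<le> 0)"

definition loc_lipschitz_tv :: "(real \<Rightarrow> 'a::euclidean_space \<Rightarrow> real) \<Rightarrow> bool" where
  "loc_lipschitz_tv B \<longleftrightarrow>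
     (\<forall>C. compact C \<and> C \<subseteq> {0..} \<times> UNIV \<longrightarrow> (\<exists>L. L-lipschitz_on C (\<lambda>(t,x). B t x)))"

definition sublevel_K :: "(real \<Rightarrow> 'a \<Rightarrow> real) \<Rightarrow> (real \<times> 'a) set" where
  "sublevel_K B = {(t,x). t \<ge> 0 \<and> B t x \<le> 0}"

definition augmented :: "('a::euclidean_space \<Rightarrow> 'a set) \<Rightarrow> real \<times> 'a \<Rightarrow> (real \<times> 'a) set" where
  "augmented F = (\<lambda>(t,x). {1} \<times> F x)"

definition star_star :: "('a::euclidean_space \<Rightarrow> 'a set) \<Rightarrow> (real \<Rightarrow> 'a \<Rightarrow> real) \<Rightarrow> bool" where
  "star_star F B \<longleftrightarrow>
     (\<exists>U. openin (top_of_set ({0..} \<times> UNIV)) U \<and> sublevel_K B \<subseteq> U \<and>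
        (let W = U - (top_of_set ({0..} \<times> UNIV)) interior_of (sublevel_K B) in
         \<forall>z0 D \<psi> I. z0 \<in> W \<and> is_solution (augmented F) z0 D \<psi> \<and>
            is_interval I \<and> 0 \<in> I \<and> I \<subseteq> D \<and> (\<forall>s\<in>I. \<psi> s \<in> W) \<longrightarrow>
            (\<forall>s1\<in>I. \<forall>s2\<in>I. s1 \<le> s2 \<longrightarrow> B (fst (\<psi> s2)) (snd (\<psi> s2)) \<le> B (fst (\<psi> s1)) (snd (\<psi> s1)))))"

end

theory Submission
  imports Defs "HOL-Complex_Analysis.Great_Picard"
begin

text \<open>
  Write \<open>G = -F\<close>. If the system is safe, the barrier is
  \<open>B(t,x) = inf {dist(y, X\<^sub>o) | y reachable from x along G within time t}\<close>, which is nonincreasing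
  along every solution of \<open>F\<close>, because going back along that solution is one admissible way to
  continue. Positivity on \<open>X\<^sub>u\<close> needs the reachable sets of \<open>G\<close> to be compact, and local Lipschitz
  continuity needs Filippov's theorem: a solution from \<open>x\<close> can be tracked from a nearby \<open>y\<close> with
  error at most \<open>|x - y| e\<^sup>k\<^sup>t\<close>.

  Both rest on one observation: a curve \<open>\<phi>\<close> on a segment is a solution iff its difference
  quotients over \<open>[s,t]\<close> are within \<open>c (t - s)\<close> of \<open>G (\<phi> s)\<close> for some constant \<open>c\<close>. This condition
  passes to pointwise limits and is satisfied approximately by Euler polygons. Boundedness of the
  reachable sets follows from completeness: if the sets reached from \<open>x\<close> within time \<open>T\<close> are
  unbounded, then some solution leads in a short time \<open>\<delta>\<close> to a point from which those within time
  \<open>T - \<delta>\<close> are again unbounded; iterating yields a maximal solution that blows up before time \<open>T\<close>.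

  Conversely, at the last time a solution with \<open>B \<le> 0\<close> leaves \<open>K\<close> it is in \<open>U(K)\<close> outside the
  interior of \<open>K\<close>, so \<open>B\<close> cannot become positive.
\<close>

text \<open>\<open>B\<close> depends on time because reachable sets over an unbounded horizon need
  not be bounded: the infimum could then be 0 without being attained. Over a finite horizon
  completeness makes these sets compact. A zero of \<open>B\<close> at a point of \<open>Xu\<close>
  is therefore attained, and reversing the corresponding solution of \<open>G\<close> yields a
  solution of \<open>F\<close> from \<open>Xo\<close> to that point, which safety forbids. Allowing
  every duration up to \<open>t\<close>, zero included, makes \<open>B\<close> vanish on
  \<open>Xo\<close>. The obstacle is that velocity bounds and Lipschitz constants of
  \<open>G\<close> are available on balls only. Every estimate must first confine the curves
  concerned to a ball, by stopping them when they reach its boundary or by an a priori error bound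
  of at most 1; this is the source of the radii \<open>R + 1\<close> and of the smallness conditions
  on \<open>norm (x - y) * exp (k * t)\<close>. The theorem on differentiability almost everywhere
  serves to turn the condition on difference quotients back into a solution. Absolute continuity
  enters through the mean velocity over an interval, which lies in any closed convex set containing
  the velocities.\<close>

section \<open>Almost everywhere differentiability of Lipschitz curves\<close>

text \<open>Adding a linear function makes \<open>f\<close> a bi-Lipschitz increasing bijection \<open>F\<close>. The measure
  \<open>A \<mapsto> \<lambda>(F A)\<close> is absolutely continuous, and its density integrates to \<open>F\<close>.\<close>

lemma lipschitz_real_ae_differentiable:
  fixes f :: "real \<Rightarrow> real"
  assumes lip: "L-lipschitz_on UNIV f"
  obtains N where "negligible N" "\<And>x. x \<notin> N \<Longrightarrow> \<exists>d. (f has_real_derivative d) (at x)"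
proof -
  have L: "L \<ge> 0" using lip lipschitz_on_nonneg by blast
  \<comment> \<open>The slopes of \<open>f\<close> are at least \<open>-L\<close>, so those of
    \<open>F\<close> are at least 1: this makes \<open>F\<close> injective and onto and its inverse
    \<open>H\<close> 1-Lipschitz.\<close>
  define F where "F x = f x + (L + 1) * x" for x
  have fb: "\<bar>f y - f x\<bar> \<le> L * \<bar>y - x\<bar>" for x y
    using lipschitz_onD[OF lip, of y x] by (simp add: dist_real_def)
  have Flow: "F y - F x \<ge> y - x" if "x \<le> y" for x y
    using fb[of y x] that unfolding F_def by (simp add: algebra_simps)
  have Fup: "\<bar>F y - F x\<bar> \<le> (2 * L + 1) * \<bar>y - x\<bar>" for x y
  proof -
    have "F y - F x = (f y - f x) + (L + 1) * (y - x)"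
      by (simp add: F_def algebra_simps)
    then have "\<bar>F y - F x\<bar> \<le> \<bar>f y - f x\<bar> + \<bar>(L + 1) * (y - x)\<bar>" by linarith
    also have "\<dots> \<le> L * \<bar>y - x\<bar> + (L + 1) * \<bar>y - x\<bar>"
      using fb[of y x] L by (simp add: abs_mult)
    finally show ?thesis by (simp add: algebra_simps)
  qed
  have contF: "continuous_on S F" for S
  proof -
    have "continuous_on UNIV f" using lip lipschitz_on_continuous_on by blast
    then have "continuous_on S f" using continuous_on_subset by blast
    then show ?thesis unfolding F_def by (intro continuous_intros)
  qed
  have Fmono: "F x < F y \<longleftrightarrow> x < y" "F x \<le> F y \<longleftrightarrow> x \<le> y" for x y
    using Flow[of x y] Flow[of y x] by linarith+
  have inj: "inj F"
  proof (rule injI)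
    fix x y assume "F x = F y"
    then show "x = y" using Fmono(2)[of x y] Fmono(2)[of y x] by simp
  qed
  have surj: "surj F"
    unfolding surj_def
  proof
    fix y
    define r where "r = \<bar>y - F 0\<bar>"
    have "F (- r) \<le> y" using Flow[of "-r" 0] unfolding r_def by linarith
    moreover have "y \<le> F r" using Flow[of 0 r] unfolding r_def by linarith
    ultimately obtain x where "F x = y"
      using IVT'[of F "-r" y r] contF unfolding r_def by auto
    then show "\<exists>x. y = F x" by auto
  qed
  define H where "H = inv F"
  have HF: "H (F x) = x" and FH: "F (H y) = y" for x y
    unfolding H_def using inj surj by (simp_all add: inv_f_f surj_f_inv_f)
  have "1-lipschitz_on UNIV H"
  proof (rule lipschitz_onI)
    fix x y
    show "dist (H x) (H y) \<le> 1 * dist x y"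
      using Flow[of "H x" "H y", unfolded FH] Flow[of "H y" "H x", unfolded FH]
      unfolding dist_real_def by (cases "H x \<le> H y") auto
  qed simp
  then have "continuous_on UNIV H" using lipschitz_on_continuous_on by blast
  then have Hm[measurable]: "H \<in> borel_measurable borel"
    by (rule borel_measurable_continuous_onI)
  have vimage: "H -` A = F ` A" for A
  proof
    show "H -` A \<subseteq> F ` A" using FH by (metis image_eqI subsetI vimageD)
    show "F ` A \<subseteq> H -` A" using HF by auto
  qed
  \<comment> \<open>The preimage of a set under \<open>H\<close> is its image under
    \<open>F\<close>, so \<open>\<mu>\<close> gives the interval from \<open>a\<close> to
    \<open>b\<close> the mass \<open>F b - F a\<close>.\<close>
  define \<mu> where "\<mu> = distr lborel borel H"
  have sets: "sets \<mu> = sets lborel" by (simp add: \<mu>_def)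
  have em: "emeasure \<mu> A = emeasure lborel (F ` A)" if "A \<in> sets borel" for A
    unfolding \<mu>_def using that by (simp add: emeasure_distr vimage)
  have "absolutely_continuous lborel \<mu>"
    unfolding absolutely_continuous_def
  proof
    fix A :: "real set" assume A: "A \<in> null_sets lborel"
    then have "negligible A"
      by (simp add: negligible_iff_null_sets null_sets_completionI)
    moreover have "\<exists>T B. open T \<and> x \<in> T \<and> (\<forall>y\<in>A \<inter> T. norm (F y - F x) \<le> B * norm (y - x))" for x
      by (rule exI[of _ UNIV], rule exI[of _ "2 * L + 1"]) (use Fup in auto)
    ultimately have "negligible (F ` A)"
      by (intro negligible_locally_Lipschitz_image) auto
    moreover have "F ` A \<in> sets lborel"
      using A measurable_sets[of H borel borel A] by (auto simp: vimage[symmetric])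
    ultimately have "emeasure lborel (F ` A) = 0"
      by (simp add: negligible_iff_emeasure0)
    then show "A \<in> null_sets \<mu>"
      using A em by (auto intro!: null_setsI simp: sets)
  qed
  then obtain h where h[measurable]: "h \<in> borel_measurable lborel" and dens: "density lborel h = \<mu>"
    using sigma_finite_measure.Radon_Nikodym[OF lborel.sigma_finite_measure_axioms _ sets] by blast
  \<comment> \<open>The density may be infinite at some points, where \<open>enn2real\<close> puts
    0. Finite mass on bounded intervals confines these points to a null set, so integrals are
    unchanged.\<close>
  define g where "g x = enn2real (h x)" for x
  have gm[measurable]: "g \<in> borel_measurable borel" unfolding g_def using h by simp
  have img: "F ` {a..b} = {F a..F b}" for a b
  proof
    show "{F a..F b} \<subseteq> F ` {a..b}"
    proof
      fix y assume "y \<in> {F a..F b}"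
      then have "H y \<in> {a..b}" using Fmono(2)[of a "H y"] Fmono(2)[of "H y" b] FH by auto
      then show "y \<in> F ` {a..b}" using FH by (metis imageI)
    qed
  qed (auto simp: Fmono)
  have hint: "(g has_integral (F b - F a)) {a..b}" if "a \<le> b" for a b
  proof -
    have nn: "(\<integral>\<^sup>+x. h x * indicator {a..b} x \<partial>lborel) = ennreal (F b - F a)"
    proof -
      have "(\<integral>\<^sup>+x. h x * indicator {a..b} x \<partial>lborel) = emeasure \<mu> {a..b}"
        unfolding dens[symmetric] by (subst emeasure_density) auto
      also have "\<dots> = ennreal (F b - F a)"
        using that by (simp add: em img Fmono)
      finally show ?thesis .
    qed
    have "AE x in lborel. h x * indicator {a..b} x \<noteq> \<infinity>"
      by (rule nn_integral_PInf_AE) (auto simp: nn)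
    then have "(\<integral>\<^sup>+x. ennreal (g x * indicator {a..b} x) \<partial>lborel) = (\<integral>\<^sup>+x. h x * indicator {a..b} x \<partial>lborel)"
      by (intro nn_integral_cong_AE)
         (auto elim!: eventually_mono simp: g_def indicator_def less_top split: if_splits)
    then have "((\<lambda>x. g x * indicator {a..b} x) has_integral (F b - F a)) UNIV"
      using that Fmono(2)[of a b] by (intro nn_integral_has_integral) (auto simp: nn g_def)
    moreover have "(\<lambda>x. g x * indicator {a..b} x) = (\<lambda>x. if x \<in> {a..b} then g x else 0)"
      by (auto simp: indicator_def)
    ultimately show ?thesis by (metis has_integral_restrict_UNIV)
  qed
  have gi: "integral {a..b} g = F b - F a" if "a \<le> b" for a b
    using hint[OF that] by (rule integral_unique)
  have gint: "g integrable_on cbox a b" for a b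
    using hint[of a b] by (cases "a \<le> b") auto
  \<comment> \<open>Lebesgue differentiation is applied to averages over intervals that start at the
    point. The reflected density supplies the averages over intervals that end there, hence the left
    difference quotients.\<close>
  have gint': "(\<lambda>x. g (- x)) integrable_on cbox a b" for a b
    using gint[of "-b" "-a"] integrable_reflect[where f=g and a="-b" and b="-a"] by (simp flip: box_real)
  obtain N1 where N1: "negligible N1" "\<And>x e. \<lbrakk>x \<notin> N1; 0 < e\<rbrakk> \<Longrightarrow>
       \<exists>d>0. \<forall>h. 0 < h \<and> h < d \<longrightarrow> norm (integral (cbox x (x + h *\<^sub>R One)) g /\<^sub>R h ^ DIM(real) - g x) < e"
    using integrable_ccontinuous_explicit[OF gint] by metis
  obtain N2 where N2: "negligible N2" "\<And>x e. \<lbrakk>x \<notin> N2; 0 < e\<rbrakk> \<Longrightarrow>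
       \<exists>d>0. \<forall>h. 0 < h \<and> h < d \<longrightarrow>
         norm (integral (cbox x (x + h *\<^sub>R One)) (\<lambda>x. g (-x)) /\<^sub>R h ^ DIM(real) - g (-x)) < e"
    using integrable_ccontinuous_explicit[OF gint'] by metis
  have "negligible (uminus ` N2)"
    by (rule negligible_locally_Lipschitz_image)
       (use N2 in \<open>auto intro!: exI[of _ UNIV] exI[of _ "1::real"]\<close>)
  then have "negligible (N1 \<union> uminus ` N2)" using N1 by auto
  moreover have "\<exists>d. (f has_real_derivative d) (at x)" if x: "x \<notin> N1 \<union> uminus ` N2" for x
  proof -
    have x2: "- x \<notin> N2" using x by force
    have "((\<lambda>y. (F y - F x) / (y - x)) \<longlongrightarrow> g x) (at x)"
    proof (rule LIM_I)
      fix e :: real assume e: "0 < e"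
      obtain d1 where d1: "d1 > 0" "\<And>h. 0 < h \<and> h < d1 \<Longrightarrow> \<bar>(F (x + h) - F x) / h - g x\<bar> < e"
        using N1(2)[of x e] x e gi[of x] by (auto simp: divide_inverse_commute)
      have rfl: "integral {- x..h - x} (\<lambda>x. g (- x)) = F x - F (x - h)" if "h > 0" for h
        using Henstock_Kurzweil_Integration.integral_reflect_real[where f=g and a="x - h" and b=x] gi[of "x - h" x] that by simp
      obtain d2 where d2: "d2 > 0" "\<And>h. 0 < h \<and> h < d2 \<Longrightarrow> \<bar>(F x - F (x - h)) / h - g x\<bar> < e"
        using N2(2)[OF x2 e] by (auto simp: rfl divide_inverse_commute)
      show "\<exists>s>0. \<forall>y. y \<noteq> x \<and> norm (y - x) < s \<longrightarrow> norm ((F y - F x) / (y - x) - g x) < e"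
      proof (intro exI[of _ "min d1 d2"] conjI allI impI)
        fix y assume y: "y \<noteq> x \<and> norm (y - x) < min d1 d2"
        show "norm ((F y - F x) / (y - x) - g x) < e"
        proof (cases "y > x")
          case True
          then show ?thesis using d1(2)[of "y - x"] y by auto
        next
          case False
          then have "\<bar>(F x - F y) / (x - y) - g x\<bar> < e"
            using d2(2)[of "x - y"] y by auto
          moreover have "(F x - F y) / (x - y) = (F y - F x) / (y - x)"
            by (metis minus_diff_eq minus_divide_divide)
          ultimately show ?thesis by simp
        qed
      qed (use d1 d2 in auto)
    qed
    then have "(F has_real_derivative g x) (at x)" by (simp add: has_field_derivative_iff)
    then have "((\<lambda>y. F y - (L + 1) * y) has_real_derivative (g x - (L + 1))) (at x)"
      by (auto intro!: derivative_eq_intros)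
    moreover have "(\<lambda>y. F y - (L + 1) * y) = f" by (auto simp: F_def)
    ultimately show ?thesis by auto
  qed
  ultimately show thesis using that by blast
qed

lemma lipschitz_ae_vector_differentiable:
  fixes f :: "real \<Rightarrow> 'a::euclidean_space"
  assumes lip: "L-lipschitz_on UNIV f"
  obtains N where "negligible N" "\<And>x. x \<notin> N \<Longrightarrow> \<exists>v. (f has_vector_derivative v) (at x)"
proof -
  have "\<exists>N. negligible N \<and> (\<forall>x. x \<notin> N \<longrightarrow> (\<exists>d. ((\<lambda>t. f t \<bullet> i) has_real_derivative d) (at x)))"
    if i: "i \<in> Basis" for i
  proof -
    have "L-lipschitz_on UNIV (\<lambda>t. f t \<bullet> i)"
    proof (rule lipschitz_onI)
      fix x y
      have "\<bar>(f x - f y) \<bullet> i\<bar> \<le> norm (f x - f y)" using i by (rule Basis_le_norm)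
      also have "\<dots> \<le> L * dist x y" using lipschitz_onD[OF lip, of x y] by (simp add: dist_norm)
      finally show "dist (f x \<bullet> i) (f y \<bullet> i) \<le> L * dist x y"
        by (simp add: dist_real_def inner_diff_left)
    qed (use lip lipschitz_on_nonneg in blast)
    then show ?thesis by (metis lipschitz_real_ae_differentiable)
  qed
  then obtain N where N: "\<And>i. i \<in> Basis \<Longrightarrow> negligible (N i)"
    "\<And>i x. i \<in> Basis \<Longrightarrow> x \<notin> N i \<Longrightarrow> \<exists>d. ((\<lambda>t. f t \<bullet> i) has_real_derivative d) (at x)"
    by metis
  have "negligible (\<Union>i\<in>Basis. N i)" using N by (intro negligible_Union) auto
  moreover have "\<exists>v. (f has_vector_derivative v) (at x)" if x: "x \<notin> (\<Union>i\<in>Basis. N i)" for x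
  proof -
    have "(\<lambda>t. f t \<bullet> i) differentiable (at x)" if "i \<in> Basis" for i
      using N(2)[OF that] x that by (auto simp: real_differentiable_def)
    then have "f differentiable (at x)"
      by (subst differentiable_componentwise_within) auto
    then show ?thesis using vector_derivative_works by blast
  qed
  ultimately show thesis using that by blast
qed

section \<open>Absolutely continuous curves\<close>

text \<open>A gauge argument: on tags in the exceptional set the gauge forces the intervals into an open set
  of small measure, where absolute continuity bounds the increments.\<close>

lemma abs_cont_real_increment_le:
  fixes g :: "real \<Rightarrow> real"
  assumes ac: "abs_cont_on a b g" and ab: "a \<le> b" and N: "negligible N"
    and der: "\<And>t. t \<in> {a..b} - N \<Longrightarrow> \<exists>d\<le>c. (g has_real_derivative d) (at t within {a..b})"
  shows "g b - g a \<le> c * (b - a)"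
proof (rule field_le_epsilon)
  fix e :: real assume e: "0 < e"
  define e1 where "e1 = e / (3 * (b - a + 1))"
  have e1: "e1 > 0" "e1 * (b - a) \<le> e / 3"
    using e ab unfolding e1_def by (auto simp: field_simps)
  obtain \<delta> where \<delta>: "\<delta> > 0" and acd: "\<And>n u v. \<lbrakk>\<And>k. k < n \<Longrightarrow> a \<le> u k \<and> u k \<le> v k \<and> v k \<le> b;
      \<And>i j. \<lbrakk>i < n; j < n; i \<noteq> j\<rbrakk> \<Longrightarrow> v i \<le> u j \<or> v j \<le> u i;
      (\<Sum>k<n::nat. v k - u k) < \<delta>\<rbrakk> \<Longrightarrow> (\<Sum>k<n. norm (g (v k) - g (u k))) < e / 3"
    using ac[unfolded abs_cont_on_def, rule_format, of "e / 3"] e by auto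
  \<comment> \<open>The first bound activates absolute continuity; the second makes
    \<open>\<bar>c\<bar>\<close> times the total length of the exceptional intervals at most
    \<open>e / 3\<close>.\<close>
  define \<delta>' where "\<delta>' = min \<delta> (e / (3 * (\<bar>c\<bar> + 1)))"
  have \<delta>': "\<delta>' > 0" "\<delta>' \<le> \<delta>" using \<delta> e by (auto simp: \<delta>'_def)
  have c\<delta>': "\<bar>c\<bar> * \<delta>' \<le> e / 3"
  proof -
    have "\<bar>c\<bar> * \<delta>' \<le> (\<bar>c\<bar> + 1) * (e / (3 * (\<bar>c\<bar> + 1)))"
      using \<delta>' e by (intro mult_mono) (auto simp: \<delta>'_def)
    also have "\<dots> = e / 3" using e by (simp add: field_simps)
    finally show ?thesis .
  qed
  obtain G where G: "open G" "N \<subseteq> G" "G - N \<in> lmeasurable" "emeasure lebesgue (G - N) < ennreal \<delta>'"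
    using sets_lebesgue_outer_open[of N \<delta>'] \<delta>' N negligible_imp_sets by blast
  have Gm: "G \<in> lmeasurable"
    using fmeasurable.Un[OF G(3) negligible_imp_measurable[OF N]] G(2) by (simp add: Un_absorb2)
  have Gd: "measure lebesgue G < \<delta>'"
  proof -
    have "measure lebesgue G = measure lebesgue (G - N)"
      using measure_Diff_null_set[of G lebesgue N] N Gm by (simp add: negligible_iff_null_sets fmeasurableD)
    also have "\<dots> < \<delta>'"
      using G(3,4) \<delta>' by (simp add: emeasure_eq_measure2 ennreal_less_iff)
    finally show ?thesis .
  qed
  \<comment> \<open>Straddling estimate: near a good tag the increments on its two sides are bounded
    separately, so they add up on any small interval containing the tag.\<close>
  have "\<exists>\<eta>>0. \<forall>y\<in>{a..b}. \<bar>y - t\<bar> < \<eta> \<longrightarrow>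
      (y \<ge> t \<longrightarrow> g y - g t \<le> (c + e1) * (y - t)) \<and> (y \<le> t \<longrightarrow> g t - g y \<le> (c + e1) * (t - y))"
    if t: "t \<in> {a..b} - N" for t
  proof -
    obtain d where d: "d \<le> c" "(g has_real_derivative d) (at t within {a..b})" using der[OF t] by auto
    then obtain \<eta> where \<eta>: "\<eta> > 0" "\<And>y. y \<in> {a..b} \<Longrightarrow> norm (y - t) < \<eta> \<Longrightarrow>
        norm (g y - g t - d * (y - t)) \<le> e1 * norm (y - t)"
      using e1 unfolding has_field_derivative_def has_derivative_within_alt by (metis mult.commute)
    show ?thesis
    proof (intro exI[of _ \<eta>] conjI ballI impI \<eta>(1))
      fix y assume y: "y \<in> {a..b}" "\<bar>y - t\<bar> < \<eta>"
      { assume "t \<le> y"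
        then have "g y - g t \<le> d * (y - t) + e1 * (y - t)" using \<eta>(2)[of y] y by auto
        also have "\<dots> \<le> (c + e1) * (y - t)" using d \<open>t \<le> y\<close> by (simp add: distrib_right mult_right_mono)
        finally show "g y - g t \<le> (c + e1) * (y - t)" . }
      { assume "y \<le> t"
        then have "g t - g y \<le> d * (t - y) + e1 * (t - y)"
          using \<eta>(2)[of y] y by (auto simp: algebra_simps abs_if split: if_splits)
        also have "\<dots> \<le> (c + e1) * (t - y)" using d \<open>y \<le> t\<close> by (simp add: distrib_right mult_right_mono)
        finally show "g t - g y \<le> (c + e1) * (t - y)" . }
    qed
  qed
  then obtain \<eta> where \<eta>: "\<And>t. t \<in> {a..b} - N \<Longrightarrow> \<eta> t > 0"
    "\<And>t y. \<lbrakk>t \<in> {a..b} - N; y \<in> {a..b}; \<bar>y - t\<bar> < \<eta> t\<rbrakk> \<Longrightarrow>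
      (y \<ge> t \<longrightarrow> g y - g t \<le> (c + e1) * (y - t)) \<and> (y \<le> t \<longrightarrow> g t - g y \<le> (c + e1) * (t - y))"
    by metis
  define \<gamma> where "\<gamma> t = (if t \<in> N then G else if t \<in> {a..b} then ball t (\<eta> t) else ball t 1)" for t
  have "gauge \<gamma>"
    unfolding gauge_def \<gamma>_def using G \<eta>(1) by auto
  then obtain p where p: "p tagged_division_of {a..b}" "\<gamma> fine p"
    using fine_division_exists_real by blast
  have fin: "finite p" using p(1) by (rule tagged_division_of_finite)
  have K: "\<exists>u v. K = {u..v} \<and> u \<le> v \<and> a \<le> u \<and> v \<le> b \<and> Inf K = u \<and> Sup K = v \<and> x \<in> {u..v} \<and> {u..v} \<subseteq> \<gamma> x"
    if xK: "(x, K) \<in> p" for x K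
  proof -
    obtain u v where uv: "K = {u..v}" using tagged_division_ofD(4)[OF p(1) xK] by auto
    have "x \<in> K" "K \<subseteq> {a..b}" using tagged_division_ofD(2,3)[OF p(1) xK] by auto
    moreover have "K \<subseteq> \<gamma> x" using p(2) xK by (auto simp: fine_def)
    ultimately show ?thesis using uv by auto
  qed
  \<comment> \<open>Degenerate intervals are excluded: one of them may lie inside another interval
    of the division, and disjoint interiors would then not order the two. Their increments are 0, so
    they are harmless in \<open>p - Q\<close>.\<close>
  define Q where "Q = {(x,K) \<in> p. x \<in> N \<and> Inf K < Sup K}"
  have Qp: "Q \<subseteq> p" "finite Q" using fin by (auto simp: Q_def intro: finite_subset)
  have Qsep: "Sup (snd z) \<le> Inf (snd w) \<or> Sup (snd w) \<le> Inf (snd z)"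
    if "z \<in> Q" "w \<in> Q" "z \<noteq> w" for z w
  proof -
    obtain x K where z: "z = (x,K)" by (cases z)
    obtain y J where w: "w = (y,J)" by (cases w)
    have zp: "(x,K) \<in> p" "Inf K < Sup K" and wp: "(y,J) \<in> p" "Inf J < Sup J"
      using that z w by (auto simp: Q_def)
    obtain u v where uv: "K = {u..v}" "Inf K = u" "Sup K = v" using K[OF zp(1)] by auto
    obtain u' v' where uv': "J = {u'..v'}" "Inf J = u'" "Sup J = v'" using K[OF wp(1)] by auto
    have int: "{u<..<v} \<inter> {u'<..<v'} = {}"
      using tagged_division_ofD(5)[OF p(1) zp(1) wp(1)] that z w uv uv' by auto
    show ?thesis
    proof (rule ccontr)
      assume "\<not> ?thesis"
      then have "max u u' < min v v'" using zp wp uv uv' z w by auto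
      then obtain m where "max u u' < m" "m < min v v'" using dense by blast
      then show False using int by auto
    qed
  qed
  have Qlen: "(\<Sum>z\<in>Q. Sup (snd z) - Inf (snd z)) < \<delta>'"
  proof -
    have Qint: "\<exists>u v. snd z = {u..v} \<and> u < v \<and> Inf (snd z) = u \<and> Sup (snd z) = v \<and> {u..v} \<subseteq> G" if "z \<in> Q" for z
    proof -
      have z: "(fst z, snd z) \<in> p" "fst z \<in> N" "Inf (snd z) < Sup (snd z)" using that by (auto simp: Q_def)
      then show ?thesis using K[OF z(1)] by (auto simp: \<gamma>_def)
    qed
    have "(\<Sum>z\<in>Q. Sup (snd z) - Inf (snd z)) = (\<Sum>z\<in>Q. measure lebesgue (snd z))"
    proof (rule sum.cong)
      fix z assume "z \<in> Q"
      then obtain u v where "snd z = {u..v}" "u < v" using Qint by blast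
      then show "Sup (snd z) - Inf (snd z) = measure lebesgue (snd z)" by simp
    qed simp
    also have "\<dots> = measure lebesgue (\<Union> (snd ` Q))"
    proof (rule measure_negligible_finite_Union_image[symmetric])
      show "finite Q" by fact
      show "snd z \<in> lmeasurable" if "z \<in> Q" for z
      proof -
        obtain u v where "snd z = {u..v}" using Qint \<open>z \<in> Q\<close> by blast
        then show ?thesis by (simp add: lmeasurable_interval)
      qed
      show "pairwise (\<lambda>z w. negligible (snd z \<inter> snd w)) Q"
        unfolding pairwise_def
      proof (intro ballI impI)
        fix z w assume zw: "z \<in> Q" "w \<in> Q" "z \<noteq> w"
        have "snd z \<inter> snd w \<subseteq> {Sup (snd z), Sup (snd w)}"
        proof -
          obtain u v where 1: "snd z = {u..v}" "Inf (snd z) = u" "Sup (snd z) = v" using Qint[OF zw(1)] by blast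
          obtain u' v' where 2: "snd w = {u'..v'}" "Inf (snd w) = u'" "Sup (snd w) = v'" using Qint[OF zw(2)] by blast
          show ?thesis using Qsep[OF zw] unfolding 1 2 by auto
        qed
        then show "negligible (snd z \<inter> snd w)"
          by (meson finite.intros negligible_finite negligible_subset)
      qed
    qed
    also have "\<dots> \<le> measure lebesgue G"
    proof (rule measure_mono_fmeasurable)
      show "\<Union> (snd ` Q) \<subseteq> G" using Qint by blast
      show "\<Union> (snd ` Q) \<in> sets lebesgue"
        proof (rule sets.finite_UN[OF Qp(2)])
        fix z assume "z \<in> Q"
        then obtain u v where "snd z = {u..v}" using Qint by blast
        then show "snd z \<in> sets lebesgue" by simp
      qed
    qed (rule Gm)
    finally show ?thesis using Gd by linarith
  qed
  have QAC: "(\<Sum>z\<in>Q. \<bar>g (Sup (snd z)) - g (Inf (snd z))\<bar>) < e / 3"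
  proof -
    obtain f where f: "bij_betw f {..<card Q} Q"
      using ex_bij_betw_nat_finite[OF Qp(2)] by (auto simp: atLeast0LessThan)
    have fQ: "f k \<in> Q" if "k < card Q" for k using f that by (auto simp: bij_betw_def)
    have "(\<Sum>k<card Q. norm (g (Sup (snd (f k))) - g (Inf (snd (f k))))) < e / 3"
    proof (rule acd)
      show "a \<le> Inf (snd (f k)) \<and> Inf (snd (f k)) \<le> Sup (snd (f k)) \<and> Sup (snd (f k)) \<le> b" if "k < card Q" for k
      proof -
        have "(fst (f k), snd (f k)) \<in> p" using fQ[OF that] Qp by auto
        then show ?thesis using K by blast
      qed
      show "Sup (snd (f i)) \<le> Inf (snd (f j)) \<or> Sup (snd (f j)) \<le> Inf (snd (f i))"
        if "i < card Q" "j < card Q" "i \<noteq> j" for i j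
        using Qsep[of "f i" "f j"] fQ that f by (auto simp: bij_betw_def inj_on_def)
      have "(\<Sum>k<card Q. Sup (snd (f k)) - Inf (snd (f k))) = (\<Sum>z\<in>Q. Sup (snd z) - Inf (snd z))"
        by (rule sum.reindex_bij_betw[OF f])
      then show "(\<Sum>k<card Q. Sup (snd (f k)) - Inf (snd (f k))) < \<delta>" using Qlen \<delta>' by linarith
    qed
    moreover have "(\<Sum>k<card Q. norm (g (Sup (snd (f k))) - g (Inf (snd (f k)))))
        = (\<Sum>z\<in>Q. norm (g (Sup (snd z)) - g (Inf (snd z))))"
      by (rule sum.reindex_bij_betw[OF f])
    ultimately show ?thesis by simp
  qed
  have incr: "g (Sup K) - g (Inf K) \<le> (c + e1) * (Sup K - Inf K)" if xK: "(x, K) \<in> p - Q" for x K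
  proof -
    obtain u v where uv: "K = {u..v}" "u \<le> v" "a \<le> u" "v \<le> b" "Inf K = u" "Sup K = v"
      "x \<in> {u..v}" "{u..v} \<subseteq> \<gamma> x" using K[OF DiffD1[OF xK]] by blast
    show ?thesis
    proof (cases "u = v")
      case True then show ?thesis using uv by simp
    next
      case False
      then have xN: "x \<in> {a..b} - N" using xK uv by (auto simp: Q_def)
      then have "\<bar>u - x\<bar> < \<eta> x" "\<bar>v - x\<bar> < \<eta> x"
        using uv(2,7,8) unfolding \<gamma>_def
        by (auto simp: subset_iff dist_real_def abs_minus_commute dest: spec[of _ u] spec[of _ v])
      then have "g v - g x \<le> (c + e1) * (v - x)" "g x - g u \<le> (c + e1) * (x - u)"
        using \<eta>(2)[OF xN, of v] \<eta>(2)[OF xN, of u] uv by auto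
      then have "g v - g u \<le> (c + e1) * (v - x) + (c + e1) * (x - u)" by linarith
      then show ?thesis using uv by (simp add: algebra_simps)
    qed
  qed
  define len where "len = (\<Sum>z\<in>Q. Sup (snd z) - Inf (snd z))"
  have l0: "len \<ge> 0" unfolding len_def by (rule sum_nonneg) (auto simp: Q_def)
  have tot: "(\<Sum>z\<in>p. f (Sup (snd z)) - f (Inf (snd z))) = f b - f a" for f :: "real \<Rightarrow> real"
    using additive_tagged_division_1[OF ab p(1), of f] by (simp add: case_prod_unfold)
  have split: "(\<Sum>z\<in>p. f z) = (\<Sum>z\<in>p - Q. f z) + (\<Sum>z\<in>Q. f z)" for f :: "_ \<Rightarrow> real"
    using sum.subset_diff[OF Qp(1) fin] by blast
  have "g b - g a = (\<Sum>z\<in>p - Q. g (Sup (snd z)) - g (Inf (snd z))) + (\<Sum>z\<in>Q. g (Sup (snd z)) - g (Inf (snd z)))"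
    using tot[of g] split by metis
  also have "\<dots> \<le> (\<Sum>z\<in>p - Q. (c + e1) * (Sup (snd z) - Inf (snd z))) + e / 3"
  proof (rule add_mono)
    show "(\<Sum>z\<in>p - Q. g (Sup (snd z)) - g (Inf (snd z))) \<le> (\<Sum>z\<in>p - Q. (c + e1) * (Sup (snd z) - Inf (snd z)))"
      by (rule sum_mono) (use incr in force)
    have "(\<Sum>z\<in>Q. g (Sup (snd z)) - g (Inf (snd z))) \<le> (\<Sum>z\<in>Q. \<bar>g (Sup (snd z)) - g (Inf (snd z))\<bar>)"
      by (rule sum_mono) auto
    then show "(\<Sum>z\<in>Q. g (Sup (snd z)) - g (Inf (snd z))) \<le> e / 3" using QAC by linarith
  qed
  also have "(\<Sum>z\<in>p - Q. (c + e1) * (Sup (snd z) - Inf (snd z))) = (c + e1) * (b - a - len)"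
    using split[of "\<lambda>z. Sup (snd z) - Inf (snd z)"] tot[of "\<lambda>x. x"] unfolding len_def
    by (simp add: sum_distrib_left[symmetric])
  also have "(c + e1) * (b - a - len) + e / 3 \<le> c * (b - a) + e"
  proof -
    have "- (c * len) \<le> \<bar>c\<bar> * len" using l0 by (cases "c \<ge> 0") auto
    also have "\<dots> \<le> \<bar>c\<bar> * \<delta>'" using Qlen unfolding len_def by (intro mult_left_mono) auto
    finally have "- (c * len) \<le> e / 3" using c\<delta>' by linarith
    moreover have "e1 * len \<ge> 0" using e1 l0 by simp
    moreover have "(c + e1) * (b - a - len) = c * (b - a) - c * len + e1 * (b - a) - e1 * len"
      by (simp add: algebra_simps)
    ultimately show ?thesis using e1(2) by linarith
  qed
  finally show "g b - g a \<le> c * (b - a) + e" .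
qed

lemma abs_cont_on_bounded_linear:
  assumes f: "bounded_linear f" and ac: "abs_cont_on a b \<phi>"
  shows "abs_cont_on a b (\<lambda>t. f (\<phi> t))"
  unfolding abs_cont_on_def
proof (intro allI impI)
  fix \<epsilon> :: real assume \<epsilon>: "\<epsilon> > 0"
  obtain K where K: "K > 0" "\<And>w. norm (f w) \<le> norm w * K" using bounded_linear.pos_bounded[OF f] by blast
  have "\<epsilon> / K > 0" using \<epsilon> K by simp
  then obtain \<delta> where \<delta>: "\<delta> > 0" "\<forall>(n::nat) u v. (\<forall>k<n. a \<le> u k \<and> u k \<le> v k \<and> v k \<le> b) \<and>
        (\<forall>i<n. \<forall>j<n. i \<noteq> j \<longrightarrow> v i \<le> u j \<or> v j \<le> u i) \<and> (\<Sum>k<n. v k - u k) < \<delta>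
        \<longrightarrow> (\<Sum>k<n. norm (\<phi> (v k) - \<phi> (u k))) < \<epsilon> / K"
    using ac unfolding abs_cont_on_def by blast
  show "\<exists>\<delta>>0. \<forall>(n::nat) u v. (\<forall>k<n. a \<le> u k \<and> u k \<le> v k \<and> v k \<le> b) \<and>
        (\<forall>i<n. \<forall>j<n. i \<noteq> j \<longrightarrow> v i \<le> u j \<or> v j \<le> u i) \<and> (\<Sum>k<n. v k - u k) < \<delta>
        \<longrightarrow> (\<Sum>k<n. norm (f (\<phi> (v k)) - f (\<phi> (u k)))) < \<epsilon>"
  proof (intro exI[of _ \<delta>] conjI allI impI \<delta>(1))
    fix n :: nat and u v :: "nat \<Rightarrow> real"
    assume "(\<forall>k<n. a \<le> u k \<and> u k \<le> v k \<and> v k \<le> b) \<and>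
        (\<forall>i<n. \<forall>j<n. i \<noteq> j \<longrightarrow> v i \<le> u j \<or> v j \<le> u i) \<and> (\<Sum>k<n. v k - u k) < \<delta>"
    then have s: "(\<Sum>k<n. norm (\<phi> (v k) - \<phi> (u k))) < \<epsilon> / K" using \<delta>(2) by blast
    have "(\<Sum>k<n. norm (f (\<phi> (v k)) - f (\<phi> (u k)))) \<le> (\<Sum>k<n. norm (\<phi> (v k) - \<phi> (u k)) * K)"
      by (intro sum_mono) (metis K(2) f linear_diff bounded_linear.linear)
    also have "\<dots> = (\<Sum>k<n. norm (\<phi> (v k) - \<phi> (u k))) * K" by (simp add: sum_distrib_right)
    also have "\<dots> < \<epsilon>" using s K(1) by (simp add: pos_less_divide_eq)
    finally show "(\<Sum>k<n. norm (f (\<phi> (v k)) - f (\<phi> (u k)))) < \<epsilon>" .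
  qed
qed

text \<open>A mean velocity outside \<open>C\<close> would be strictly separated from
  \<open>C\<close> by a hyperplane. Along the normal \<open>- p\<close> the curve would then violate
  the scalar increment bound.\<close>

lemma abs_cont_mean_velocity_in_convex:
  fixes \<phi> :: "real \<Rightarrow> 'a::euclidean_space"
  assumes ac: "abs_cont_on a b \<phi>" and ab: "a < b" and N: "negligible N"
    and der: "\<And>t. t \<in> {a..b} - N \<Longrightarrow> \<exists>v\<in>C. (\<phi> has_vector_derivative v) (at t within {a..b})"
    and C: "closed C" "convex C"
  shows "(\<phi> b - \<phi> a) /\<^sub>R (b - a) \<in> C"
proof (rule ccontr)
  assume "\<not> ?thesis"
  then obtain p \<beta> where p: "p \<bullet> ((\<phi> b - \<phi> a) /\<^sub>R (b - a)) < \<beta>" "\<And>x. x \<in> C \<Longrightarrow> p \<bullet> x > \<beta>"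
    using separating_hyperplane_closed_point[OF C(2,1)] by blast
  have "(- p) \<bullet> \<phi> b - (- p) \<bullet> \<phi> a \<le> (- \<beta>) * (b - a)"
  proof (rule abs_cont_real_increment_le[OF abs_cont_on_bounded_linear[OF bounded_linear_inner_right ac] _ N])
    fix t assume "t \<in> {a..b} - N"
    then obtain v where v: "v \<in> C" "(\<phi> has_vector_derivative v) (at t within {a..b})" using der by blast
    have "((\<lambda>t. (- p) \<bullet> \<phi> t) has_vector_derivative ((- p) \<bullet> v)) (at t within {a..b})"
      by (rule bounded_linear.has_vector_derivative[OF bounded_linear_inner_right v(2)])
    then show "\<exists>d\<le>- \<beta>. ((\<lambda>t. (- p) \<bullet> \<phi> t) has_real_derivative d) (at t within {a..b})"
      using p(2)[OF v(1)]
      by (intro exI[of _ "(- p) \<bullet> v"]) (auto simp: has_real_derivative_iff_has_vector_derivative)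
  qed (use ab in auto)
  then have "p \<bullet> (\<phi> b - \<phi> a) \<ge> \<beta> * (b - a)" by (simp add: inner_diff_right)
  moreover have "p \<bullet> (\<phi> b - \<phi> a) < \<beta> * (b - a)"
    using p(1) ab by (simp add: divide_inverse_commute[symmetric] pos_divide_less_eq)
  ultimately show False by simp
qed

section \<open>Elementary operations on absolutely continuous curves\<close>

lemma abs_cont_on_mono:
  assumes "abs_cont_on a b \<phi>" "a \<le> c" "d \<le> b"
  shows "abs_cont_on c d \<phi>"
  unfolding abs_cont_on_def
proof (intro allI impI)
  fix \<epsilon> :: real assume "\<epsilon> > 0"
  then obtain \<delta> where \<delta>: "\<delta> > 0" "\<forall>(n::nat) u v. (\<forall>k<n. a \<le> u k \<and> u k \<le> v k \<and> v k \<le> b) \<and>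
        (\<forall>i<n. \<forall>j<n. i \<noteq> j \<longrightarrow> v i \<le> u j \<or> v j \<le> u i) \<and> (\<Sum>k<n. v k - u k) < \<delta>
        \<longrightarrow> (\<Sum>k<n. norm (\<phi> (v k) - \<phi> (u k))) < \<epsilon>"
    using assms(1) unfolding abs_cont_on_def by blast
  show "\<exists>\<delta>>0. \<forall>(n::nat) u v. (\<forall>k<n. c \<le> u k \<and> u k \<le> v k \<and> v k \<le> d) \<and>
        (\<forall>i<n. \<forall>j<n. i \<noteq> j \<longrightarrow> v i \<le> u j \<or> v j \<le> u i) \<and> (\<Sum>k<n. v k - u k) < \<delta>
        \<longrightarrow> (\<Sum>k<n. norm (\<phi> (v k) - \<phi> (u k))) < \<epsilon>"
  proof (intro exI[of _ \<delta>] conjI allI impI \<delta>(1))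
    fix n :: nat and u v :: "nat \<Rightarrow> real"
    assume A: "(\<forall>k<n. c \<le> u k \<and> u k \<le> v k \<and> v k \<le> d) \<and>
        (\<forall>i<n. \<forall>j<n. i \<noteq> j \<longrightarrow> v i \<le> u j \<or> v j \<le> u i) \<and> (\<Sum>k<n. v k - u k) < \<delta>"
    then have "\<forall>k<n. a \<le> u k \<and> u k \<le> v k \<and> v k \<le> b"
      using assms(2,3) by (meson order_trans)
    then show "(\<Sum>k<n. norm (\<phi> (v k) - \<phi> (u k))) < \<epsilon>" using \<delta>(2) A by blast
  qed
qed

lemma abs_cont_on_imp_continuous_on:
  fixes \<phi> :: "real \<Rightarrow> 'a::real_normed_vector"
  assumes "abs_cont_on a b \<phi>"
  shows "continuous_on {a..b} \<phi>"
  unfolding continuous_on_iff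
proof (intro ballI allI impI)
  fix x and e :: real assume x: "x \<in> {a..b}" and e: "0 < e"
  obtain \<delta> where \<delta>: "\<delta> > 0" "\<And>(n::nat) u v. (\<forall>k<n. a \<le> u k \<and> u k \<le> v k \<and> v k \<le> b) \<and>
        (\<forall>i<n. \<forall>j<n. i \<noteq> j \<longrightarrow> v i \<le> u j \<or> v j \<le> u i) \<and> (\<Sum>k<n. v k - u k) < \<delta>
        \<Longrightarrow> (\<Sum>k<n. norm (\<phi> (v k) - \<phi> (u k))) < e"
    using assms e unfolding abs_cont_on_def by blast
  have *: "norm (\<phi> v - \<phi> u) < e" if "a \<le> u" "u \<le> v" "v \<le> b" "v - u < \<delta>" for u v
    using \<delta>(2)[of 1 "\<lambda>_. u" "\<lambda>_. v"] that by simp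
  show "\<exists>d>0. \<forall>x'\<in>{a..b}. dist x' x < d \<longrightarrow> dist (\<phi> x') (\<phi> x) < e"
  proof (intro exI[of _ \<delta>] conjI ballI impI \<delta>(1))
    fix y assume y: "y \<in> {a..b}" "dist y x < \<delta>"
    show "dist (\<phi> y) (\<phi> x) < e"
    proof (cases "x \<le> y")
      case True
      then show ?thesis using *[of x y] x y by (simp add: dist_norm)
    next
      case False
      then show ?thesis using *[of y x] x y by (simp add: dist_norm norm_minus_commute)
    qed
  qed
qed

lemma lipschitz_on_imp_abs_cont_on:
  fixes \<phi> :: "real \<Rightarrow> 'a::real_normed_vector"
  assumes "L-lipschitz_on {a..b} \<phi>"
  shows "abs_cont_on a b \<phi>"
  unfolding abs_cont_on_def
proof (intro allI impI)
  fix \<epsilon> :: real assume \<epsilon>: "\<epsilon> > 0"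
  have L: "L \<ge> 0" using assms lipschitz_on_nonneg by blast
  show "\<exists>\<delta>>0. \<forall>(n::nat) u v. (\<forall>k<n. a \<le> u k \<and> u k \<le> v k \<and> v k \<le> b) \<and>
        (\<forall>i<n. \<forall>j<n. i \<noteq> j \<longrightarrow> v i \<le> u j \<or> v j \<le> u i) \<and> (\<Sum>k<n. v k - u k) < \<delta>
        \<longrightarrow> (\<Sum>k<n. norm (\<phi> (v k) - \<phi> (u k))) < \<epsilon>"
  proof (intro exI[of _ "\<epsilon> / (L + 1)"] conjI allI impI)
    show "\<epsilon> / (L + 1) > 0" using \<epsilon> L by simp
    fix n :: nat and u v :: "nat \<Rightarrow> real"
    assume A: "(\<forall>k<n. a \<le> u k \<and> u k \<le> v k \<and> v k \<le> b) \<and>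
        (\<forall>i<n. \<forall>j<n. i \<noteq> j \<longrightarrow> v i \<le> u j \<or> v j \<le> u i) \<and> (\<Sum>k<n. v k - u k) < \<epsilon> / (L + 1)"
    have "(\<Sum>k<n. norm (\<phi> (v k) - \<phi> (u k))) \<le> (\<Sum>k<n. (L + 1) * (v k - u k))"
    proof (rule sum_mono)
      fix k assume "k \<in> {..<n}"
      then have k: "a \<le> u k" "u k \<le> v k" "v k \<le> b" using A by auto
      then have "norm (\<phi> (v k) - \<phi> (u k)) \<le> L * (v k - u k)"
        using lipschitz_onD[OF assms, of "v k" "u k"] by (simp add: dist_norm)
      then show "norm (\<phi> (v k) - \<phi> (u k)) \<le> (L + 1) * (v k - u k)"
        using k by (simp add: distrib_right)
    qed
    also have "\<dots> = (L + 1) * (\<Sum>k<n. v k - u k)" by (simp add: sum_distrib_left)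
    also have "\<dots> < (L + 1) * (\<epsilon> / (L + 1))" using A L by (intro mult_strict_left_mono) auto
    also have "\<dots> = \<epsilon>" using L by simp
    finally show "(\<Sum>k<n. norm (\<phi> (v k) - \<phi> (u k))) < \<epsilon>" .
  qed
qed

lemma abs_cont_on_shift:
  assumes "abs_cont_on (s + a) (s + b) \<phi>"
  shows "abs_cont_on a b (\<lambda>t. \<phi> (s + t))"
  unfolding abs_cont_on_def
proof (intro allI impI)
  fix \<epsilon> :: real assume "\<epsilon> > 0"
  then obtain \<delta> where \<delta>: "\<delta> > 0" "\<And>(n::nat) u v. (\<forall>k<n. s + a \<le> u k \<and> u k \<le> v k \<and> v k \<le> s + b) \<and>
        (\<forall>i<n. \<forall>j<n. i \<noteq> j \<longrightarrow> v i \<le> u j \<or> v j \<le> u i) \<and> (\<Sum>k<n. v k - u k) < \<delta>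
        \<Longrightarrow> (\<Sum>k<n. norm (\<phi> (v k) - \<phi> (u k))) < \<epsilon>"
    using assms(1) unfolding abs_cont_on_def by blast
  show "\<exists>\<delta>>0. \<forall>(n::nat) u v. (\<forall>k<n. a \<le> u k \<and> u k \<le> v k \<and> v k \<le> b) \<and>
        (\<forall>i<n. \<forall>j<n. i \<noteq> j \<longrightarrow> v i \<le> u j \<or> v j \<le> u i) \<and> (\<Sum>k<n. v k - u k) < \<delta>
        \<longrightarrow> (\<Sum>k<n. norm (\<phi> (s + v k) - \<phi> (s + u k))) < \<epsilon>"
  proof (intro exI[of _ \<delta>] conjI allI impI \<delta>(1))
    fix n :: nat and u v :: "nat \<Rightarrow> real"
    assume "(\<forall>k<n. a \<le> u k \<and> u k \<le> v k \<and> v k \<le> b) \<and>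
        (\<forall>i<n. \<forall>j<n. i \<noteq> j \<longrightarrow> v i \<le> u j \<or> v j \<le> u i) \<and> (\<Sum>k<n. v k - u k) < \<delta>"
    then show "(\<Sum>k<n. norm (\<phi> (s + v k) - \<phi> (s + u k))) < \<epsilon>"
      using \<delta>(2)[of n "\<lambda>k. s + u k" "\<lambda>k. s + v k"] by simp
  qed
qed

lemma abs_cont_on_reflect:
  assumes "abs_cont_on (T - b) (T - a) \<phi>"
  shows "abs_cont_on a b (\<lambda>t. \<phi> (T - t))"
  unfolding abs_cont_on_def
proof (intro allI impI)
  fix \<epsilon> :: real assume "\<epsilon> > 0"
  then obtain \<delta> where \<delta>: "\<delta> > 0" "\<And>(n::nat) u v. (\<forall>k<n. T - b \<le> u k \<and> u k \<le> v k \<and> v k \<le> T - a) \<and>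
        (\<forall>i<n. \<forall>j<n. i \<noteq> j \<longrightarrow> v i \<le> u j \<or> v j \<le> u i) \<and> (\<Sum>k<n. v k - u k) < \<delta>
        \<Longrightarrow> (\<Sum>k<n. norm (\<phi> (v k) - \<phi> (u k))) < \<epsilon>"
    using assms(1) unfolding abs_cont_on_def by blast
  show "\<exists>\<delta>>0. \<forall>(n::nat) u v. (\<forall>k<n. a \<le> u k \<and> u k \<le> v k \<and> v k \<le> b) \<and>
        (\<forall>i<n. \<forall>j<n. i \<noteq> j \<longrightarrow> v i \<le> u j \<or> v j \<le> u i) \<and> (\<Sum>k<n. v k - u k) < \<delta>
        \<longrightarrow> (\<Sum>k<n. norm (\<phi> (T - v k) - \<phi> (T - u k))) < \<epsilon>"
  proof (intro exI[of _ \<delta>] conjI allI impI \<delta>(1))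
    fix n :: nat and u v :: "nat \<Rightarrow> real"
    assume "(\<forall>k<n. a \<le> u k \<and> u k \<le> v k \<and> v k \<le> b) \<and>
        (\<forall>i<n. \<forall>j<n. i \<noteq> j \<longrightarrow> v i \<le> u j \<or> v j \<le> u i) \<and> (\<Sum>k<n. v k - u k) < \<delta>"
    then have "(\<Sum>k<n. norm (\<phi> (T - u k) - \<phi> (T - v k))) < \<epsilon>"
      using \<delta>(2)[of n "\<lambda>k. T - v k" "\<lambda>k. T - u k"] by auto
    then show "(\<Sum>k<n. norm (\<phi> (T - v k) - \<phi> (T - u k))) < \<epsilon>"
      by (simp add: norm_minus_commute)
  qed
qed

lemma abs_cont_on_Pair:
  assumes \<phi>: "abs_cont_on a b \<phi>" and \<psi>: "abs_cont_on a b \<psi>"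
  shows "abs_cont_on a b (\<lambda>t. (\<phi> t, \<psi> t))"
  unfolding abs_cont_on_def
proof (intro allI impI)
  fix \<epsilon> :: real assume "\<epsilon> > 0"
  then have \<epsilon>: "\<epsilon> / 2 > 0" by simp
  obtain \<delta>1 where \<delta>1: "\<delta>1 > 0" "\<And>(n::nat) u v. (\<forall>k<n. a \<le> u k \<and> u k \<le> v k \<and> v k \<le> b) \<and>
        (\<forall>i<n. \<forall>j<n. i \<noteq> j \<longrightarrow> v i \<le> u j \<or> v j \<le> u i) \<and> (\<Sum>k<n. v k - u k) < \<delta>1
        \<Longrightarrow> (\<Sum>k<n. norm (\<phi> (v k) - \<phi> (u k))) < \<epsilon> / 2"
    using \<phi> \<epsilon> unfolding abs_cont_on_def by blast
  obtain \<delta>2 where \<delta>2: "\<delta>2 > 0" "\<And>(n::nat) u v. (\<forall>k<n. a \<le> u k \<and> u k \<le> v k \<and> v k \<le> b) \<and>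
        (\<forall>i<n. \<forall>j<n. i \<noteq> j \<longrightarrow> v i \<le> u j \<or> v j \<le> u i) \<and> (\<Sum>k<n. v k - u k) < \<delta>2
        \<Longrightarrow> (\<Sum>k<n. norm (\<psi> (v k) - \<psi> (u k))) < \<epsilon> / 2"
    using \<psi> \<epsilon> unfolding abs_cont_on_def by blast
  show "\<exists>\<delta>>0. \<forall>(n::nat) u v. (\<forall>k<n. a \<le> u k \<and> u k \<le> v k \<and> v k \<le> b) \<and>
        (\<forall>i<n. \<forall>j<n. i \<noteq> j \<longrightarrow> v i \<le> u j \<or> v j \<le> u i) \<and> (\<Sum>k<n. v k - u k) < \<delta>
        \<longrightarrow> (\<Sum>k<n. norm ((\<phi> (v k), \<psi> (v k)) - (\<phi> (u k), \<psi> (u k)))) < \<epsilon>"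
  proof (intro exI[of _ "min \<delta>1 \<delta>2"] conjI allI impI)
    fix n :: nat and u v :: "nat \<Rightarrow> real"
    assume A: "(\<forall>k<n. a \<le> u k \<and> u k \<le> v k \<and> v k \<le> b) \<and>
        (\<forall>i<n. \<forall>j<n. i \<noteq> j \<longrightarrow> v i \<le> u j \<or> v j \<le> u i) \<and> (\<Sum>k<n. v k - u k) < min \<delta>1 \<delta>2"
    have "(\<Sum>k<n. norm (\<phi> (v k) - \<phi> (u k))) < \<epsilon> / 2" using A by (intro \<delta>1(2)) simp
    moreover have "(\<Sum>k<n. norm (\<psi> (v k) - \<psi> (u k))) < \<epsilon> / 2" using A by (intro \<delta>2(2)) simp
    moreover have "(\<Sum>k<n. norm ((\<phi> (v k), \<psi> (v k)) - (\<phi> (u k), \<psi> (u k))))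
        \<le> (\<Sum>k<n. norm (\<phi> (v k) - \<phi> (u k)) + norm (\<psi> (v k) - \<psi> (u k)))"
      by (intro sum_mono) (simp add: norm_Pair_le)
    ultimately show "(\<Sum>k<n. norm ((\<phi> (v k), \<psi> (v k)) - (\<phi> (u k), \<psi> (u k)))) < \<epsilon>"
      by (simp add: sum.distrib)
  qed (use \<delta>1 \<delta>2 in simp)
qed

section \<open>Solutions of differential inclusions\<close>

lemma sol_domain_closed_segment [simp]: "0 \<le> T \<Longrightarrow> sol_domain {0..T}"
  by (auto simp: sol_domain_def)

lemma sol_domain_initial_segment:
  assumes "sol_domain D" "T \<in> D"
  shows "0 \<le> T" "{0..T} \<subseteq> D"
  using assms by (auto simp: sol_domain_def)

lemma loc_abs_cont_on_segment_iff: "loc_abs_cont_on {0..T} \<phi> \<longleftrightarrow> (0 \<le> T \<longrightarrow> abs_cont_on 0 T \<phi>)"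
proof
  assume L: "loc_abs_cont_on {0..T} \<phi>"
  show "0 \<le> T \<longrightarrow> abs_cont_on 0 T \<phi>" using L unfolding loc_abs_cont_on_def by blast
next
  assume "0 \<le> T \<longrightarrow> abs_cont_on 0 T \<phi>"
  then show "loc_abs_cont_on {0..T} \<phi>"
    unfolding loc_abs_cont_on_def using abs_cont_on_mono[of 0 T \<phi>] by auto
qed

lemma is_solution_segment_iff:
  assumes "0 \<le> T"
  shows "is_solution G x {0..T} \<phi> \<longleftrightarrow> \<phi> 0 = x \<and> abs_cont_on 0 T \<phi> \<and>
     (\<exists>N. negligible N \<and>
        (\<forall>t\<in>{0..T} - N. \<exists>v. (\<phi> has_vector_derivative v) (at t within {0..T}) \<and> v \<in> G (\<phi> t)))"
  using assms by (auto simp: is_solution_def loc_abs_cont_on_segment_iff)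

lemma is_solution_restrict:
  assumes "is_solution G x D \<phi>" "T \<in> D"
  shows "is_solution G x {0..T} \<phi>"
proof -
  have D: "0 \<le> T" "{0..T} \<subseteq> D"
    using assms sol_domain_initial_segment unfolding is_solution_def by blast+
  obtain N where N: "negligible N"
    "\<And>t. t \<in> D - N \<Longrightarrow> \<exists>v. (\<phi> has_vector_derivative v) (at t within D) \<and> v \<in> G (\<phi> t)"
    using assms unfolding is_solution_def by blast
  have "abs_cont_on 0 T \<phi>" using assms D unfolding is_solution_def loc_abs_cont_on_def by auto
  moreover have "\<forall>t\<in>{0..T} - N. \<exists>v. (\<phi> has_vector_derivative v) (at t within {0..T}) \<and> v \<in> G (\<phi> t)"
  proof
    fix t assume "t \<in> {0..T} - N"
    then obtain v where v: "(\<phi> has_vector_derivative v) (at t within D)" "v \<in> G (\<phi> t)"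
      using N(2)[of t] D(2) by blast
    have "(\<phi> has_vector_derivative v) (at t within {0..T})"
      by (rule has_vector_derivative_within_subset[OF v(1) D(2)])
    with v(2) show "\<exists>v. (\<phi> has_vector_derivative v) (at t within {0..T}) \<and> v \<in> G (\<phi> t)" by blast
  qed
  ultimately show ?thesis
    using assms N(1) D(1) unfolding is_solution_segment_iff[OF D(1)] by (auto simp: is_solution_def)
qed

lemma is_solution_shift:
  assumes sol: "is_solution G x {0..T} \<phi>" and s: "0 \<le> s" "s \<le> T"
  shows "is_solution G (\<phi> s) {0..T - s} (\<lambda>t. \<phi> (s + t))"
proof -
  have T: "0 \<le> T" "0 \<le> T - s" using s by auto
  obtain N where N: "negligible N"
    "\<And>t. t \<in> {0..T} - N \<Longrightarrow> \<exists>v. (\<phi> has_vector_derivative v) (at t within {0..T}) \<and> v \<in> G (\<phi> t)"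
    using sol T by (auto simp: is_solution_segment_iff)
  have "abs_cont_on 0 T \<phi>" using sol T by (auto simp: is_solution_segment_iff)
  then have "abs_cont_on (s + 0) (s + (T - s)) \<phi>" by (rule abs_cont_on_mono) (use s in auto)
  then have ac: "abs_cont_on 0 (T - s) (\<lambda>t. \<phi> (s + t))" by (rule abs_cont_on_shift)
  have neg: "negligible ((+) (- s) ` N)" using N(1) by (rule negligible_translation)
  have "\<exists>v. ((\<lambda>t. \<phi> (s + t)) has_vector_derivative v) (at t within {0..T - s}) \<and> v \<in> G (\<phi> (s + t))"
    if t: "t \<in> {0..T - s} - (+) (- s) ` N" for t
  proof -
    have "s + t \<notin> N" using t by (auto simp: image_iff)
    then have "s + t \<in> {0..T} - N" using t s by auto
    then obtain v where v: "(\<phi> has_vector_derivative v) (at (s + t) within {0..T})" "v \<in> G (\<phi> (s + t))"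
      using N(2) by blast
    have "((\<phi> \<circ> (\<lambda>t. s + t)) has_vector_derivative (1 *\<^sub>R v)) (at t within {0..T - s})"
    proof (rule vector_diff_chain_within)
      show "((+) s has_vector_derivative 1) (at t within {0..T - s})"
        by (auto intro!: derivative_eq_intros)
      have "(+) s ` {0..T - s} \<subseteq> {0..T}" using s by auto
      then show "(\<phi> has_vector_derivative v) (at (s + t) within (+) s ` {0..T - s})"
        using v(1) has_vector_derivative_within_subset by blast
    qed
    then show ?thesis using v(2) by (auto simp: o_def)
  qed
  then show ?thesis using ac neg unfolding is_solution_segment_iff[OF T(2)] by auto
qed

lemma is_solution_reverse:
  assumes sol: "is_solution G x {0..T} \<phi>" and T: "0 \<le> T"
  shows "is_solution (\<lambda>x. uminus ` G x) (\<phi> T) {0..T} (\<lambda>t. \<phi> (T - t))"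
proof -
  obtain N where N: "negligible N"
    "\<And>t. t \<in> {0..T} - N \<Longrightarrow> \<exists>v. (\<phi> has_vector_derivative v) (at t within {0..T}) \<and> v \<in> G (\<phi> t)"
    using sol T by (auto simp: is_solution_segment_iff)
  have "abs_cont_on 0 T \<phi>" using sol T by (auto simp: is_solution_segment_iff)
  then have ac: "abs_cont_on 0 T (\<lambda>t. \<phi> (T - t))" by (intro abs_cont_on_reflect) simp
  have neg: "negligible ((\<lambda>t. T - t) ` N)"
    by (rule negligible_locally_Lipschitz_image)
       (use N(1) in \<open>auto intro!: exI[of _ UNIV] exI[of _ "1::real"]\<close>)
  have "\<exists>v. ((\<lambda>t. \<phi> (T - t)) has_vector_derivative v) (at t within {0..T}) \<and> v \<in> uminus ` G (\<phi> (T - t))"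
    if t: "t \<in> {0..T} - (\<lambda>t. T - t) ` N" for t
  proof -
    have "T - t \<notin> N" using t by (force simp: image_iff)
    then have "T - t \<in> {0..T} - N" using t by auto
    then obtain v where v: "(\<phi> has_vector_derivative v) (at (T - t) within {0..T})" "v \<in> G (\<phi> (T - t))"
      using N(2) by blast
    have "((\<phi> \<circ> (\<lambda>t. T - t)) has_vector_derivative ((-1) *\<^sub>R v)) (at t within {0..T})"
    proof (rule vector_diff_chain_within)
      show "((\<lambda>t. T - t) has_vector_derivative -1) (at t within {0..T})"
        by (auto intro!: derivative_eq_intros)
      have "(\<lambda>t. T - t) ` {0..T} \<subseteq> {0..T}" by auto
      then show "(\<phi> has_vector_derivative v) (at (T - t) within (\<lambda>t. T - t) ` {0..T})"
        using v(1) has_vector_derivative_within_subset by blast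
    qed
    then show ?thesis using v(2) by (auto simp: o_def)
  qed
  then show ?thesis using ac neg unfolding is_solution_segment_iff[OF T] by auto
qed

lemma is_solution_cong:
  assumes sol: "is_solution G x {0..T} \<phi>" and T: "0 \<le> T" and eq: "\<And>t. t \<in> {0..T} \<Longrightarrow> \<psi> t = \<phi> t"
  shows "is_solution G x {0..T} \<psi>"
proof -
  obtain N where N: "negligible N"
    "\<And>t. t \<in> {0..T} - N \<Longrightarrow> \<exists>v. (\<phi> has_vector_derivative v) (at t within {0..T}) \<and> v \<in> G (\<phi> t)"
    using sol T by (auto simp: is_solution_segment_iff)
  have "\<exists>v. (\<psi> has_vector_derivative v) (at t within {0..T}) \<and> v \<in> G (\<psi> t)" if t: "t \<in> {0..T} - N" for t
  proof -
    obtain v where v: "(\<phi> has_vector_derivative v) (at t within {0..T})" "v \<in> G (\<phi> t)" using N(2)[OF t] by blast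
    have "(\<psi> has_vector_derivative v) (at t within {0..T})"
      by (rule has_vector_derivative_transform[OF _ _ v(1)]) (use t eq in auto)
    then show ?thesis using v(2) eq[of t] t by auto
  qed
  moreover have "abs_cont_on 0 T \<psi>"
    unfolding abs_cont_on_def
  proof (intro allI impI)
    fix \<epsilon> :: real assume "\<epsilon> > 0"
    then obtain \<delta> where \<delta>: "\<delta> > 0" "\<And>(n::nat) u v. (\<forall>k<n. 0 \<le> u k \<and> u k \<le> v k \<and> v k \<le> T) \<and>
        (\<forall>i<n. \<forall>j<n. i \<noteq> j \<longrightarrow> v i \<le> u j \<or> v j \<le> u i) \<and> (\<Sum>k<n. v k - u k) < \<delta>
        \<Longrightarrow> (\<Sum>k<n. norm (\<phi> (v k) - \<phi> (u k))) < \<epsilon>"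
      using sol unfolding is_solution_segment_iff[OF T] abs_cont_on_def by blast
    show "\<exists>\<delta>>0. \<forall>(n::nat) u v. (\<forall>k<n. 0 \<le> u k \<and> u k \<le> v k \<and> v k \<le> T) \<and>
        (\<forall>i<n. \<forall>j<n. i \<noteq> j \<longrightarrow> v i \<le> u j \<or> v j \<le> u i) \<and> (\<Sum>k<n. v k - u k) < \<delta>
        \<longrightarrow> (\<Sum>k<n. norm (\<psi> (v k) - \<psi> (u k))) < \<epsilon>"
    proof (intro exI[of _ \<delta>] conjI allI impI \<delta>(1))
      fix n :: nat and u v :: "nat \<Rightarrow> real"
      assume A: "(\<forall>k<n. 0 \<le> u k \<and> u k \<le> v k \<and> v k \<le> T) \<and>
        (\<forall>i<n. \<forall>j<n. i \<noteq> j \<longrightarrow> v i \<le> u j \<or> v j \<le> u i) \<and> (\<Sum>k<n. v k - u k) < \<delta>"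
      have "(\<Sum>k<n. norm (\<psi> (v k) - \<psi> (u k))) = (\<Sum>k<n. norm (\<phi> (v k) - \<phi> (u k)))"
      proof (rule sum.cong)
        fix k assume "k \<in> {..<n}"
        then have "0 \<le> u k" "u k \<le> v k" "v k \<le> T" using A by auto
        then show "norm (\<psi> (v k) - \<psi> (u k)) = norm (\<phi> (v k) - \<phi> (u k))" using eq[of "u k"] eq[of "v k"] by simp
      qed simp
      then show "(\<Sum>k<n. norm (\<psi> (v k) - \<psi> (u k))) < \<epsilon>" using \<delta>(2)[OF A] by simp
    qed
  qed
  moreover have "\<psi> 0 = x" using sol T eq[of 0] by (auto simp: is_solution_def)
  ultimately show ?thesis using N(1) unfolding is_solution_segment_iff[OF T] by blast
qed

lemma is_solution_increasing_union:
  assumes sol: "\<And>n::nat. is_solution G x {0..s n} \<phi>" and s0: "\<And>n. 0 \<le> s n" and less: "\<And>n. s n < S"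
    and sup: "\<And>b. b < S \<Longrightarrow> \<exists>n. b < s n"
  shows "is_solution G x {0..<S} \<phi>"
proof -
  have S: "0 < S" using s0[of 0] less[of 0] by linarith
  have "\<exists>N. negligible N \<and> (\<forall>t\<in>{0..s n} - N. \<exists>v. (\<phi> has_vector_derivative v) (at t within {0..s n}) \<and> v \<in> G (\<phi> t))" for n
    using sol[of n] by (auto simp: is_solution_segment_iff[OF s0])
  then obtain N where N: "\<And>n. negligible (N n)"
    "\<And>n t. t \<in> {0..s n} - N n \<Longrightarrow> \<exists>v. (\<phi> has_vector_derivative v) (at t within {0..s n}) \<and> v \<in> G (\<phi> t)"
    by metis
  \<comment> \<open>Adjoining 0 makes every remaining \<open>t\<close> interior to some
    \<open>{0..s n}\<close>; there the derivative within that segment is two-sided and may be taken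
    within \<open>{0..<S}\<close>.\<close>
  have neg: "negligible (insert 0 (\<Union>n. N n))" using N(1) by (auto intro!: negligible_countable_Union)
  have "loc_abs_cont_on {0..<S} \<phi>"
    unfolding loc_abs_cont_on_def
  proof (intro allI impI)
    fix a b assume ab: "a \<le> b \<and> {a..b} \<subseteq> {0..<S}"
    then have "0 \<le> a" "b < S" by auto
    then obtain n where "b < s n" using sup by blast
    have "abs_cont_on 0 (s n) \<phi>" using sol[of n] by (auto simp: is_solution_segment_iff[OF s0])
    then show "abs_cont_on a b \<phi>" by (rule abs_cont_on_mono) (use \<open>0 \<le> a\<close> \<open>b < s n\<close> in auto)
  qed
  moreover have "\<exists>v. (\<phi> has_vector_derivative v) (at t within {0..<S}) \<and> v \<in> G (\<phi> t)"
    if t: "t \<in> {0..<S} - insert 0 (\<Union>n. N n)" for t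
  proof -
    obtain n where n: "t < s n" using sup t by auto
    then have "t \<in> {0..s n} - N n" using t by auto
    then obtain v where v: "(\<phi> has_vector_derivative v) (at t within {0..s n})" "v \<in> G (\<phi> t)" using N(2) by blast
    have "at t within {0..s n} = at t" using t n by (intro at_within_interior) auto
    then have "(\<phi> has_vector_derivative v) (at t within {0..<S})"
      using v(1) has_vector_derivative_at_within by fastforce
    then show ?thesis using v(2) by blast
  qed
  moreover have "\<phi> 0 = x" using sol[of 0] by (simp add: is_solution_def)
  moreover have "sol_domain {0..<S}" unfolding sol_domain_def using S less_imp_le by blast
  ultimately show ?thesis
    unfolding is_solution_def using S neg by (intro conjI exI[of _ "insert 0 (\<Union>n. N n)"]) auto
qed

section \<open>Time as an additional state component\<close>

lemma augmented_solutionI: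
  assumes sol: "is_solution F x {0..T} \<phi>" and T: "0 \<le> T"
  shows "is_solution (augmented F) (a, x) {0..T} (\<lambda>t. (a + t, \<phi> t))"
proof -
  obtain N where N: "negligible N"
    "\<And>t. t \<in> {0..T} - N \<Longrightarrow> \<exists>v. (\<phi> has_vector_derivative v) (at t within {0..T}) \<and> v \<in> F (\<phi> t)"
    using sol T by (auto simp: is_solution_segment_iff)
  have "abs_cont_on 0 T ((+) a)"
    by (rule lipschitz_on_imp_abs_cont_on[of 1]) (auto intro: lipschitz_onI)
  then have "abs_cont_on 0 T (\<lambda>t. (a + t, \<phi> t))"
    using sol by (intro abs_cont_on_Pair) (auto simp: is_solution_segment_iff[OF T])
  moreover have "\<exists>v. ((\<lambda>t. (a + t, \<phi> t)) has_vector_derivative v) (at t within {0..T}) \<and> v \<in> augmented F (a + t, \<phi> t)"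
    if t: "t \<in> {0..T} - N" for t
  proof -
    obtain v where v: "(\<phi> has_vector_derivative v) (at t within {0..T})" "v \<in> F (\<phi> t)" using N(2)[OF t] by blast
    have "((+) a has_vector_derivative 1) (at t within {0..T})" by (auto intro!: derivative_eq_intros)
    then have "((\<lambda>t. (a + t, \<phi> t)) has_vector_derivative (1, v)) (at t within {0..T})"
      using v(1) by (rule has_vector_derivative_Pair)
    then show ?thesis using v(2) by (auto simp: augmented_def)
  qed
  ultimately show ?thesis
    using N(1) sol unfolding is_solution_segment_iff[OF T] by auto
qed

lemma augmented_solutionD:
  assumes sol: "is_solution (augmented F) z {0..T} \<psi>" and T: "0 \<le> T"
  shows "is_solution F (snd z) {0..T} (\<lambda>t. snd (\<psi> t))" "fst (\<psi> T) = fst z + T"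
proof -
  obtain N where N: "negligible N"
    "\<And>t. t \<in> {0..T} - N \<Longrightarrow> \<exists>v. (\<psi> has_vector_derivative v) (at t within {0..T}) \<and> v \<in> augmented F (\<psi> t)"
    using sol T by (auto simp: is_solution_segment_iff)
  have ac: "abs_cont_on 0 T \<psi>" and \<psi>0: "\<psi> 0 = z" using sol T by (auto simp: is_solution_segment_iff)
  have der: "\<exists>v\<in>F (snd (\<psi> t)). ((\<lambda>t. snd (\<psi> t)) has_vector_derivative v) (at t within {0..T}) \<and>
      ((\<lambda>t. fst (\<psi> t)) has_vector_derivative 1) (at t within {0..T})" if t: "t \<in> {0..T} - N" for t
  proof -
    obtain v where v: "(\<psi> has_vector_derivative v) (at t within {0..T})" "v \<in> augmented F (\<psi> t)" using N(2)[OF t] by blast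
    have "((\<lambda>t. snd (\<psi> t)) has_vector_derivative snd v) (at t within {0..T})"
      by (rule bounded_linear.has_vector_derivative[OF bounded_linear_snd v(1)])
    moreover have "((\<lambda>t. fst (\<psi> t)) has_vector_derivative fst v) (at t within {0..T})"
      by (rule bounded_linear.has_vector_derivative[OF bounded_linear_fst v(1)])
    moreover have "fst v = 1" "snd v \<in> F (snd (\<psi> t))" using v(2) by (auto simp: augmented_def case_prod_unfold)
    ultimately show ?thesis by (intro bexI[of _ "snd v"]) auto
  qed
  have "abs_cont_on 0 T (\<lambda>t. snd (\<psi> t))" by (rule abs_cont_on_bounded_linear[OF bounded_linear_snd ac])
  then show "is_solution F (snd z) {0..T} (\<lambda>t. snd (\<psi> t))"
    unfolding is_solution_segment_iff[OF T] using \<psi>0 N(1) der by blast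
  show "fst (\<psi> T) = fst z + T"
  proof (cases "T = 0")
    case False
    \<comment> \<open>The time component has derivative 1 almost everywhere. By absolute continuity
      its mean velocity lies in the closed convex set \<open>{1}\<close>, so it advances by exactly
      \<open>T\<close>.\<close>
    have "(fst (\<psi> T) - fst (\<psi> 0)) /\<^sub>R (T - 0) \<in> {1}"
    proof (rule abs_cont_mean_velocity_in_convex[OF abs_cont_on_bounded_linear[OF bounded_linear_fst ac] _ N(1)])
      fix t assume "t \<in> {0..T} - N"
      then show "\<exists>v\<in>{1}. ((\<lambda>t. fst (\<psi> t)) has_vector_derivative v) (at t within {0..T})" using der by blast
    qed (use False T in auto)
    then show ?thesis using False \<psi>0 by (simp add: field_simps)
  qed (simp add: \<psi>0)
qed

text \<open>Emptiness at one point spreads everywhere, since every enlargement of the empty set is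
  empty. No solution could then live on an interval of positive length, and the domain
  \<open>{0..0}\<close> would carry a maximal solution, contradicting completeness.\<close>

lemma forward_complete_imp_nonempty_val:
  assumes lip: "loc_lipschitz_setvalued G" and fc: "forward_complete G"
  shows "G x \<noteq> {}"
proof
  assume x: "G x = {}"
  have empty: "G y = {}" for y
  proof -
    obtain k where "\<forall>x1\<in>{x,y}. \<forall>x2\<in>{x,y}. G x1 \<subseteq> enlarge (G x2) (k * norm (x1 - x2))"
      using lip unfolding loc_lipschitz_setvalued_def by (metis finite.emptyI finite_imp_compact finite_insert)
    then have "G y \<subseteq> enlarge (G x) (k * norm (y - x))" by auto
    then show ?thesis by (simp add: x enlarge_def)
  qed
  have "abs_cont_on 0 0 (\<lambda>_. x)"
    by (rule lipschitz_on_imp_abs_cont_on[of 0]) (auto intro: lipschitz_onI)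
  \<comment> \<open>On this one-point domain the exceptional set \<open>{0}\<close> absorbs the
    derivative condition.\<close>
  then have sol: "is_solution G x {0..0} (\<lambda>_. x)"
    unfolding is_solution_segment_iff[OF order_refl] by (auto intro!: exI[of _ "{0::real}"])
  have "is_maximal_solution G x {0..0} (\<lambda>_. x)"
    unfolding is_maximal_solution_def
  proof (intro conjI notI sol)
    assume "\<exists>D' \<psi>. is_solution G x D' \<psi> \<and> {0..0} \<subset> D' \<and> (\<forall>t\<in>{0..0}. \<psi> t = x)"
    then obtain D' \<psi> where D': "is_solution G x D' \<psi>" "{0..0} \<subset> D'" by blast
    then obtain u where u: "u \<in> D'" "u \<noteq> 0" by auto
    have "0 \<le> u" "{0..u} \<subseteq> D'"
      using sol_domain_initial_segment[of D' u] D'(1) u(1) by (auto simp: is_solution_def)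
    then have "0 < u" using u by simp
    obtain N where N: "negligible N" "\<forall>t\<in>D' - N. \<exists>v. (\<psi> has_vector_derivative v) (at t within D') \<and> v \<in> G (\<psi> t)"
      using D'(1) unfolding is_solution_def by blast
    have "D' \<subseteq> N" using N(2) empty by blast
    then have "negligible {0..u}" using N(1) \<open>{0..u} \<subseteq> D'\<close> by (meson negligible_subset)
    then show False using \<open>0 < u\<close> negligible_interval(1)[of 0 u] by (simp add: box_real)
  qed
  then show False using fc unfolding forward_complete_def by auto
qed

section \<open>Distances, hitting times and convergent subsequences\<close>

text \<open>Enlargements of the values of \<open>G\<close> serve as the convex set in mean velocity
  arguments. A convex combination of nearest points is a competitor for the distance.\<close>

lemma convex_infdist_le:
  fixes A :: "'a::euclidean_space set"
  assumes "closed A" "convex A" "A \<noteq> {}"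
  shows "convex {v. infdist v A \<le> r}"
proof (rule convexI)
  fix u v and x y :: real
  assume uv: "u \<in> {v. infdist v A \<le> r}" "v \<in> {v. infdist v A \<le> r}" and xy: "0 \<le> x" "0 \<le> y" "x + y = 1"
  obtain a where a: "a \<in> A" "infdist u A = dist u a" using infdist_attains_inf assms by metis
  obtain b where b: "b \<in> A" "infdist v A = dist v b" using infdist_attains_inf assms by metis
  have "x *\<^sub>R a + y *\<^sub>R b \<in> A" using assms(2) a b xy by (auto simp: convex_def)
  then have "infdist (x *\<^sub>R u + y *\<^sub>R v) A \<le> dist (x *\<^sub>R u + y *\<^sub>R v) (x *\<^sub>R a + y *\<^sub>R b)"
    by (rule infdist_le)
  also have "\<dots> = norm (x *\<^sub>R (u - a) + y *\<^sub>R (v - b))" by (simp add: dist_norm algebra_simps)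
  also have "\<dots> \<le> x * norm (u - a) + y * norm (v - b)"
    using xy norm_triangle_ineq[of "x *\<^sub>R (u - a)" "y *\<^sub>R (v - b)"] by simp
  also have "\<dots> \<le> x * r + y * r"
    using a b uv xy by (intro add_mono mult_left_mono) (auto simp: dist_norm)
  also have "\<dots> = r" using xy by (simp flip: distrib_right)
  finally show "x *\<^sub>R u + y *\<^sub>R v \<in> {v. infdist v A \<le> r}" by simp
qed

lemma closed_infdist_le: "closed {v. infdist v A \<le> r}"
  by (intro closed_Collect_le continuous_intros)

text \<open>Stopping a curve at level \<open>r\<close> bounds its whole past, as local constants
  require, and gives equality at the end, from which contradictions are drawn.\<close>

lemma first_hitting_time:
  fixes f :: "real \<Rightarrow> real"
  assumes cont: "continuous_on {0..\<tau>} f" and f: "f 0 < r" "r \<le> f \<tau>" and \<tau>: "0 \<le> \<tau>"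
  obtains \<sigma> where "0 \<le> \<sigma>" "\<sigma> \<le> \<tau>" "f \<sigma> = r" "\<And>s. s \<in> {0..\<sigma>} \<Longrightarrow> f s \<le> r"
proof -
  define S where "S = {s \<in> {0..\<tau>}. r \<le> f s}"
  have cl: "closed S"
    unfolding S_def by (intro continuous_on_closed_Collect_le continuous_intros cont)
  have ne: "S \<noteq> {}" using f \<tau> by (auto simp: S_def)
  have bd: "bdd_below S" by (rule bdd_belowI[of _ 0]) (auto simp: S_def)
  define \<sigma> where "\<sigma> = Inf S"
  have \<sigma>S: "\<sigma> \<in> S" unfolding \<sigma>_def using closed_contains_Inf[OF ne bd cl] .
  have less: "f s < r" if "0 \<le> s" "s < \<sigma>" for s
  proof (rule ccontr)
    assume "\<not> f s < r"
    then have "s \<in> S" using that \<sigma>S by (auto simp: S_def)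
    then show False using cInf_lower[OF _ bd, of s] that unfolding \<sigma>_def by simp
  qed
  have \<sigma>: "0 \<le> \<sigma>" "\<sigma> \<le> \<tau>" "r \<le> f \<sigma>" using \<sigma>S by (auto simp: S_def)
  have "continuous_on {0..\<sigma>} f" using cont \<sigma> continuous_on_subset by fastforce
  then obtain s where s: "0 \<le> s" "s \<le> \<sigma>" "f s = r"
    using IVT'[of f 0 r \<sigma>] f \<sigma> by auto
  then have "s = \<sigma>" using less[of s] by force
  show thesis
  proof (rule that[of \<sigma>])
    show "f \<sigma> = r" using s \<open>s = \<sigma>\<close> by simp
    then show "f t \<le> r" if "t \<in> {0..\<sigma>}" for t
      using less[of t] that by (cases "t = \<sigma>") auto
  qed (use \<sigma> in auto)
qed

lemma lipschitz_sequence_convergent_subsequence: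
  fixes \<Phi> :: "nat \<Rightarrow> real \<Rightarrow> 'a::euclidean_space"
  assumes R: "\<And>n t. t \<in> {0..T} \<Longrightarrow> norm (\<Phi> n t) \<le> R"
    and M: "\<And>n s t. s \<in> {0..T} \<Longrightarrow> t \<in> {0..T} \<Longrightarrow> norm (\<Phi> n t - \<Phi> n s) \<le> M * \<bar>t - s\<bar>"
  obtains g r where "strict_mono (r :: nat \<Rightarrow> nat)" "\<And>t. t \<in> {0..T} \<Longrightarrow> (\<lambda>n. \<Phi> (r n) t) \<longlonglongrightarrow> g t"
    "\<And>s t. s \<in> {0..T} \<Longrightarrow> t \<in> {0..T} \<Longrightarrow> norm (g t - g s) \<le> M * \<bar>t - s\<bar>"
proof -
  have eq: "\<exists>d. 0 < d \<and> (\<forall>n y. y \<in> {0..T} \<and> norm (x - y) < d \<longrightarrow> norm (\<Phi> n x - \<Phi> n y) < e)"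
    if x: "x \<in> {0..T}" and e: "0 < e" for x e
  proof (intro exI[of _ "e / (\<bar>M\<bar> + 1)"] conjI allI impI)
    show "0 < e / (\<bar>M\<bar> + 1)" using e by simp
    fix n y assume y: "y \<in> {0..T} \<and> norm (x - y) < e / (\<bar>M\<bar> + 1)"
    have "norm (\<Phi> n x - \<Phi> n y) \<le> M * \<bar>x - y\<bar>" using M x y by blast
    also have "\<dots> \<le> (\<bar>M\<bar> + 1) * \<bar>x - y\<bar>" by (intro mult_right_mono) auto
    also have "\<dots> < (\<bar>M\<bar> + 1) * (e / (\<bar>M\<bar> + 1))" using y by (intro mult_strict_left_mono) auto
    also have "\<dots> = e" by simp
    finally show "norm (\<Phi> n x - \<Phi> n y) < e" .
  qed
  obtain g r where r: "strict_mono (r :: nat \<Rightarrow> nat)"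
    and g: "\<And>e. 0 < e \<Longrightarrow> \<exists>N. \<forall>n x. n \<ge> N \<and> x \<in> {0..T} \<longrightarrow> norm (\<Phi> (r n) x - g x) < e"
  proof (rule Arzela_Ascoli[of "{0..T}" \<Phi> R])
    show "\<exists>d. 0 < d \<and> (\<forall>n y. y \<in> {0..T} \<and> norm (x - y) < d \<longrightarrow> norm (\<Phi> n x - \<Phi> n y) < e)"
      if "x \<in> {0..T}" "0 < e" for x e using that by (rule eq)
    show "norm (\<Phi> n x) \<le> R" if "x \<in> {0..T}" for n x using that by (rule R)
    fix g k
    assume "strict_mono (k :: nat \<Rightarrow> nat)"
      "\<And>e. 0 < e \<Longrightarrow> \<exists>N. \<forall>n x. n \<ge> N \<and> x \<in> {0..T} \<longrightarrow> norm (\<Phi> (k n) x - g x) < e"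
    then show thesis by (rule that[of k g])
  qed simp
  have lim: "(\<lambda>n. \<Phi> (r n) t) \<longlonglongrightarrow> g t" if "t \<in> {0..T}" for t
    unfolding LIMSEQ_iff
  proof (intro allI impI)
    fix e :: real assume "0 < e"
    then obtain N where "\<forall>n x. n \<ge> N \<and> x \<in> {0..T} \<longrightarrow> norm (\<Phi> (r n) x - g x) < e" using g by blast
    then show "\<exists>N. \<forall>n\<ge>N. norm (\<Phi> (r n) t - g t) < e" using that by blast
  qed
  moreover have "norm (g t - g s) \<le> M * \<bar>t - s\<bar>" if "s \<in> {0..T}" "t \<in> {0..T}" for s t
    using M that by (intro LIMSEQ_le_const2[OF tendsto_norm[OF tendsto_diff[OF lim lim]]]) auto
  ultimately show thesis using that r by blast
qed

section \<open>Solutions as curves with controlled difference quotients\<close>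

locale lipschitz_inclusion =
  fixes G :: "'a::euclidean_space \<Rightarrow> 'a set"
  assumes loc_lip: "loc_lipschitz_setvalued G"
    and compact_val: "compact (G x)" and convex_val: "convex (G x)" and nonempty_val: "G x \<noteq> {}"
begin

text \<open>\<open>M\<close> bounds the velocities on the ball of radius \<open>R\<close>, and
  \<open>k\<close> is a Lipschitz constant of \<open>G\<close> there. The latter is phrased through
  \<open>infdist\<close>, for an arbitrary vector \<open>v\<close>, so that estimates chain as
  inequalities between reals rather than as inclusions of enlargements. For negative
  \<open>R\<close> the conditions on \<open>G\<close> are void.\<close>

definition local_consts :: "real \<Rightarrow> real \<Rightarrow> real \<Rightarrow> bool" where
  "local_consts R k M \<longleftrightarrow> 0 < k \<and> 0 < M \<and> (\<forall>x v. norm x \<le> R \<longrightarrow> v \<in> G x \<longrightarrow> norm v \<le> M) \<and>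
     (\<forall>x y v. norm x \<le> R \<longrightarrow> norm y \<le> R \<longrightarrow> infdist v (G y) \<le> infdist v (G x) + k * norm (x - y))"

text \<open>Comparing with \<open>G\<close> at the left endpoint leaves no derivative in the
  condition. The allowance \<open>c * (t - s)\<close> covers the variation of \<open>G\<close> along
  the curve and vanishes as \<open>t\<close> decreases to \<open>s\<close>, so that a right
  derivative at \<open>s\<close> is still forced into \<open>G (\<phi> s)\<close>.\<close>

definition quotient_bound :: "real \<Rightarrow> real \<Rightarrow> (real \<Rightarrow> 'a) \<Rightarrow> bool" where
  "quotient_bound c T \<phi> \<longleftrightarrow>
     (\<forall>s t. 0 \<le> s \<longrightarrow> s < t \<longrightarrow> t \<le> T \<longrightarrow> infdist ((\<phi> t - \<phi> s) /\<^sub>R (t - s)) (G (\<phi> s)) \<le> c * (t - s))"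

lemma closed_val: "closed (G x)"
  using compact_val by (rule compact_imp_closed)

lemma local_consts_exist: "\<exists>k M. local_consts R k M"
proof -
  obtain k where k: "k > 0" "\<And>x y. x \<in> cball 0 R \<Longrightarrow> y \<in> cball 0 R \<Longrightarrow> G x \<subseteq> enlarge (G y) (k * norm (x - y))"
    using loc_lip unfolding loc_lipschitz_setvalued_def by (meson compact_cball)
  obtain m where m: "\<And>v. v \<in> G 0 \<Longrightarrow> norm v \<le> m"
    using compact_val[of 0] compact_imp_bounded bounded_iff by metis
  \<comment> \<open>On the ball every value of \<open>G\<close> lies within \<open>k * R\<close> of
    \<open>G 0\<close>. The absolute values and the 1 keep \<open>M\<close> positive even for
    negative \<open>R\<close>.\<close>
  define M where "M = \<bar>m\<bar> + k * \<bar>R\<bar> + 1"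
  have "M > 0" using k(1) by (simp add: M_def add_nonneg_pos)
  moreover have "norm v \<le> M" if x: "norm x \<le> R" and v: "v \<in> G x" for x v
  proof -
    have R: "0 \<le> R" using x norm_ge_zero order_trans by blast
    then have "v \<in> enlarge (G 0) (k * norm x)" using k(2)[of x 0] x v by auto
    then obtain a b where ab: "v = a + b" "a \<in> G 0" "norm b \<le> k * norm x" by (auto simp: enlarge_def)
    have "norm v \<le> norm a + norm b" using ab norm_triangle_ineq by blast
    also have "\<dots> \<le> m + k * R"
      using m[OF ab(2)] ab(3) x k(1) by (smt (verit) mult_left_mono)
    finally show ?thesis using R unfolding M_def by simp
  qed
  moreover have "infdist v (G y) \<le> infdist v (G x) + k * norm (x - y)"
    if xy: "norm x \<le> R" "norm y \<le> R" for x y v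
  proof -
    obtain a where a: "a \<in> G x" "infdist v (G x) = dist v a"
      using infdist_attains_inf[OF closed_val nonempty_val] by metis
    have "a \<in> enlarge (G y) (k * norm (x - y))" using k(2)[of x y] xy a by auto
    then obtain b c where bc: "a = b + c" "b \<in> G y" "norm c \<le> k * norm (x - y)" by (auto simp: enlarge_def)
    have "infdist v (G y) \<le> dist v b" using bc(2) by (rule infdist_le)
    also have "\<dots> \<le> dist v a + dist a b" by (rule dist_triangle)
    also have "dist a b = norm c" using bc by (simp add: dist_norm)
    finally show ?thesis using a bc by simp
  qed
  ultimately show ?thesis using k(1) unfolding local_consts_def by blast
qed

lemma local_constsD:
  assumes "local_consts R k M"
  shows "0 < k" "0 < M" "\<And>x v. norm x \<le> R \<Longrightarrow> v \<in> G x \<Longrightarrow> norm v \<le> M"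
    "\<And>x y v. norm x \<le> R \<Longrightarrow> norm y \<le> R \<Longrightarrow> infdist v (G y) \<le> infdist v (G x) + k * norm (x - y)"
  using assms unfolding local_consts_def by blast+

lemma norm_le_infdist_val:
  assumes "\<And>w. w \<in> G x \<Longrightarrow> norm w \<le> M"
  shows "norm v \<le> infdist v (G x) + M"
proof -
  obtain a where a: "a \<in> G x" "infdist v (G x) = dist v a"
    using infdist_attains_inf[OF closed_val nonempty_val] by metis
  have "norm v \<le> dist v a + norm a" by (metis dist_norm norm_triangle_sub add.commute)
  then show ?thesis using a assms[OF a(1)] by simp
qed

lemma solution_bounded:
  assumes "is_solution G x {0..T} \<phi>" "0 \<le> T"
  obtains R where "\<And>t. t \<in> {0..T} \<Longrightarrow> norm (\<phi> t) \<le> R"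
proof -
  have "continuous_on {0..T} \<phi>"
    using assms abs_cont_on_imp_continuous_on by (auto simp: is_solution_segment_iff)
  then have "bounded (\<phi> ` {0..T})" by (intro compact_imp_bounded compact_continuous_image) auto
  then obtain R where "\<forall>t\<in>{0..T}. norm (\<phi> t) \<le> R" by (auto simp: bounded_iff)
  then show ?thesis using that by blast
qed

lemma solution_mean_velocity:
  assumes sol: "is_solution G x {0..T} \<phi>" and st: "0 \<le> s" "s < t" "t \<le> T"
    and C: "closed C" "convex C" and sub: "\<And>r. s \<le> r \<Longrightarrow> r \<le> t \<Longrightarrow> G (\<phi> r) \<subseteq> C"
  shows "(\<phi> t - \<phi> s) /\<^sub>R (t - s) \<in> C"
proof -
  have T: "0 \<le> T" using st by simp
  obtain N where N: "negligible N"
    "\<And>t. t \<in> {0..T} - N \<Longrightarrow> \<exists>v. (\<phi> has_vector_derivative v) (at t within {0..T}) \<and> v \<in> G (\<phi> t)"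
    using sol T by (auto simp: is_solution_segment_iff)
  show ?thesis
  proof (rule abs_cont_mean_velocity_in_convex[OF _ st(2) N(1) _ C])
    have "abs_cont_on 0 T \<phi>" using sol T by (auto simp: is_solution_segment_iff)
    then show "abs_cont_on s t \<phi>" by (rule abs_cont_on_mono) (use st in auto)
    fix r assume r: "r \<in> {s..t} - N"
    then have "r \<in> {0..T} - N" using st by auto
    then obtain v where "(\<phi> has_vector_derivative v) (at r within {0..T})" "v \<in> G (\<phi> r)"
      using N(2) by blast
    moreover have "{s..t} \<subseteq> {0..T}" using st by auto
    ultimately have "(\<phi> has_vector_derivative v) (at r within {s..t})" "v \<in> C"
      using sub[of r] r by (auto intro: has_vector_derivative_within_subset)
    then show "\<exists>v\<in>C. (\<phi> has_vector_derivative v) (at r within {s..t})" by blast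
  qed
qed

lemma solution_lipschitz:
  assumes sol: "is_solution G x {0..T} \<phi>"
    and R: "\<And>t. t \<in> {0..T} \<Longrightarrow> norm (\<phi> t) \<le> R" and kM: "local_consts R k M"
    and st: "s \<in> {0..T}" "t \<in> {0..T}"
  shows "norm (\<phi> t - \<phi> s) \<le> M * \<bar>t - s\<bar>"
proof -
  have *: "norm (\<phi> t - \<phi> s) \<le> M * (t - s)" if "0 \<le> s" "s < t" "t \<le> T" for s t
  proof -
    have "(\<phi> t - \<phi> s) /\<^sub>R (t - s) \<in> cball 0 M"
    proof (rule solution_mean_velocity[OF sol that])
      fix r assume "s \<le> r" "r \<le> t"
      then have "norm (\<phi> r) \<le> R" using R that by simp
      then show "G (\<phi> r) \<subseteq> cball 0 M" using local_constsD(3)[OF kM] by auto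
    qed auto
    then have "norm (\<phi> t - \<phi> s) / (t - s) \<le> M" using that by (simp add: divide_inverse_commute)
    then show ?thesis using that by (simp add: pos_divide_le_eq)
  qed
  show ?thesis
    using *[of s t] *[of t s] st by (cases s t rule: linorder_cases) (auto simp: norm_minus_commute)
qed

text \<open>Between \<open>s\<close> and \<open>t\<close> the curve moves by at most
  \<open>M * (t - s)\<close>, so the velocities on the way stay within
  \<open>k * M * (t - s)\<close> of \<open>G (\<phi> s)\<close>. This enlargement is closed and
  convex, hence contains the mean velocity.\<close>

lemma solution_quotient_bound:
  assumes sol: "is_solution G x {0..T} \<phi>"
    and R: "\<And>t. t \<in> {0..T} \<Longrightarrow> norm (\<phi> t) \<le> R" and kM: "local_consts R k M"
  shows "quotient_bound (k * M) T \<phi>"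
  unfolding quotient_bound_def
proof (intro allI impI)
  fix s t assume st: "0 \<le> s" "s < t" "t \<le> T"
  have "(\<phi> t - \<phi> s) /\<^sub>R (t - s) \<in> {v. infdist v (G (\<phi> s)) \<le> k * M * (t - s)}"
  proof (rule solution_mean_velocity[OF sol st])
    fix r assume r: "s \<le> r" "r \<le> t"
    have "norm (\<phi> r - \<phi> s) \<le> M * (r - s)"
      using solution_lipschitz[OF sol R kM, of s r] st r by auto
    also have "\<dots> \<le> M * (t - s)" using r local_constsD(2)[OF kM] by (intro mult_left_mono) auto
    finally have "k * norm (\<phi> r - \<phi> s) \<le> k * M * (t - s)"
      using local_constsD(1)[OF kM] by (simp add: mult.assoc mult_left_mono)
    moreover have "norm (\<phi> r) \<le> R" "norm (\<phi> s) \<le> R" using R st r by auto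
    ultimately have "infdist v (G (\<phi> s)) \<le> infdist v (G (\<phi> r)) + k * M * (t - s)" for v
      using local_constsD(4)[OF kM, of "\<phi> r" "\<phi> s" v] by linarith
    then show "G (\<phi> r) \<subseteq> {v. infdist v (G (\<phi> s)) \<le> k * M * (t - s)}"
      by (metis (mono_tags, lifting) add_0 infdist_zero mem_Collect_eq subsetI)
  qed (intro closed_infdist_le convex_infdist_le closed_val convex_val nonempty_val)+
  then show "infdist ((\<phi> t - \<phi> s) /\<^sub>R (t - s)) (G (\<phi> s)) \<le> k * M * (t - s)" by simp
qed

text \<open>No bound on the curve is known at first. Comparison with the initial time, where
  \<open>G (\<phi> 0)\<close> is bounded, confines the curve to a ball; the velocity bound on that
  ball then gives the Lipschitz constant.\<close>

lemma quotient_bound_imp_lipschitz: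
  assumes q: "quotient_bound c T \<phi>" and T: "0 \<le> T"
  obtains L where "L-lipschitz_on {0..T} \<phi>"
proof -
  define c' where "c' = \<bar>c\<bar> * T"
  have c': "c' \<ge> 0" using T by (simp add: c'_def)
  have inc: "norm (\<phi> t - \<phi> s) \<le> (c' + M) * (t - s)"
    if st: "0 \<le> s" "s < t" "t \<le> T" and M: "\<And>w. w \<in> G (\<phi> s) \<Longrightarrow> norm w \<le> M" for s t M
  proof -
    have "infdist ((\<phi> t - \<phi> s) /\<^sub>R (t - s)) (G (\<phi> s)) \<le> c * (t - s)"
      using q st unfolding quotient_bound_def by blast
    also have "\<dots> \<le> \<bar>c\<bar> * T" using st by (intro mult_mono) auto
    finally have "norm ((\<phi> t - \<phi> s) /\<^sub>R (t - s)) \<le> c' + M"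
      using norm_le_infdist_val[of "\<phi> s" M "(\<phi> t - \<phi> s) /\<^sub>R (t - s)", OF M] unfolding c'_def by linarith
    then have "norm (\<phi> t - \<phi> s) / (t - s) \<le> c' + M" using st by (simp add: divide_inverse_commute)
    then show ?thesis using st by (simp add: pos_divide_le_eq)
  qed
  obtain m where m: "\<And>v. v \<in> G (\<phi> 0) \<Longrightarrow> norm v \<le> m"
    using compact_val[of "\<phi> 0"] compact_imp_bounded bounded_iff by metis
  have "m \<ge> 0" using m nonempty_val[of "\<phi> 0"] norm_ge_zero order_trans by blast
  define R where "R = norm (\<phi> 0) + (c' + m) * T"
  have R: "norm (\<phi> t) \<le> R" if "t \<in> {0..T}" for t
  proof (cases "t = 0")
    case True
    then show ?thesis using T c' \<open>m \<ge> 0\<close> by (simp add: R_def)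
  next
    case False
    then have "norm (\<phi> t - \<phi> 0) \<le> (c' + m) * t" using inc[of 0 t, OF _ _ _ m] that by auto
    also have "\<dots> \<le> (c' + m) * T" using that c' \<open>m \<ge> 0\<close> by (intro mult_left_mono) auto
    finally show ?thesis unfolding R_def using norm_triangle_sub[of "\<phi> t" "\<phi> 0"] by linarith
  qed
  obtain k M where kM: "local_consts R k M" using local_consts_exist by blast
  have M: "M > 0" using local_constsD(2)[OF kM] .
  have *: "norm (\<phi> t - \<phi> s) \<le> (c' + M) * (t - s)" if "0 \<le> s" "s < t" "t \<le> T" for s t
  proof (rule inc[OF that])
    have "norm (\<phi> s) \<le> R" using R that by simp
    then show "norm w \<le> M" if "w \<in> G (\<phi> s)" for w using local_constsD(3)[OF kM _ that] by blast
  qed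
  have "(c' + M)-lipschitz_on {0..T} \<phi>"
  proof (rule lipschitz_onI)
    fix s t assume st: "s \<in> {0..T}" "t \<in> {0..T}"
    show "dist (\<phi> s) (\<phi> t) \<le> (c' + M) * dist s t"
      using *[of s t] *[of t s] st
      by (cases s t rule: linorder_cases) (auto simp: norm_minus_commute dist_norm)
  qed (use c' M in simp)
  then show ?thesis by (rule that)
qed

text \<open>At a point of differentiability the right difference quotients converge to the
  derivative while their distance to the closed set \<open>G (\<phi> t)\<close> is at most
  \<open>c * h\<close>, so the derivative belongs to that set.\<close>

lemma quotient_bound_imp_solution:
  assumes q: "quotient_bound c T \<phi>" and T: "0 \<le> T"
  shows "is_solution G (\<phi> 0) {0..T} \<phi>"
proof -
  obtain L where L: "L-lipschitz_on {0..T} \<phi>" using quotient_bound_imp_lipschitz[OF q T] .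
  \<comment> \<open>Clamping time to the segment extends the curve to the whole line with the same
    Lipschitz constant.\<close>
  define \<psi> where "\<psi> t = \<phi> (max 0 (min T t))" for t
  have "L-lipschitz_on UNIV \<psi>"
  proof (rule lipschitz_onI)
    fix s t
    have "dist (\<psi> s) (\<psi> t) \<le> L * dist (max 0 (min T s)) (max 0 (min T t))"
      unfolding \<psi>_def using T by (intro lipschitz_onD[OF L]) auto
    also have "\<dots> \<le> L * dist s t"
      using lipschitz_on_nonneg[OF L] by (intro mult_left_mono) (auto simp: dist_real_def)
    finally show "dist (\<psi> s) (\<psi> t) \<le> L * dist s t" .
  qed (use L lipschitz_on_nonneg in blast)
  then obtain N where N: "negligible N" "\<And>x. x \<notin> N \<Longrightarrow> \<exists>v. (\<psi> has_vector_derivative v) (at x)"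
    using lipschitz_ae_vector_differentiable by blast
  have "\<exists>v. (\<phi> has_vector_derivative v) (at t within {0..T}) \<and> v \<in> G (\<phi> t)"
    if t: "t \<in> {0..T} - (N \<union> {0,T})" for t
  proof -
    have t0: "0 < t" "t < T" using t by auto
    obtain v where v: "(\<psi> has_vector_derivative v) (at t)" using N(2) t by blast
    have "(\<phi> has_vector_derivative v) (at t)"
      by (rule has_vector_derivative_transform_within_open[OF v, of "{0<..<T}"]) (use t0 in \<open>auto simp: \<psi>_def\<close>)
    then have v: "(\<phi> has_vector_derivative v) (at t)" .
    have "((\<lambda>h. (\<phi> (t + h) - \<phi> t) /\<^sub>R h) \<longlongrightarrow> v) (at 0)"
    proof -
      have lim: "((\<lambda>h. norm (\<phi> (t + h) - \<phi> t - h *\<^sub>R v) / norm h) \<longlongrightarrow> 0) (at 0)"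
        using v unfolding has_vector_derivative_def has_derivative_at by blast
      have eq: "norm (\<phi> (t + h) - \<phi> t - h *\<^sub>R v) / norm h = norm ((\<phi> (t + h) - \<phi> t) /\<^sub>R h - v)"
        if "h \<noteq> 0" for h
      proof -
        have "(\<phi> (t + h) - \<phi> t) /\<^sub>R h - v = (\<phi> (t + h) - \<phi> t - h *\<^sub>R v) /\<^sub>R h"
          using that by (simp add: scaleR_diff_right)
        then show ?thesis by (simp add: divide_inverse_commute)
      qed
      have "((\<lambda>h. norm ((\<phi> (t + h) - \<phi> t) /\<^sub>R h - v)) \<longlongrightarrow> 0) (at 0)"
        by (rule Lim_transform_eventually[OF lim])
           (unfold eventually_at_filter, intro always_eventually allI impI, rule eq)
      then show ?thesis by (subst Lim_null) (rule tendsto_norm_zero_cancel)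
    qed
    then have "((\<lambda>h. (\<phi> (t + h) - \<phi> t) /\<^sub>R h) \<longlongrightarrow> v) (at_right 0)"
      by (rule tendsto_within_subset) auto
    then have "((\<lambda>h. infdist ((\<phi> (t + h) - \<phi> t) /\<^sub>R h) (G (\<phi> t))) \<longlongrightarrow> infdist v (G (\<phi> t))) (at_right 0)"
      by (intro tendsto_intros)
    moreover have "((\<lambda>h. c * h) \<longlongrightarrow> 0) (at_right (0::real))"
      by (auto intro!: tendsto_eq_intros)
    moreover have "eventually (\<lambda>h. infdist ((\<phi> (t + h) - \<phi> t) /\<^sub>R h) (G (\<phi> t)) \<le> c * h) (at_right 0)"
    proof -
      have "eventually (\<lambda>h. h \<in> {0<..<T - t}) (at_right 0)"
        using t0 by (intro eventually_at_right_real) auto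
      then show ?thesis
      proof (rule eventually_mono)
        fix h assume "h \<in> {0<..<T - t}"
        then show "infdist ((\<phi> (t + h) - \<phi> t) /\<^sub>R h) (G (\<phi> t)) \<le> c * h"
          using q[unfolded quotient_bound_def, rule_format, of t "t + h"] t0 by auto
      qed
    qed
    ultimately have "infdist v (G (\<phi> t)) \<le> 0"
      by (intro tendsto_le[of "at_right (0::real)"]) auto
    then have "infdist v (G (\<phi> t)) = 0" using infdist_nonneg[of v "G (\<phi> t)"] by linarith
    then have "v \<in> G (\<phi> t)"
      using in_closed_iff_infdist_zero[OF closed_val nonempty_val] by blast
    then show ?thesis using v has_vector_derivative_at_within by blast
  qed
  moreover have "negligible (N \<union> {0,T})" using N(1) by auto
  ultimately show ?thesis
    unfolding is_solution_segment_iff[OF T] using lipschitz_on_imp_abs_cont_on[OF L] by blast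
qed

text \<open>Working with difference quotients avoids matching derivatives and exceptional sets. Only
  intervals straddling \<open>S\<close> need an argument: their quotient is a convex combination of
  the quotients on the two sides.\<close>

lemma solution_concat:
  assumes \<phi>: "is_solution G x {0..S} \<phi>" and \<psi>: "is_solution G (\<phi> S) {0..T} \<psi>" and ST: "0 \<le> S" "0 \<le> T"
  shows "is_solution G x {0..S + T} (\<lambda>t. if t \<le> S then \<phi> t else \<psi> (t - S))" (is "is_solution G x _ ?\<chi>")
proof -
  obtain R1 where R1: "\<And>t. t \<in> {0..S} \<Longrightarrow> norm (\<phi> t) \<le> R1" using solution_bounded[OF \<phi> ST(1)] by blast
  obtain R2 where R2: "\<And>t. t \<in> {0..T} \<Longrightarrow> norm (\<psi> t) \<le> R2" using solution_bounded[OF \<psi> ST(2)] by blast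
  define R where "R = max R1 R2"
  have R: "\<And>t. t \<in> {0..S} \<Longrightarrow> norm (\<phi> t) \<le> R" "\<And>t. t \<in> {0..T} \<Longrightarrow> norm (\<psi> t) \<le> R"
    using R1 R2 unfolding R_def by (auto simp: le_max_iff_disj)
  obtain k M where kM: "local_consts R k M" using local_consts_exist by blast
  have k: "k > 0" and M: "M > 0" using local_constsD[OF kM] by auto
  have q1: "quotient_bound (k * M) S \<phi>" by (rule solution_quotient_bound[OF \<phi> R(1) kM])
  have q2: "quotient_bound (k * M) T \<psi>" by (rule solution_quotient_bound[OF \<psi> R(2) kM])
  have \<psi>0: "\<psi> 0 = \<phi> S" and \<phi>0: "\<phi> 0 = x" using \<phi> \<psi> by (auto simp: is_solution_def)
  have \<chi>2: "?\<chi> t = \<psi> (t - S)" if "t \<ge> S" for t using that \<psi>0 by auto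
  have "quotient_bound (k * M) (S + T) ?\<chi>"
    unfolding quotient_bound_def
  proof (intro allI impI)
    fix s t assume st: "0 \<le> s" "s < t" "t \<le> S + T"
    consider "t \<le> S" | "s \<ge> S" | "s < S" "S < t" by linarith
    then show "infdist ((?\<chi> t - ?\<chi> s) /\<^sub>R (t - s)) (G (?\<chi> s)) \<le> k * M * (t - s)"
    proof cases
      case 1
      then show ?thesis using q1 st by (auto simp: quotient_bound_def)
    next
      case 2
      then show ?thesis
        using q2[unfolded quotient_bound_def, rule_format, of "s - S" "t - S"] st \<chi>2[of s] \<chi>2[of t] by simp
    next
      case 3
      define q1 where "q1 = (\<phi> S - \<phi> s) /\<^sub>R (S - s)"
      define q2 where "q2 = (\<psi> (t - S) - \<psi> 0) /\<^sub>R (t - S)"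
      define C where "C = {v. infdist v (G (\<phi> s)) \<le> k * M * (t - s)}"
      have kM0: "k * M \<ge> 0" using k M by simp
      have "infdist q1 (G (\<phi> s)) \<le> k * M * (S - s)"
        using \<open>quotient_bound (k * M) S \<phi>\<close> 3 st unfolding quotient_bound_def q1_def by auto
      also have "\<dots> \<le> k * M * (t - s)" using 3 kM0 by (intro mult_left_mono) auto
      finally have "q1 \<in> C" by (simp add: C_def)
      \<comment> \<open>Carrying the second quotient from \<open>G\<close> at the junction back to
        \<open>G (\<phi> s)\<close> costs \<open>k * M * (S - s)\<close>; added to
        \<open>k * M * (t - S)\<close> this is exactly the permitted
        \<open>k * M * (t - s)\<close>.\<close>
      have "infdist q2 (G (\<phi> s)) \<le> infdist q2 (G (\<psi> 0)) + k * norm (\<psi> 0 - \<phi> s)"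
        using R 3 st by (intro local_constsD(4)[OF kM]) (auto simp: \<psi>0)
      also have "\<dots> \<le> k * M * (t - S) + k * (M * (S - s))"
      proof (rule add_mono)
        show "infdist q2 (G (\<psi> 0)) \<le> k * M * (t - S)"
          using \<open>quotient_bound (k * M) T \<psi>\<close>[unfolded quotient_bound_def, rule_format, of 0 "t - S"] 3 st
          unfolding q2_def by auto
        have "norm (\<phi> S - \<phi> s) \<le> M * \<bar>S - s\<bar>"
          by (rule solution_lipschitz[OF \<phi> R(1) kM]) (use 3 st in auto)
        then show "k * norm (\<psi> 0 - \<phi> s) \<le> k * (M * (S - s))"
          using k 3 by (intro mult_left_mono) (auto simp: \<psi>0)
      qed
      also have "\<dots> = k * M * (t - s)" by (simp add: algebra_simps)
      finally have "q2 \<in> C" by (simp add: C_def)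
      define \<theta> where "\<theta> = (S - s) / (t - s)"
      have \<theta>: "\<theta> \<ge> 0" "1 - \<theta> \<ge> 0" "1 - \<theta> = (t - S) / (t - s)"
        using 3 st by (auto simp: \<theta>_def field_simps)
      have "convex C"
        unfolding C_def by (intro convex_infdist_le closed_val convex_val nonempty_val)
      then have "\<theta> *\<^sub>R q1 + (1 - \<theta>) *\<^sub>R q2 \<in> C"
        using \<open>q1 \<in> C\<close> \<open>q2 \<in> C\<close> \<theta> by (auto simp: convex_def)
      moreover have "\<theta> *\<^sub>R q1 = (\<phi> S - \<phi> s) /\<^sub>R (t - s)" "(1 - \<theta>) *\<^sub>R q2 = (\<psi> (t - S) - \<psi> 0) /\<^sub>R (t - s)"
        unfolding q1_def q2_def \<theta>(3) using 3 by (auto simp: \<theta>_def divide_inverse)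
      moreover have "(\<phi> S - \<phi> s) /\<^sub>R (t - s) + (\<psi> (t - S) - \<psi> 0) /\<^sub>R (t - s) = (\<psi> (t - S) - \<phi> s) /\<^sub>R (t - s)"
        unfolding \<psi>0 by (simp flip: scaleR_add_right)
      ultimately have "(\<psi> (t - S) - \<phi> s) /\<^sub>R (t - s) \<in> C" by simp
      then show ?thesis using 3 by (simp add: C_def)
    qed
  qed
  then have "is_solution G (?\<chi> 0) {0..S + T} ?\<chi>"
    by (rule quotient_bound_imp_solution) (use ST in auto)
  then show ?thesis using ST \<phi>0 by simp
qed

subsection \<open>Tracking\<close>

text \<open>The set \<open>G (\<Phi> n s)\<close> varies with \<open>n\<close>; the Lipschitz
  constant \<open>k\<close> carries the estimate over to \<open>G (g s)\<close>. The errors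
  \<open>\<epsilon>\<close> accommodate Euler polygons, and requiring the bound only eventually
  accommodates curves whose durations vary with \<open>n\<close>.\<close>

lemma quotient_bound_limit:
  assumes kM: "local_consts R k M"
    and R: "\<And>n. norm (\<Phi> n s) \<le> R"
    and lim: "(\<lambda>n. \<Phi> n s) \<longlonglongrightarrow> g s" "(\<lambda>n. \<Phi> n t) \<longlonglongrightarrow> g t" "\<epsilon> \<longlonglongrightarrow> 0"
    and ev: "eventually (\<lambda>n. infdist ((\<Phi> n t - \<Phi> n s) /\<^sub>R (t - s)) (G (\<Phi> n s)) \<le> c + \<epsilon> n) sequentially"
  shows "infdist ((g t - g s) /\<^sub>R (t - s)) (G (g s)) \<le> c"
proof -
  have gR: "norm (g s) \<le> R" using R by (intro LIMSEQ_le_const2[OF tendsto_norm[OF lim(1)]]) auto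
  let ?q = "\<lambda>n. (\<Phi> n t - \<Phi> n s) /\<^sub>R (t - s)" and ?Q = "(g t - g s) /\<^sub>R (t - s)"
  have q: "?q \<longlonglongrightarrow> ?Q" using lim by (intro tendsto_intros)
  have "eventually (\<lambda>n. infdist ?Q (G (g s)) \<le> c + \<epsilon> n + dist ?Q (?q n) + k * norm (\<Phi> n s - g s)) sequentially"
    using ev
  proof (rule eventually_mono)
    fix n assume "infdist (?q n) (G (\<Phi> n s)) \<le> c + \<epsilon> n"
    moreover have "infdist ?Q (G (g s)) \<le> infdist ?Q (G (\<Phi> n s)) + k * norm (\<Phi> n s - g s)"
      by (rule local_constsD(4)[OF kM R gR])
    moreover have "infdist ?Q (G (\<Phi> n s)) \<le> infdist (?q n) (G (\<Phi> n s)) + dist ?Q (?q n)"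
      by (rule infdist_triangle)
    ultimately show "infdist ?Q (G (g s)) \<le> c + \<epsilon> n + dist ?Q (?q n) + k * norm (\<Phi> n s - g s)" by linarith
  qed
  moreover have "(\<lambda>n. c + \<epsilon> n + dist ?Q (?q n) + k * norm (\<Phi> n s - g s)) \<longlonglongrightarrow> c + 0 + dist ?Q ?Q + k * norm (g s - g s)"
    using lim q by (intro tendsto_intros)
  ultimately have "infdist ?Q (G (g s)) \<le> c + 0 + dist ?Q ?Q + k * norm (g s - g s)"
    by (intro tendsto_le[OF _ _ tendsto_const]) auto
  then show ?thesis by simp
qed

text \<open>Each Euler velocity is the point of \<open>G\<close> nearest to the corresponding difference quotient of \<open>\<psi>\<close>. The
  polygon is written as \<open>y + (\<Sum>l<N. \<mu> l t *\<^sub>R W l)\<close>, where \<open>\<mu> l t\<close> is the time spent in the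
  \<open>l\<close>-th step up to \<open>t\<close>, so that its difference quotients are convex combinations of velocities.\<close>

lemma euler_tracking:
  assumes sol: "is_solution G x {0..T} \<psi>" and T: "0 < T"
    and R: "\<And>t. t \<in> {0..T} \<Longrightarrow> norm (\<psi> t) \<le> R" and kM: "local_consts (R + 1) k M"
    and e0: "norm (y - \<psi> 0) * exp (k * T) < 1" and \<epsilon>: "0 < \<epsilon>"
  shows "\<exists>\<Phi>. \<Phi> 0 = y \<and> (\<forall>t\<in>{0..T}. norm (\<Phi> t) \<le> R + 1) \<and>
     (\<forall>s\<in>{0..T}. \<forall>t\<in>{0..T}. norm (\<Phi> t - \<Phi> s) \<le> M * \<bar>t - s\<bar>) \<and>
     (\<forall>s t. 0 \<le> s \<longrightarrow> s < t \<longrightarrow> t \<le> T \<longrightarrow>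
        infdist ((\<Phi> t - \<Phi> s) /\<^sub>R (t - s)) (G (\<Phi> s)) \<le> k * M * (t - s) + \<epsilon>) \<and>
     (\<forall>t\<in>{0..T}. norm (\<Phi> t - \<psi> t) \<le> norm (y - \<psi> 0) * exp (k * t) + \<epsilon>)"
proof -
  have k: "k > 0" and M: "M > 0" using local_constsD[OF kM] by auto
  have R1: "norm (\<psi> t) \<le> R + 1" if "t \<in> {0..T}" for t using R[OF that] by simp
  define e where "e = norm (y - \<psi> 0)"
  have e: "e \<ge> 0" by (simp add: e_def)
  \<comment> \<open>Besides being at most \<open>\<epsilon>\<close>, the tolerance keeps the
    tracking error at most 1, so that the polygon remains in the ball of radius \<open>R + 1\<close>
    on which \<open>k\<close> and \<open>M\<close> are valid.\<close>
  define m where "m = min \<epsilon> (1 - e * exp (k * T))"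
  have m: "m > 0" "m \<le> \<epsilon>" "e * exp (k * T) + m \<le> 1" using \<epsilon> e0 by (auto simp: m_def e_def)
  \<comment> \<open>Collects all errors of order \<open>h\<close>: the quotient error
    \<open>k * M * h\<close>, the accumulated Euler error
    \<open>k * M * T * h * exp (k * T)\<close>, and \<open>2 * M * h\<close> for moving both curves
    off the grid.\<close>
  define K where "K = k * M + k * M * T * exp (k * T) + 2 * M"
  have K: "K > 0" using k M T by (simp add: K_def add_pos_pos)
  obtain n0 where n0: "T * K / m < real n0" using reals_Archimedean2 by blast
  define N where "N = Suc n0"
  define h where "h = T / N"
  have h: "h > 0" using T by (simp add: h_def N_def)
  have Nh: "real N * h = T" by (simp add: h_def N_def)
  have hK: "h * K \<le> m"
  proof -
    have "T * K / m < real N" using n0 by (simp add: N_def)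
    then have "T * K < real N * m" using m by (simp add: pos_divide_less_eq)
    then show ?thesis by (simp add: h_def N_def pos_divide_le_eq mult.commute)
  qed
  define q where "q i = (\<psi> (real (Suc i) * h) - \<psi> (real i * h)) /\<^sub>R h" for i
  have ex: "\<exists>v. v \<in> G z \<and> infdist (q i) (G z) = dist (q i) v" for i z
  proof -
    obtain v where "v \<in> G z" "infdist (q i) (G z) = dist (q i) v"
      using infdist_attains_inf[OF closed_val nonempty_val] by blast
    then show ?thesis by blast
  qed
  define w where "w i z = (SOME v. v \<in> G z \<and> infdist (q i) (G z) = dist (q i) v)" for i z
  have w: "w i z \<in> G z" "infdist (q i) (G z) = dist (q i) (w i z)" for i z
    using someI_ex[OF ex[of z i]] unfolding w_def by blast+
  define Y where "Y = rec_nat y (\<lambda>i z. z + h *\<^sub>R w i z)"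
  define W where "W i = w i (Y i)" for i
  have Y0: "Y 0 = y" and YS: "Y (Suc i) = Y i + h *\<^sub>R W i" for i by (simp_all add: Y_def W_def)
  have WG: "W i \<in> G (Y i)" for i by (simp add: W_def w)
  have grid: "real i * h \<in> {0..T}" if "i \<le> N" for i
    using that h Nh mult_right_mono[of "real i" "real N" h] by simp
  \<comment> \<open>Local error of one step: the mean velocity of \<open>\<psi>\<close> over a cell
    is within \<open>k * M * h\<close> of \<open>G\<close> at its left end and acts for time
    \<open>h\<close>.\<close>
  define a where "a = k * M * h\<^sup>2"
  have a: "a \<ge> 0" using k M by (simp add: a_def)
  \<comment> \<open>A majorant with \<open>(1 + k * h) * E i + a \<le> E (Suc i)\<close>: every
    local error is charged the full growth factor. Since it does not involve the polygon, it can be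
    bounded by 1 before the induction, which needs that bound to stay in the ball.\<close>
  define E where "E i = (e + real i * a) * (1 + k * h) ^ i" for i
  have Ebound: "E i \<le> (e + k * M * T * h) * exp (k * (real i * h))" if "i \<le> N" for i
  proof -
    have "real i * a \<le> real N * a" using that a by (intro mult_right_mono) auto
    also have "\<dots> = k * M * (real N * h) * h" by (simp add: a_def power2_eq_square)
    finally have 1: "real i * a \<le> k * M * T * h" by (simp only: Nh)
    have "(1 + k * h) ^ i \<le> exp (k * h) ^ i"
      using k h by (intro power_mono exp_ge_add_one_self) auto
    also have "\<dots> = exp (k * (real i * h))" by (simp flip: exp_of_nat_mult add: mult_ac)
    finally have 2: "(1 + k * h) ^ i \<le> exp (k * (real i * h))" .
    show ?thesis unfolding E_def using 1 2 e a k h M T by (intro mult_mono) auto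
  qed
  have EK: "(e + k * M * T * h) * exp (k * t) + 2 * M * h \<le> e * exp (k * t) + m" if "t \<in> {0..T}" for t
  proof -
    have "k * M * T * h * exp (k * t) \<le> k * M * T * h * exp (k * T)"
      using that k h M T by (intro mult_left_mono) auto
    moreover have "k * M * h > 0" using k M h by simp
    moreover have "h * K = k * M * h + k * M * T * h * exp (k * T) + 2 * M * h"
      by (simp add: K_def algebra_simps)
    ultimately have "k * M * T * h * exp (k * t) + 2 * M * h \<le> m" using hK by linarith
    then show ?thesis by (simp add: algebra_simps)
  qed
  have emono: "e * exp (k * t) \<le> e * exp (k * T)" if "t \<in> {0..T}" for t
    using that k e by (intro mult_left_mono) auto
  have E1: "E i \<le> 1" if "i \<le> N" for i
  proof -
    have "M * h > 0" using M h by simp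
    then show ?thesis
      using Ebound[OF that] EK[OF grid[OF that]] emono[OF grid[OF that]] m by linarith
  qed
  have YE: "norm (Y i - \<psi> (real i * h)) \<le> E i" if "i \<le> N" for i
    using that
  proof (induction i)
    case 0
    then show ?case by (simp add: Y0 E_def e_def)
  next
    case (Suc i)
    then have i: "i \<le> N" and IH: "norm (Y i - \<psi> (real i * h)) \<le> E i" by auto
    have Yi: "norm (Y i) \<le> R + 1"
      using norm_triangle_sub[of "Y i" "\<psi> (real i * h)"] IH E1[OF i] R[OF grid[OF i]] by linarith
    have "infdist (q i) (G (Y i)) \<le> infdist (q i) (G (\<psi> (real i * h))) + k * norm (\<psi> (real i * h) - Y i)"
      by (rule local_constsD(4)[OF kM R1[OF grid[OF i]] Yi])
    also have "\<dots> \<le> k * M * h + k * E i"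
    proof (rule add_mono)
      have "real i * h < real (Suc i) * h" using h by simp
      then have "infdist (q i) (G (\<psi> (real i * h))) \<le> k * M * (real (Suc i) * h - real i * h)"
        using solution_quotient_bound[OF sol R1 kM, unfolded quotient_bound_def, rule_format,
            of "real i * h" "real (Suc i) * h"] grid[OF i] grid[OF Suc.prems]
        unfolding q_def by (simp add: algebra_simps)
      then show "infdist (q i) (G (\<psi> (real i * h))) \<le> k * M * h" by (simp add: algebra_simps)
      show "k * norm (\<psi> (real i * h) - Y i) \<le> k * E i"
        using IH k by (simp add: norm_minus_commute)
    qed
    finally have Wq: "norm (W i - q i) \<le> k * M * h + k * E i"
      unfolding w(2) W_def[symmetric] by (simp add: dist_norm norm_minus_commute)
    have "Y (Suc i) - \<psi> (real (Suc i) * h) = (Y i - \<psi> (real i * h)) + h *\<^sub>R (W i - q i)"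
      using h by (simp add: YS q_def scaleR_diff_right)
    then have "norm (Y (Suc i) - \<psi> (real (Suc i) * h)) \<le> norm (Y i - \<psi> (real i * h)) + h * norm (W i - q i)"
      using norm_triangle_ineq[of "Y i - \<psi> (real i * h)" "h *\<^sub>R (W i - q i)"] h by simp
    also have "\<dots> \<le> E i + h * (k * M * h + k * E i)"
      using IH Wq h by (intro add_mono mult_left_mono) auto
    also have "\<dots> = (1 + k * h) * E i + a" by (simp add: a_def algebra_simps power2_eq_square)
    also have "\<dots> \<le> E (Suc i)"
    proof -
      have "1 \<le> (1 + k * h) ^ Suc i" using k h by (intro one_le_power) auto
      then have "a \<le> a * (1 + k * h) ^ Suc i" using a mult_left_mono by fastforce
      then show ?thesis by (simp add: E_def algebra_simps)
    qed
    finally show ?case .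
  qed
  have YR: "norm (Y i) \<le> R + 1" if "i \<le> N" for i
    using norm_triangle_sub[of "Y i" "\<psi> (real i * h)"] YE[OF that] E1[OF that] R[OF grid[OF that]] by linarith
  define \<mu> where "\<mu> l t = max 0 (min h (t - real l * h))" for l :: nat and t
  have \<mu>mono: "\<mu> l s \<le> \<mu> l t" if "s \<le> t" for l s t using that by (auto simp: \<mu>_def)
  have \<mu>sum: "(\<Sum>l<n. \<mu> l t) = max 0 (min (real n * h) t)" for n t
  proof (induction n)
    case 0 then show ?case by simp
  next
    case (Suc n)
    have "real n * h \<ge> 0" using h by simp
    moreover have "real (Suc n) * h = real n * h + h" by (simp add: distrib_right)
    moreover have "(\<Sum>l<Suc n. \<mu> l t) = max 0 (min (real n * h) t) + max 0 (min h (t - real n * h))"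
      using Suc by (simp add: \<mu>_def)
    ultimately show ?case using h by linarith
  qed
  have \<mu>T: "(\<Sum>l<N. \<mu> l t) = t" if "t \<in> {0..T}" for t using that \<mu>sum[of t N] Nh by auto
  define \<Phi> where "\<Phi> t = y + (\<Sum>l<N. \<mu> l t *\<^sub>R W l)" for t
  have Ysum: "Y i = y + (\<Sum>l<i. h *\<^sub>R W l)" for i by (induction i) (auto simp: Y0 YS)
  have \<Phi>grid: "\<Phi> (real i * h) = Y i" if "i \<le> N" for i
  proof -
    have \<mu>i: "\<mu> l (real i * h) = (if l < i then h else 0)" for l
    proof (cases "l < i")
      case True
      then have "real l + 1 \<le> real i" by simp
      then have "(real l + 1) * h \<le> real i * h" using h by (intro mult_right_mono) auto
      then show ?thesis using True h by (simp add: \<mu>_def algebra_simps)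
    next
      case False
      then have "real i * h \<le> real l * h" using h by (intro mult_right_mono) auto
      then have "real i * h - real l * h \<le> 0" by simp
      then have "max 0 (min h (real i * h - real l * h)) = 0" using h by linarith
      then show ?thesis using False by (simp add: \<mu>_def)
    qed
    have "(\<Sum>l<N. \<mu> l (real i * h) *\<^sub>R W l) = (\<Sum>l\<in>{..<N}. if l < i then h *\<^sub>R W l else 0)"
      by (rule sum.cong) (auto simp: \<mu>i)
    also have "\<dots> = (\<Sum>l\<in>{l\<in>{..<N}. l < i}. h *\<^sub>R W l)" by (rule sum.inter_filter[symmetric]) simp
    also have "{l\<in>{..<N}. l < i} = {..<i}" using that by auto
    finally show ?thesis by (simp add: \<Phi>_def Ysum)
  qed
  have mean: "(\<Phi> t - \<Phi> s) /\<^sub>R (t - s) \<in> C"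
    if st: "0 \<le> s" "s < t" "t \<le> T" and C: "convex C"
      and WC: "\<And>l. l < N \<Longrightarrow> \<mu> l s < \<mu> l t \<Longrightarrow> W l \<in> C" for s t C
  proof -
    define S where "S = {l\<in>{..<N}. \<mu> l s < \<mu> l t}"
    have out: "\<mu> l t - \<mu> l s = 0" if "l \<in> {..<N} - S" for l
      using that \<mu>mono[of s t l] st by (auto simp: S_def)
    have "(\<Sum>l\<in>S. \<mu> l t - \<mu> l s) = (\<Sum>l<N. \<mu> l t - \<mu> l s)"
      by (rule sum.mono_neutral_left) (use out in \<open>auto simp: S_def\<close>)
    also have "\<dots> = t - s" using \<mu>T[of t] \<mu>T[of s] st by (simp add: sum_subtractf)
    finally have one: "(\<Sum>l\<in>S. (\<mu> l t - \<mu> l s) / (t - s)) = 1"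
      using st by (simp flip: sum_divide_distrib)
    have "\<Phi> t - \<Phi> s = (\<Sum>l<N. (\<mu> l t - \<mu> l s) *\<^sub>R W l)"
      by (simp add: \<Phi>_def sum_subtractf scaleR_diff_left)
    also have "\<dots> = (\<Sum>l\<in>S. (\<mu> l t - \<mu> l s) *\<^sub>R W l)"
      by (rule sum.mono_neutral_right) (use out in \<open>auto simp: S_def\<close>)
    finally have "(\<Phi> t - \<Phi> s) /\<^sub>R (t - s) = (\<Sum>l\<in>S. ((\<mu> l t - \<mu> l s) / (t - s)) *\<^sub>R W l)"
      by (simp add: scaleR_sum_right divide_inverse_commute)
    also have "\<dots> \<in> C"
      by (rule convex_sum[OF _ C one]) (use WC st \<mu>mono[of s t] in \<open>auto simp: S_def\<close>)
    finally show ?thesis .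
  qed
  have lip: "norm (\<Phi> t - \<Phi> s) \<le> M * \<bar>t - s\<bar>" if "s \<in> {0..T}" "t \<in> {0..T}" for s t
  proof -
    have *: "norm (\<Phi> t - \<Phi> s) \<le> M * (t - s)" if "0 \<le> s" "s < t" "t \<le> T" for s t
    proof -
      have "(\<Phi> t - \<Phi> s) /\<^sub>R (t - s) \<in> cball 0 M"
      proof (rule mean[OF that])
        fix l assume "l < N"
        then have "norm (Y l) \<le> R + 1" using YR by simp
        then show "W l \<in> cball 0 M" using local_constsD(3)[OF kM _ WG] by simp
      qed simp
      then have "norm (\<Phi> t - \<Phi> s) / (t - s) \<le> M" using that by (simp add: divide_inverse_commute)
      then show ?thesis using that by (simp add: pos_divide_le_eq)
    qed
    show ?thesis
      using *[of s t] *[of t s] that by (cases s t rule: linorder_cases) (auto simp: norm_minus_commute)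
  qed
  have close: "norm (\<Phi> t - \<psi> t) \<le> e * exp (k * t) + m" if t: "t \<in> {0..T}" for t
  proof -
    define i where "i = nat \<lfloor>t / h\<rfloor>"
    have "0 \<le> t / h" using t h by simp
    then have "real i \<le> t / h" "t / h < real i + 1" unfolding i_def by linarith+
    then have i1: "real i * h \<le> t" "t \<le> real i * h + h"
      using h by (auto simp: pos_le_divide_eq pos_divide_less_eq distrib_right)
    have "real i * h \<le> real N * h" using i1 t Nh by simp
    then have iN: "i \<le> N" using h by simp
    have "norm (\<Phi> t - \<Phi> (real i * h)) \<le> M * \<bar>t - real i * h\<bar>" using lip grid[OF iN] t by blast
    also have "\<dots> \<le> M * h" using i1 M by (intro mult_left_mono) auto
    finally have 1: "norm (\<Phi> t - Y i) \<le> M * h" by (simp add: \<Phi>grid[OF iN])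
    have "norm (\<psi> t - \<psi> (real i * h)) \<le> M * \<bar>t - real i * h\<bar>"
      using solution_lipschitz[OF sol R1 kM] grid[OF iN] t by blast
    also have "\<dots> \<le> M * h" using i1 M by (intro mult_left_mono) auto
    finally have 2: "norm (\<psi> (real i * h) - \<psi> t) \<le> M * h" by (simp add: norm_minus_commute)
    have "norm (Y i - \<psi> (real i * h)) \<le> (e + k * M * T * h) * exp (k * (real i * h))"
      using YE[OF iN] Ebound[OF iN] by linarith
    also have "\<dots> \<le> (e + k * M * T * h) * exp (k * t)"
      using i1 e k M T h by (intro mult_left_mono) auto
    finally have 3: "norm (Y i - \<psi> (real i * h)) \<le> (e + k * M * T * h) * exp (k * t)" .
    have "norm (\<Phi> t - \<psi> t) \<le> norm (\<Phi> t - Y i) + norm (Y i - \<psi> (real i * h)) + norm (\<psi> (real i * h) - \<psi> t)"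
      using dist_triangle[of "\<Phi> t" "\<psi> t" "\<psi> (real i * h)"] dist_triangle[of "\<Phi> t" "\<psi> (real i * h)" "Y i"]
      unfolding dist_norm by linarith
    then show ?thesis using 1 2 3 EK[OF t] by linarith
  qed
  have \<Phi>R: "norm (\<Phi> t) \<le> R + 1" if t: "t \<in> {0..T}" for t
    using norm_triangle_sub[of "\<Phi> t" "\<psi> t"] close[OF t] emono[OF t] m R[OF t] by linarith
  have quot: "infdist ((\<Phi> t - \<Phi> s) /\<^sub>R (t - s)) (G (\<Phi> s)) \<le> k * M * (t - s) + \<epsilon>"
    if st: "0 \<le> s" "s < t" "t \<le> T" for s t
  proof -
    have "(\<Phi> t - \<Phi> s) /\<^sub>R (t - s) \<in> {v. infdist v (G (\<Phi> s)) \<le> k * M * (t - s) + \<epsilon>}"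
    proof (rule mean[OF st])
      show "convex {v. infdist v (G (\<Phi> s)) \<le> k * M * (t - s) + \<epsilon>}"
        by (intro convex_infdist_le closed_val convex_val nonempty_val)
      fix l assume l: "l < N" "\<mu> l s < \<mu> l t"
      \<comment> \<open>A step that contributes between \<open>s\<close> and \<open>t\<close>
        started before \<open>t\<close> and ended after \<open>s\<close>, so its base point
        \<open>Y l\<close> is within \<open>M * ((t - s) + h)\<close> of
        \<open>\<Phi> s\<close>.\<close>
      have "real l * h < t" "s < real l * h + h"
        using l(2) h st unfolding \<mu>_def by linarith+
      then have d: "\<bar>s - real l * h\<bar> \<le> (t - s) + h" using st h by linarith
      have lN: "l \<le> N" "s \<in> {0..T}" using l st by auto
      have "norm (Y l - \<Phi> s) \<le> M * \<bar>real l * h - s\<bar>"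
        using lip[OF lN(2) grid[OF lN(1)]] by (simp add: \<Phi>grid[OF lN(1)])
      also have "\<dots> \<le> M * ((t - s) + h)" using d M by (intro mult_left_mono) auto
      finally have "k * norm (Y l - \<Phi> s) \<le> k * (M * ((t - s) + h))" using k by simp
      moreover have "infdist (W l) (G (\<Phi> s)) \<le> infdist (W l) (G (Y l)) + k * norm (Y l - \<Phi> s)"
        by (rule local_constsD(4)[OF kM YR[OF lN(1)] \<Phi>R[OF lN(2)]])
      moreover have "infdist (W l) (G (Y l)) = 0" using WG by simp
      ultimately have "infdist (W l) (G (\<Phi> s)) \<le> k * (M * ((t - s) + h))" by linarith
      also have "\<dots> = k * M * (t - s) + k * M * h" by (simp add: algebra_simps)
      also have "k * M * h \<le> \<epsilon>"
      proof -
        have "h * K = k * M * h + (k * M * T * h * exp (k * T) + 2 * M * h)" by (simp add: K_def algebra_simps)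
        moreover have "k * M * T * h * exp (k * T) + 2 * M * h \<ge> 0" using k M T h by simp
        ultimately show ?thesis using hK m by linarith
      qed
      finally show "W l \<in> {v. infdist v (G (\<Phi> s)) \<le> k * M * (t - s) + \<epsilon>}" by simp
    qed
    then show ?thesis by simp
  qed
  have "\<Phi> 0 = y" using \<Phi>grid[of 0] Y0 by simp
  moreover have "norm (\<Phi> t - \<psi> t) \<le> norm (y - \<psi> 0) * exp (k * t) + \<epsilon>" if "t \<in> {0..T}" for t
    using close[OF that] m unfolding e_def by linarith
  ultimately show ?thesis using \<Phi>R lip quot by (intro exI[of _ \<Phi>] conjI ballI allI impI) simp_all
qed

text \<open>Filippov's estimate as a limit of Euler polygons: as the tolerances tend to 0, the
  excess in the difference quotients and the excess in the distance to \<open>\<psi>\<close> both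
  vanish. The smallness of the initial distance is what keeps the polygons in the ball of radius
  \<open>R + 1\<close>.\<close>

lemma solution_tracking:
  assumes sol: "is_solution G x {0..T} \<psi>" and T: "0 \<le> T"
    and R: "\<And>t. t \<in> {0..T} \<Longrightarrow> norm (\<psi> t) \<le> R" and kM: "local_consts (R + 1) k M"
    and e0: "norm (y - \<psi> 0) * exp (k * T) < 1"
  shows "\<exists>\<phi>. is_solution G y {0..T} \<phi> \<and> (\<forall>t\<in>{0..T}. norm (\<phi> t - \<psi> t) \<le> norm (y - \<psi> 0) * exp (k * t))"
proof (cases "T = 0")
  case True
  have "quotient_bound 0 T (\<lambda>_. y)" by (auto simp: quotient_bound_def True)
  then have "is_solution G y {0..T} (\<lambda>_. y)" using quotient_bound_imp_solution[of 0 T "\<lambda>_. y"] T by simp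
  then show ?thesis using True by (intro exI[of _ "\<lambda>_. y"]) auto
next
  case False
  then have T0: "0 < T" using T by simp
  define P where "P \<epsilon> \<Phi> \<longleftrightarrow> \<Phi> 0 = y \<and> (\<forall>t\<in>{0..T}. norm (\<Phi> t) \<le> R + 1) \<and>
     (\<forall>s\<in>{0..T}. \<forall>t\<in>{0..T}. norm (\<Phi> t - \<Phi> s) \<le> M * \<bar>t - s\<bar>) \<and>
     (\<forall>s t. 0 \<le> s \<longrightarrow> s < t \<longrightarrow> t \<le> T \<longrightarrow>
        infdist ((\<Phi> t - \<Phi> s) /\<^sub>R (t - s)) (G (\<Phi> s)) \<le> k * M * (t - s) + \<epsilon>) \<and>
     (\<forall>t\<in>{0..T}. norm (\<Phi> t - \<psi> t) \<le> norm (y - \<psi> 0) * exp (k * t) + \<epsilon>)" for \<epsilon> \<Phi>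
  have "\<exists>\<Phi>. P (inverse (real (Suc n))) \<Phi>" for n
    unfolding P_def by (rule euler_tracking[OF sol T0 R kM e0]) auto
  then have "\<exists>\<Phi>. \<forall>n. P (inverse (real (Suc n))) (\<Phi> n)" by (intro choice allI)
  then obtain \<Phi> where \<Phi>: "\<And>n. P (inverse (real (Suc n))) (\<Phi> n)" by blast
  have \<Phi>R: "\<And>n t. t \<in> {0..T} \<Longrightarrow> norm (\<Phi> n t) \<le> R + 1"
    and \<Phi>M: "\<And>n s t. s \<in> {0..T} \<Longrightarrow> t \<in> {0..T} \<Longrightarrow> norm (\<Phi> n t - \<Phi> n s) \<le> M * \<bar>t - s\<bar>"
    using \<Phi> unfolding P_def by blast+
  obtain g r where r: "strict_mono (r :: nat \<Rightarrow> nat)" and g: "\<And>t. t \<in> {0..T} \<Longrightarrow> (\<lambda>n. \<Phi> (r n) t) \<longlonglongrightarrow> g t"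
  proof (rule lipschitz_sequence_convergent_subsequence[of T \<Phi> "R + 1" M])
    fix g r
    assume "strict_mono (r :: nat \<Rightarrow> nat)" "\<And>t. t \<in> {0..T} \<Longrightarrow> (\<lambda>n. \<Phi> (r n) t) \<longlonglongrightarrow> g t"
    then show thesis by (rule that)
  qed (use \<Phi>R \<Phi>M in simp_all)
  have inv: "(\<lambda>n. inverse (real (Suc (r n)))) \<longlonglongrightarrow> 0"
    using LIMSEQ_subseq_LIMSEQ[OF LIMSEQ_inverse_real_of_nat r] by (simp add: o_def)
  have "quotient_bound (k * M) T g"
    unfolding quotient_bound_def
  proof (intro allI impI)
    fix s t assume st: "0 \<le> s" "s < t" "t \<le> T"
    show "infdist ((g t - g s) /\<^sub>R (t - s)) (G (g s)) \<le> k * M * (t - s)"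
    proof (rule quotient_bound_limit[OF kM, where \<Phi> = "\<lambda>n. \<Phi> (r n)" and g = g])
      show "norm (\<Phi> (r n) s) \<le> R + 1" for n using \<Phi>R st by simp
      show "(\<lambda>n. \<Phi> (r n) s) \<longlonglongrightarrow> g s" "(\<lambda>n. \<Phi> (r n) t) \<longlonglongrightarrow> g t" using g st by auto
      show "(\<lambda>n. inverse (real (Suc (r n)))) \<longlonglongrightarrow> 0" by (rule inv)
      show "\<forall>\<^sub>F n in sequentially. infdist ((\<Phi> (r n) t - \<Phi> (r n) s) /\<^sub>R (t - s)) (G (\<Phi> (r n) s))
          \<le> k * M * (t - s) + inverse (real (Suc (r n)))"
        using \<Phi> st unfolding P_def by (intro always_eventually allI) blast
    qed
  qed
  then have "is_solution G (g 0) {0..T} g" using T by (rule quotient_bound_imp_solution)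
  moreover have "g 0 = y"
    using g[of 0] T \<Phi> by (simp add: P_def LIMSEQ_const_iff)
  moreover have "norm (g t - \<psi> t) \<le> norm (y - \<psi> 0) * exp (k * t)" if t: "t \<in> {0..T}" for t
  proof (rule LIMSEQ_le)
    show "(\<lambda>n. norm (\<Phi> (r n) t - \<psi> t)) \<longlonglongrightarrow> norm (g t - \<psi> t)" using g[OF t] by (intro tendsto_intros)
    show "(\<lambda>n. norm (y - \<psi> 0) * exp (k * t) + inverse (real (Suc (r n)))) \<longlonglongrightarrow> norm (y - \<psi> 0) * exp (k * t)"
      using tendsto_add[OF tendsto_const inv] by simp
    show "\<exists>N. \<forall>n\<ge>N. norm (\<Phi> (r n) t - \<psi> t) \<le> norm (y - \<psi> 0) * exp (k * t) + inverse (real (Suc (r n)))"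
      using \<Phi> t unfolding P_def by blast
  qed
  ultimately show ?thesis by blast
qed

subsection \<open>Reachable sets\<close>

definition reach :: "real \<Rightarrow> 'a \<Rightarrow> 'a set" where
  "reach T x = {\<phi> \<tau> |\<phi> \<tau>. 0 \<le> \<tau> \<and> \<tau> \<le> T \<and> is_solution G x {0..\<tau>} \<phi>}"

lemma solution_continuous_on:
  assumes "is_solution G x {0..T} \<phi>" "0 \<le> T"
  shows "continuous_on {0..T} \<phi>"
  using assms abs_cont_on_imp_continuous_on by (auto simp: is_solution_segment_iff)

lemma local_consts_mono:
  assumes "local_consts R k M" "R' \<le> R" "M \<le> M'"
  shows "local_consts R' k M'"
  unfolding local_consts_def
proof (intro conjI allI impI)
  show "0 < k" "0 < M'" using local_constsD(1,2)[OF assms(1)] assms(3) by auto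
  show "norm v \<le> M'" if "norm x \<le> R'" "v \<in> G x" for x v
    using local_constsD(3)[OF assms(1) _ that(2)] that(1) assms(2,3) by linarith
  show "infdist v (G y) \<le> infdist v (G x) + k * norm (x - y)" if "norm x \<le> R'" "norm y \<le> R'" for x y v
    using local_constsD(4)[OF assms(1)] that assms(2) by simp
qed

lemma reachI:
  assumes "is_solution G x {0..\<tau>} \<phi>" "\<tau> \<le> T" "t \<in> {0..\<tau>}"
  shows "\<phi> t \<in> reach T x"
  unfolding reach_def using is_solution_restrict[OF assms(1,3)] assms(2,3)
  by (intro CollectI exI[of _ \<phi>] exI[of _ t]) auto

lemma reach_self: "0 \<le> T \<Longrightarrow> x \<in> reach T x"
proof -
  assume T: "0 \<le> T"
  have "quotient_bound 0 0 (\<lambda>_. x)" by (auto simp: quotient_bound_def)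
  then have "is_solution G x {0..0} (\<lambda>_. x)" using quotient_bound_imp_solution[of 0 0 "\<lambda>_. x"] by simp
  then show ?thesis using reachI[of x 0 "\<lambda>_. x" T 0] T by simp
qed

lemma reach_concat:
  assumes \<phi>: "is_solution G x {0..s} \<phi>" "0 \<le> s" and z: "z \<in> reach T (\<phi> s)"
  shows "z \<in> reach (s + T) x"
proof -
  obtain \<psi> \<tau> where \<psi>: "0 \<le> \<tau>" "\<tau> \<le> T" "is_solution G (\<phi> s) {0..\<tau>} \<psi>" "z = \<psi> \<tau>"
    using z unfolding reach_def by auto
  have sol: "is_solution G x {0..s + \<tau>} (\<lambda>t. if t \<le> s then \<phi> t else \<psi> (t - s))"
    by (rule solution_concat[OF \<phi>(1) \<psi>(3) \<phi>(2) \<psi>(1)])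
  have "\<psi> 0 = \<phi> s" using \<psi>(3) by (simp add: is_solution_def)
  then have "z = (\<lambda>t. if t \<le> s then \<phi> t else \<psi> (t - s)) (s + \<tau>)" using \<psi> by auto
  then show ?thesis using reachI[OF sol, of "s + T" "s + \<tau>"] \<psi> \<phi>(2) by simp
qed

text \<open>Suppose a solution from \<open>y\<close> exceeds radius \<open>\<rho> + 1\<close>. Up to
  the first time it has that norm it can be tracked from \<open>x\<close> with error below 1/2,
  which places a point reachable from \<open>x\<close> beyond radius \<open>\<rho>\<close>.\<close>

lemma reach_bounded_nearby:
  assumes \<rho>: "reach T x \<subseteq> cball 0 \<rho>" and T: "0 \<le> T"
  shows "\<exists>\<eta>>0. \<forall>y. norm (y - x) < \<eta> \<longrightarrow> reach T y \<subseteq> cball 0 (\<rho> + 1)"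
proof -
  \<comment> \<open>Radius \<open>\<rho> + 1\<close> bounds the stopped solution from
    \<open>y\<close>, and tracking it requires one more.\<close>
  obtain k M where kM: "local_consts ((\<rho> + 1) + 1) k M" using local_consts_exist by blast
  have k: "k > 0" using local_constsD(1)[OF kM] .
  have x: "norm x \<le> \<rho>" using reach_self[OF T, of x] \<rho> by auto
  show ?thesis
  proof (intro exI[of _ "exp (- (k * T)) / 2"] conjI allI impI subsetI)
    fix y z assume y: "norm (y - x) < exp (- (k * T)) / 2" and z: "z \<in> reach T y"
    have yT: "norm (x - y) * exp (k * T) < 1 / 2"
    proof -
      have "norm (x - y) * exp (k * T) < exp (- (k * T)) / 2 * exp (k * T)"
        using y by (intro mult_strict_right_mono) (auto simp: norm_minus_commute)
      also have "\<dots> = 1 / 2" by (simp add: exp_minus field_simps)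
      finally show ?thesis .
    qed
    have y1: "norm (x - y) < 1 / 2"
    proof -
      have "norm (x - y) * 1 \<le> norm (x - y) * exp (k * T)" using k T by (intro mult_left_mono) auto
      then show ?thesis using yT by simp
    qed
    obtain \<phi> \<tau> where \<phi>: "0 \<le> \<tau>" "\<tau> \<le> T" "is_solution G y {0..\<tau>} \<phi>" "z = \<phi> \<tau>"
      using z unfolding reach_def by auto
    have \<phi>0: "\<phi> 0 = y" using \<phi>(3) by (simp add: is_solution_def)
    show "z \<in> cball 0 (\<rho> + 1)"
    proof (rule ccontr)
      assume "z \<notin> cball 0 (\<rho> + 1)"
      then have big: "\<rho> + 1 \<le> norm (\<phi> \<tau>)" using \<phi>(4) by simp
      have "norm (\<phi> 0) < \<rho> + 1"
        using norm_triangle_sub[of y x] x y1 by (simp add: \<phi>0 norm_minus_commute)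
      then obtain \<sigma> where \<sigma>: "0 \<le> \<sigma>" "\<sigma> \<le> \<tau>" "norm (\<phi> \<sigma>) = \<rho> + 1" "\<And>s. s \<in> {0..\<sigma>} \<Longrightarrow> norm (\<phi> s) \<le> \<rho> + 1"
        using first_hitting_time[of \<tau> "\<lambda>t. norm (\<phi> t)" "\<rho> + 1"]
          continuous_on_norm[OF solution_continuous_on[OF \<phi>(3,1)]] big \<phi>(1) by blast
      have sol: "is_solution G y {0..\<sigma>} \<phi>" using is_solution_restrict[OF \<phi>(3)] \<sigma> by auto
      have mono: "norm (x - y) * exp (k * \<sigma>) \<le> norm (x - y) * exp (k * T)"
        using k \<sigma> \<phi>(2) by (intro mult_left_mono) auto
      then have "norm (x - \<phi> 0) * exp (k * \<sigma>) < 1" using yT by (simp add: \<phi>0)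
      then obtain \<phi>' where \<phi>': "is_solution G x {0..\<sigma>} \<phi>'"
        "\<forall>t\<in>{0..\<sigma>}. norm (\<phi>' t - \<phi> t) \<le> norm (x - \<phi> 0) * exp (k * t)"
        using solution_tracking[OF sol \<sigma>(1) \<sigma>(4) kM] by blast
      have "norm (\<phi>' \<sigma> - \<phi> \<sigma>) \<le> norm (x - \<phi> 0) * exp (k * \<sigma>)" using \<phi>'(2) \<sigma>(1) by auto
      then have "norm (\<phi>' \<sigma> - \<phi> \<sigma>) < 1 / 2" using yT mono by (simp add: \<phi>0)
      moreover have "\<phi>' \<sigma> \<in> reach T x" by (rule reachI[OF \<phi>'(1)]) (use \<sigma> \<phi> in auto)
      then have "norm (\<phi>' \<sigma>) \<le> \<rho>" using \<rho> by auto
      ultimately show False using \<sigma>(3) norm_triangle_sub[of "\<phi> \<sigma>" "\<phi>' \<sigma>"] by (simp add: norm_minus_commute)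
    qed
  qed simp
qed

section \<open>Boundedness of reachable sets under completeness\<close>

lemma solution_stays_near:
  assumes sol: "is_solution G x {0..\<tau>} \<phi>" and \<tau>: "0 \<le> \<tau>" "\<tau> \<le> 1 / (1 + M)"
    and kM: "local_consts (norm x + 1) k M"
  shows "norm (\<phi> \<tau>) \<le> norm x + 1"
proof (rule ccontr)
  assume "\<not> ?thesis"
  then have big: "1 \<le> norm (\<phi> \<tau> - x)" using norm_triangle_sub[of "\<phi> \<tau>" x] by linarith
  have M: "M > 0" using local_constsD(2)[OF kM] .
  have \<phi>0: "\<phi> 0 = x" using sol by (simp add: is_solution_def)
  have "continuous_on {0..\<tau>} (\<lambda>t. norm (\<phi> t - x))"
    using solution_continuous_on[OF sol \<tau>(1)] by (intro continuous_intros)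
  then obtain \<sigma> where \<sigma>: "0 \<le> \<sigma>" "\<sigma> \<le> \<tau>" "norm (\<phi> \<sigma> - x) = 1" "\<And>s. s \<in> {0..\<sigma>} \<Longrightarrow> norm (\<phi> s - x) \<le> 1"
    using first_hitting_time[of \<tau> "\<lambda>t. norm (\<phi> t - x)" 1] big \<tau>(1) \<phi>0 by auto
  have "norm (\<phi> s) \<le> norm x + 1" if "s \<in> {0..\<sigma>}" for s
    using \<sigma>(4)[OF that] norm_triangle_sub[of "\<phi> s" x] by linarith
  moreover have "is_solution G x {0..\<sigma>} \<phi>" using is_solution_restrict[OF sol] \<sigma> by auto
  ultimately have "norm (\<phi> \<sigma> - \<phi> 0) \<le> M * \<bar>\<sigma> - 0\<bar>"
    using solution_lipschitz[of x \<sigma> \<phi> "norm x + 1" k M 0 \<sigma>] kM \<sigma>(1) by auto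
  \<comment> \<open>At speed at most \<open>M\<close>, covering the distance 1 takes longer than
    \<open>1 / (1 + M)\<close>.\<close>
  then have "1 \<le> M * \<sigma>" using \<sigma>(1,3) \<phi>0 by simp
  also have "\<dots> \<le> M * (1 / (1 + M))" using \<sigma> \<tau> M by (intro mult_left_mono) auto
  also have "\<dots> < 1" using M by simp
  finally show False by simp
qed

text \<open>Up to time \<open>\<delta>\<close> no solution from \<open>x\<close> exceeds norm
  \<open>norm x + 1\<close>, so those that get far last longer, and a subsequence converges on
  \<open>{0..\<delta>}\<close> to a solution \<open>g\<close>. If the points reachable from
  \<open>g \<delta>\<close> were bounded, a common bound would hold for all starting points near it,
  against the far endpoints of the approximating solutions.\<close>

lemma unbounded_reach_step:
  assumes unb: "\<not> bounded (reach T x)" and kM: "local_consts (norm x + 1) k M"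
  defines "\<delta> \<equiv> 1 / (1 + M)"
  shows "\<exists>\<phi>. is_solution G x {0..\<delta>} \<phi> \<and> \<not> bounded (reach (T - \<delta>) (\<phi> \<delta>))"
proof -
  define R where "R = norm x + 1"
  have kMR: "local_consts R k M" using kM by (simp add: R_def)
  have M: "M > 0" and k: "k > 0" using local_constsD[OF kM] by auto
  have \<delta>: "\<delta> > 0" using M by (simp add: \<delta>_def)
  have stay: "norm (\<phi> t) \<le> R" if "is_solution G x {0..\<tau>} \<phi>" "t \<in> {0..\<tau>}" "t \<le> \<delta>" for \<phi> \<tau> t
    using solution_stays_near[OF is_solution_restrict[OF that(1,2)] _ _ kM] that(2,3) by (auto simp: R_def \<delta>_def)
  have "\<exists>\<phi> \<tau>. \<delta> < \<tau> \<and> \<tau> \<le> T \<and> is_solution G x {0..\<tau>} \<phi> \<and> R + real n < norm (\<phi> \<tau>)" for n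
  proof -
    obtain y where y: "y \<in> reach T x" "\<not> norm y \<le> R + real n"
      using unb unfolding bounded_iff by blast
    then obtain \<phi> \<tau> where \<phi>: "0 \<le> \<tau>" "\<tau> \<le> T" "is_solution G x {0..\<tau>} \<phi>" "y = \<phi> \<tau>" by (auto simp: reach_def)
    have "\<delta> < \<tau>"
    proof (rule ccontr)
      assume "\<not> \<delta> < \<tau>"
      then have "norm (\<phi> \<tau>) \<le> R" using stay[OF \<phi>(3), of \<tau>] \<phi>(1) by auto
      then show False using y(2) \<phi>(4) by simp
    qed
    then show ?thesis using \<phi> y by (intro exI[of _ \<phi>] exI[of _ \<tau>]) auto
  qed
  then have "\<forall>n. \<exists>p. \<delta> < snd p \<and> snd p \<le> T \<and> is_solution G x {0..snd p} (fst p) \<and> R + real n < norm (fst p (snd p))"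
    by (metis fst_conv snd_conv)
  from choice[OF this] obtain p where p: "\<And>n. \<delta> < snd (p n) \<and> snd (p n) \<le> T \<and>
      is_solution G x {0..snd (p n)} (fst (p n)) \<and> R + real n < norm (fst (p n) (snd (p n)))" by blast
  define \<Phi> where "\<Phi> n = fst (p n)" for n
  define \<tau> where "\<tau> n = snd (p n)" for n
  have \<tau>: "\<delta> < \<tau> n" "\<tau> n \<le> T" and sol: "is_solution G x {0..\<tau> n} (\<Phi> n)" and big: "R + real n < norm (\<Phi> n (\<tau> n))" for n
    using p[of n] by (auto simp: \<Phi>_def \<tau>_def)
  have sol\<delta>: "is_solution G x {0..\<delta>} (\<Phi> n)" for n
    using is_solution_restrict[OF sol, of \<delta> n] \<tau>[of n] \<delta> by auto
  have \<Phi>R: "norm (\<Phi> n t) \<le> R" if "t \<in> {0..\<delta>}" for n t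
    using stay[OF sol\<delta>[of n] that] that by auto
  have \<Phi>M: "norm (\<Phi> n t - \<Phi> n s) \<le> M * \<bar>t - s\<bar>" if "s \<in> {0..\<delta>}" "t \<in> {0..\<delta>}" for n s t
    by (rule solution_lipschitz[OF sol\<delta> \<Phi>R kMR that])
  have \<Phi>q: "quotient_bound (k * M) \<delta> (\<Phi> n)" for n
    by (rule solution_quotient_bound[OF sol\<delta> \<Phi>R kMR])
  obtain g r where r: "strict_mono (r :: nat \<Rightarrow> nat)" and g: "\<And>t. t \<in> {0..\<delta>} \<Longrightarrow> (\<lambda>n. \<Phi> (r n) t) \<longlonglongrightarrow> g t"
  proof (rule lipschitz_sequence_convergent_subsequence[of \<delta> \<Phi> R M])
    fix g r
    assume "strict_mono (r :: nat \<Rightarrow> nat)" "\<And>t. t \<in> {0..\<delta>} \<Longrightarrow> (\<lambda>n. \<Phi> (r n) t) \<longlonglongrightarrow> g t"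
    then show thesis by (rule that)
  qed (use \<Phi>R \<Phi>M in simp_all)
  have "quotient_bound (k * M) \<delta> g"
    unfolding quotient_bound_def
  proof (intro allI impI)
    fix s t assume st: "0 \<le> s" "s < t" "t \<le> \<delta>"
    show "infdist ((g t - g s) /\<^sub>R (t - s)) (G (g s)) \<le> k * M * (t - s)"
    proof (rule quotient_bound_limit[OF kMR, where \<Phi> = "\<lambda>n. \<Phi> (r n)" and g = g and \<epsilon> = "\<lambda>_. 0"])
      show "norm (\<Phi> (r n) s) \<le> R" for n using \<Phi>R st by simp
      show "(\<lambda>n. \<Phi> (r n) s) \<longlonglongrightarrow> g s" "(\<lambda>n. \<Phi> (r n) t) \<longlonglongrightarrow> g t" using g st by auto
      show "\<forall>\<^sub>F n in sequentially. infdist ((\<Phi> (r n) t - \<Phi> (r n) s) /\<^sub>R (t - s)) (G (\<Phi> (r n) s))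
          \<le> k * M * (t - s) + 0"
        using \<Phi>q st unfolding quotient_bound_def by (intro always_eventually allI) simp
    qed simp
  qed
  then have "is_solution G (g 0) {0..\<delta>} g" using \<delta> by (intro quotient_bound_imp_solution) auto
  moreover have "g 0 = x"
  proof -
    have "\<Phi> n 0 = x" for n using sol\<delta>[of n] by (simp add: is_solution_def)
    then show ?thesis using g[of 0] \<delta> by (simp add: LIMSEQ_const_iff)
  qed
  moreover have "\<not> bounded (reach (T - \<delta>) (g \<delta>))"
  proof
    assume "bounded (reach (T - \<delta>) (g \<delta>))"
    then obtain \<rho> where \<rho>: "reach (T - \<delta>) (g \<delta>) \<subseteq> cball 0 \<rho>" by (auto simp: bounded_iff subset_iff)
    have T\<delta>: "0 \<le> T - \<delta>" using \<tau>[of 0] by simp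
    obtain \<eta> where \<eta>: "\<eta> > 0" "\<And>y. norm (y - g \<delta>) < \<eta> \<Longrightarrow> reach (T - \<delta>) y \<subseteq> cball 0 (\<rho> + 1)"
      using reach_bounded_nearby[OF \<rho> T\<delta>] by blast
    have "(\<lambda>n. \<Phi> (r n) \<delta>) \<longlonglongrightarrow> g \<delta>" using g \<delta> by simp
    then obtain n0 where n0: "\<And>n. n \<ge> n0 \<Longrightarrow> norm (\<Phi> (r n) \<delta> - g \<delta>) < \<eta>"
      using \<eta>(1) unfolding LIMSEQ_iff by blast
    \<comment> \<open>Late enough for closeness to \<open>g \<delta>\<close>, and large enough that
      the endpoint, of norm above \<open>R + real (r n)\<close> with \<open>r n\<close> at least
      \<open>n\<close>, exceeds \<open>\<rho> + 1\<close>.\<close>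
    define n where "n = max n0 (nat \<lceil>\<rho> + 1\<rceil>)"
    have "reach (T - \<delta>) (\<Phi> (r n) \<delta>) \<subseteq> cball 0 (\<rho> + 1)" by (intro \<eta>(2) n0) (simp add: n_def)
    moreover have "\<Phi> (r n) (\<delta> + (\<tau> (r n) - \<delta>)) \<in> reach (T - \<delta>) (\<Phi> (r n) \<delta>)"
      by (rule reachI[OF is_solution_shift[OF sol, of \<delta> "r n"]]) (use \<tau>[of "r n"] \<delta> in auto)
    ultimately have "norm (\<Phi> (r n) (\<tau> (r n))) \<le> \<rho> + 1" by auto
    moreover have "R + real (r n) < norm (\<Phi> (r n) (\<tau> (r n)))" by (rule big)
    moreover have "real n \<le> real (r n)" using seq_suble[OF r] by simp
    moreover have "\<rho> + 1 \<le> real n" unfolding n_def by linarith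
    moreover have "R \<ge> 0" by (simp add: R_def)
    ultimately show False by linarith
  qed
  ultimately show ?thesis by blast
qed

text \<open>Maximality of the glued curve: the times \<open>s n\<close> never exceed
  \<open>T\<close>. If the states at these times were bounded, the step lengths, which depend on the
  norm only, would be bounded below and the times would pass \<open>T\<close>. The curve is thus
  unbounded before \<open>S\<close> and has no extension to \<open>S\<close>.\<close>

lemma forward_complete_imp_bounded_reach:
  assumes fc: "forward_complete G"
  shows "bounded (reach T x)"
proof (rule ccontr)
  assume unb: "\<not> bounded (reach T x)"
  \<comment> \<open>Constants are fixed at integer radii and their velocity bounds are summed up in
    \<open>B\<close>, which therefore increases with the radius. Constants chosen separately for
    each state would give no uniform lower bound on the steps.\<close>
  have "\<exists>q. local_consts (real n) (fst q) (snd q)" for n :: nat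
    using local_consts_exist[of "real n"] by auto
  then have "\<exists>q. \<forall>n::nat. local_consts (real n) (fst (q n)) (snd (q n))" by (intro choice allI)
  then obtain q where q: "\<And>n::nat. local_consts (real n) (fst (q n)) (snd (q n))" by blast
  have qpos: "0 \<le> snd (q n)" for n using local_constsD(2)[OF q[of n]] by simp
  define B where "B n = (\<Sum>i\<le>n. snd (q i))" for n
  have Bpos: "0 \<le> B n" for n unfolding B_def by (intro sum_nonneg qpos)
  have Bmono: "B m \<le> B n" if "m \<le> n" for m n
    unfolding B_def using that qpos by (intro sum_mono2) auto
  define idx where "idx y = nat \<lceil>norm (y::'a)\<rceil> + 1" for y
  have idx_consts: "local_consts (norm y + 1) (fst (q (idx y))) (B (idx y))" for y
  proof (rule local_consts_mono[OF q[of "idx y"]])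
    show "norm y + 1 \<le> real (idx y)" unfolding idx_def by linarith
    show "snd (q (idx y)) \<le> B (idx y)" unfolding B_def using qpos by (intro member_le_sum) auto
  qed
  define \<delta> where "\<delta> y = 1 / (1 + B (idx y))" for y
  have \<delta>pos: "0 < \<delta> y" for y using Bpos[of "idx y"] by (simp add: \<delta>_def)
  define P where "P n p \<longleftrightarrow> 0 \<le> fst p \<and> is_solution G x {0..fst p} (snd p) \<and>
      \<not> bounded (reach (T - fst p) (snd p (fst p)))" for n :: nat and p :: "real \<times> (real \<Rightarrow> 'a)"
  define Q where "Q n p p' \<longleftrightarrow> fst p' = fst p + \<delta> (snd p (fst p)) \<and> (\<forall>t\<le>fst p. snd p' t = snd p t)"
    for n :: nat and p p' :: "real \<times> (real \<Rightarrow> 'a)"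
  have "quotient_bound 0 0 (\<lambda>_. x)" by (auto simp: quotient_bound_def)
  then have "is_solution G x {0..0} (\<lambda>_. x)" using quotient_bound_imp_solution[of 0 0 "\<lambda>_. x"] by simp
  then have base: "\<exists>p. P 0 p" using unb by (intro exI[of _ "(0, \<lambda>_. x)"]) (simp add: P_def)
  have step: "\<exists>p'. P (Suc n) p' \<and> Q n p p'" if "P n p" for n p
  proof -
    obtain s \<Psi> where p: "p = (s, \<Psi>)" by (cases p)
    have s: "0 \<le> s" and \<Psi>: "is_solution G x {0..s} \<Psi>" and u: "\<not> bounded (reach (T - s) (\<Psi> s))"
      using that by (auto simp: P_def p)
    obtain \<phi> where \<phi>: "is_solution G (\<Psi> s) {0..\<delta> (\<Psi> s)} \<phi>"
      "\<not> bounded (reach (T - s - \<delta> (\<Psi> s)) (\<phi> (\<delta> (\<Psi> s))))"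
      using unbounded_reach_step[OF u idx_consts] unfolding \<delta>_def by blast
    define \<Psi>' where "\<Psi>' t = (if t \<le> s then \<Psi> t else \<phi> (t - s))" for t
    have "is_solution G x {0..s + \<delta> (\<Psi> s)} \<Psi>'"
      unfolding \<Psi>'_def using solution_concat[OF \<Psi> \<phi>(1) s] \<delta>pos[of "\<Psi> s"] by simp
    moreover have "\<Psi>' (s + \<delta> (\<Psi> s)) = \<phi> (\<delta> (\<Psi> s))" using \<delta>pos[of "\<Psi> s"] by (simp add: \<Psi>'_def)
    ultimately show ?thesis
      using \<phi>(2) s \<delta>pos[of "\<Psi> s"]
      by (intro exI[of _ "(s + \<delta> (\<Psi> s), \<Psi>')"]) (simp add: P_def Q_def p \<Psi>'_def diff_diff_eq)
  qed
  obtain p where p: "\<And>n. P n (p n)" "\<And>n. Q n (p n) (p (Suc n))"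
    using dependent_nat_choice[of P Q, OF base step] by blast
  define s where "s n = fst (p n)" for n
  define \<Psi> where "\<Psi> n = snd (p n)" for n
  have s0: "0 \<le> s n" and sol: "is_solution G x {0..s n} (\<Psi> n)" and u: "\<not> bounded (reach (T - s n) (\<Psi> n (s n)))" for n
    using p(1)[of n] by (auto simp: P_def s_def \<Psi>_def)
  have sS: "s (Suc n) = s n + \<delta> (\<Psi> n (s n))" and agree1: "\<And>t. t \<le> s n \<Longrightarrow> \<Psi> (Suc n) t = \<Psi> n t" for n
    using p(2)[of n] by (auto simp: Q_def s_def \<Psi>_def)
  have sT: "s n \<le> T" for n
  proof (rule ccontr)
    assume "\<not> s n \<le> T"
    \<comment> \<open>With negative remaining time the reachable set is empty, hence bounded, so the
      construction never passes \<open>T\<close>.\<close>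
    then have "reach (T - s n) (\<Psi> n (s n)) = {}" by (auto simp: reach_def)
    then show False using u[of n] by simp
  qed
  have sless: "s n < s (Suc n)" for n using sS[of n] \<delta>pos by simp
  then have smono: "s m \<le> s n" if "m \<le> n" for m n using that lift_Suc_mono_le[of s] less_imp_le by blast
  have agree: "\<Psi> n t = \<Psi> m t" if "m \<le> n" "t \<le> s m" for m n t
    using that
  proof (induction n rule: dec_induct)
    case (step n)
    then show ?case using agree1[of t n] smono[of m n] by simp
  qed simp
  \<comment> \<open>All \<open>\<Psi> n\<close> with \<open>t \<le> s n\<close> agree at
    \<open>t\<close>; \<open>LEAST\<close> merely selects one of them. Values from \<open>S\<close>
    on are arbitrary.\<close>
  define \<Phi> where "\<Phi> t = \<Psi> (LEAST n. t \<le> s n) t" for t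
  have \<Phi>: "\<Phi> t = \<Psi> n t" if "t \<le> s n" for n t
  proof -
    have "t \<le> s (LEAST n. t \<le> s n)" "(LEAST n. t \<le> s n) \<le> n" using that by (auto intro: LeastI Least_le)
    then show ?thesis unfolding \<Phi>_def using agree by simp
  qed
  have sol\<Phi>: "is_solution G x {0..s n} \<Phi>" for n
    by (rule is_solution_cong[OF sol s0]) (simp add: \<Phi>)
  define S where "S = Sup (range s)"
  have bdd: "bdd_above (range s)" by (rule bdd_aboveI[of _ T]) (use sT in auto)
  have lessS: "s n < S" for n
    using sless[of n] cSup_upper[OF rangeI[of s "Suc n"] bdd] unfolding S_def by linarith
  have supS: "\<exists>n. b < s n" if "b < S" for b
    using that less_cSup_iff[OF _ bdd, of b] unfolding S_def by auto
  have solS: "is_solution G x {0..<S} \<Phi>"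
    by (rule is_solution_increasing_union[OF sol\<Phi> s0 lessS supS])
  have unbd: "\<exists>n. R < norm (\<Phi> (s n))" for R
  proof (rule ccontr)
    assume "\<not> ?thesis"
    then have le: "norm (\<Psi> n (s n)) \<le> R" for n using \<Phi>[of "s n" n] by (metis not_less order_refl)
    define d where "d = 1 / (1 + B (nat \<lceil>R\<rceil> + 1))"
    have d: "0 < d" using Bpos[of "nat \<lceil>R\<rceil> + 1"] by (simp add: d_def)
    have dle: "d \<le> \<delta> (\<Psi> n (s n))" for n
    proof -
      have "idx (\<Psi> n (s n)) \<le> nat \<lceil>R\<rceil> + 1" 
        unfolding idx_def using nat_mono[OF ceiling_mono[OF le[of n]]] by simp
      then have "B (idx (\<Psi> n (s n))) \<le> B (nat \<lceil>R\<rceil> + 1)" by (rule Bmono)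
      then show ?thesis unfolding d_def \<delta>_def using Bpos[of "idx (\<Psi> n (s n))"] by (intro divide_left_mono) auto
    qed
    have "real n * d \<le> s n" for n
    proof (induction n)
      case (Suc n)
      then show ?case using sS[of n] dle[of n] by (simp add: distrib_right)
    qed (use s0 in simp)
    moreover obtain n where "T / d < real n" using reals_Archimedean2 by blast
    ultimately have "T < s n" using d by (metis less_le_trans pos_divide_less_eq)
    then show False using sT[of n] by simp
  qed
  have "is_maximal_solution G x {0..<S} \<Phi>"
    unfolding is_maximal_solution_def
  proof (intro conjI notI solS)
    assume "\<exists>D' \<psi>. is_solution G x D' \<psi> \<and> {0..<S} \<subset> D' \<and> (\<forall>t\<in>{0..<S}. \<psi> t = \<Phi> t)"
    then obtain D' \<psi> where D': "is_solution G x D' \<psi>" "{0..<S} \<subset> D'" "\<forall>t\<in>{0..<S}. \<psi> t = \<Phi> t" by blast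
    then obtain b where b: "b \<in> D'" "b \<notin> {0..<S}" by blast
    have seg: "0 \<le> b" "{0..b} \<subseteq> D'"
      using sol_domain_initial_segment[of D' b] D'(1) b(1) by (auto simp: is_solution_def)
    have S0: "0 \<le> S" using s0[of 0] lessS[of 0] by linarith
    \<comment> \<open>Any strictly larger domain contains \<open>S\<close>, and a solution on the
      compact segment \<open>{0..S}\<close> is bounded.\<close>
    have "S \<in> D'" using seg b S0 by auto
    then have "is_solution G x {0..S} \<psi>" using is_solution_restrict[OF D'(1)] by blast
    then obtain R where R: "\<And>t. t \<in> {0..S} \<Longrightarrow> norm (\<psi> t) \<le> R" using solution_bounded S0 by blast
    obtain n where n: "R < norm (\<Phi> (s n))" using unbd by blast
    have "s n \<in> {0..<S}" using s0[of n] lessS[of n] by simp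
    then show False using R[of "s n"] D'(3) n by fastforce
  qed
  then have "\<not> bounded {0..<S}" using fc unfolding forward_complete_def by blast
  then show False by simp
qed

lemma bounded_reach_compact:
  assumes bd: "\<And>x. bounded (reach T x)" and T: "0 \<le> T" and C: "compact C"
  obtains \<rho> where "\<And>x. x \<in> C \<Longrightarrow> reach T x \<subseteq> cball 0 \<rho>"
proof -
  have "\<exists>q. 0 < fst q \<and> (\<forall>y. norm (y - x) < fst q \<longrightarrow> reach T y \<subseteq> cball 0 (snd q))" for x
  proof -
    obtain \<rho> where "reach T x \<subseteq> cball 0 \<rho>" using bd[of x] by (auto simp: bounded_iff subset_iff)
    then obtain \<eta> where "\<eta> > 0" "\<forall>y. norm (y - x) < \<eta> \<longrightarrow> reach T y \<subseteq> cball 0 (\<rho> + 1)"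
      using reach_bounded_nearby[OF _ T] by blast
    then show ?thesis by (intro exI[of _ "(\<eta>, \<rho> + 1)"]) simp
  qed
  then have "\<exists>q. \<forall>x. 0 < fst (q x) \<and> (\<forall>y. norm (y - x) < fst (q x) \<longrightarrow> reach T y \<subseteq> cball 0 (snd (q x)))"
    by (intro choice allI)
  then obtain q where q: "\<And>x. 0 < fst (q x)"
    "\<And>x y. norm (y - x) < fst (q x) \<Longrightarrow> reach T y \<subseteq> cball 0 (snd (q x))" by blast
  obtain D where D: "D \<subseteq> C" "finite D" "C \<subseteq> (\<Union>x\<in>D. ball x (fst (q x)))"
  proof (rule compactE_image[OF C, of C "\<lambda>x. ball x (fst (q x))"])
    show "C \<subseteq> (\<Union>x\<in>C. ball x (fst (q x)))" using q(1) by force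
  qed (auto intro: that)
  define \<rho> where "\<rho> = (\<Sum>x\<in>D. \<bar>snd (q x)\<bar>)"
  show thesis
  proof (rule that[of \<rho>])
    fix y assume "y \<in> C"
    then obtain x where x: "x \<in> D" "norm (y - x) < fst (q x)" using D(3) by (auto simp: dist_norm norm_minus_commute)
    have "snd (q x) \<le> \<rho>"
      unfolding \<rho>_def using member_le_sum[of x D "\<lambda>x. \<bar>snd (q x)\<bar>"] x(1) D(2) by auto
    then show "reach T y \<subseteq> cball 0 \<rho>" using q(2)[OF x(2)] by fastforce
  qed
qed

text \<open>Not only the curves but also their durations vary along the sequence. Freezing each
  curve at its endpoint gives a common domain for the compactness argument; a further subsequence
  makes the durations converge to some \<open>\<sigma>\<close>, and the limit curve is a solution up
  to \<open>\<sigma>\<close>.\<close>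

lemma closed_reach:
  assumes bd: "bounded (reach T x)"
  shows "closed (reach T x)"
  unfolding closed_sequential_limits
proof (intro allI impI)
  fix y l assume y: "(\<forall>n. y n \<in> reach T x) \<and> y \<longlonglongrightarrow> l"
  obtain \<rho> where \<rho>: "\<And>z. z \<in> reach T x \<Longrightarrow> norm z \<le> \<rho>" using bd by (auto simp: bounded_iff)
  obtain k M where kM: "local_consts \<rho> k M" using local_consts_exist by blast
  have M: "M > 0" using local_constsD(2)[OF kM] .
  have "\<forall>n. \<exists>p. 0 \<le> snd p \<and> snd p \<le> T \<and> is_solution G x {0..snd p} (fst p) \<and> y n = fst p (snd p)"
  proof
    fix n
    have "y n \<in> reach T x" using y by blast
    then obtain \<phi> \<tau> where "0 \<le> \<tau>" "\<tau> \<le> T" "is_solution G x {0..\<tau>} \<phi>" "y n = \<phi> \<tau>" by (auto simp: reach_def)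
    then show "\<exists>p. 0 \<le> snd p \<and> snd p \<le> T \<and> is_solution G x {0..snd p} (fst p) \<and> y n = fst p (snd p)"
      by (intro exI[of _ "(\<phi>, \<tau>)"]) simp
  qed
  from choice[OF this] obtain p where p: "\<And>n. 0 \<le> snd (p n) \<and> snd (p n) \<le> T \<and>
      is_solution G x {0..snd (p n)} (fst (p n)) \<and> y n = fst (p n) (snd (p n))" by blast
  define \<phi> where "\<phi> n = fst (p n)" for n
  define \<tau> where "\<tau> n = snd (p n)" for n
  have \<tau>: "0 \<le> \<tau> n" "\<tau> n \<le> T" and sol: "is_solution G x {0..\<tau> n} (\<phi> n)" and yn: "y n = \<phi> n (\<tau> n)" for n
    using p[of n] by (auto simp: \<phi>_def \<tau>_def)
  have \<phi>R: "norm (\<phi> n t) \<le> \<rho>" if "t \<in> {0..\<tau> n}" for n t using \<rho> reachI[OF sol \<tau>(2) that] by blast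
  have q: "quotient_bound (k * M) (\<tau> n) (\<phi> n)" for n by (rule solution_quotient_bound[OF sol \<phi>R kM])
  define f where "f n t = \<phi> n (min t (\<tau> n))" for n t
  have fR: "norm (f n t) \<le> \<rho>" if "t \<in> {0..T}" for n t
    unfolding f_def using \<phi>R that \<tau>(1) by simp
  have fM: "norm (f n t - f n s) \<le> M * \<bar>t - s\<bar>" if "s \<in> {0..T}" "t \<in> {0..T}" for n s t
  proof -
    have "norm (f n t - f n s) \<le> M * \<bar>min t (\<tau> n) - min s (\<tau> n)\<bar>"
      unfolding f_def by (rule solution_lipschitz[OF sol \<phi>R kM]) (use that \<tau>(1) in auto)
    also have "\<dots> \<le> M * \<bar>t - s\<bar>" using M by (intro mult_left_mono) auto
    finally show ?thesis .
  qed
  obtain g r where r: "strict_mono (r :: nat \<Rightarrow> nat)" and g: "\<And>t. t \<in> {0..T} \<Longrightarrow> (\<lambda>n. f (r n) t) \<longlonglongrightarrow> g t"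
    and gM: "\<And>s t. s \<in> {0..T} \<Longrightarrow> t \<in> {0..T} \<Longrightarrow> norm (g t - g s) \<le> M * \<bar>t - s\<bar>"
  proof (rule lipschitz_sequence_convergent_subsequence[of T f \<rho> M])
    fix g r
    assume "strict_mono (r :: nat \<Rightarrow> nat)" "\<And>t. t \<in> {0..T} \<Longrightarrow> (\<lambda>n. f (r n) t) \<longlonglongrightarrow> g t"
      "\<And>s t. s \<in> {0..T} \<Longrightarrow> t \<in> {0..T} \<Longrightarrow> norm (g t - g s) \<le> M * \<bar>t - s\<bar>"
    then show thesis by (rule that)
  qed (use fR fM in simp_all)
  have "\<forall>n. \<tau> (r n) \<in> {0..T}" using \<tau> by simp
  then obtain \<sigma> r' where \<sigma>: "\<sigma> \<in> {0..T}" and r': "strict_mono (r' :: nat \<Rightarrow> nat)"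
    and \<sigma>lim: "((\<lambda>n. \<tau> (r n)) \<circ> r') \<longlonglongrightarrow> \<sigma>"
    using compact_Icc[of 0 T, unfolded compact_def, rule_format, of "\<lambda>n. \<tau> (r n)"] by blast
  define R where "R n = r (r' n)" for n
  have R: "strict_mono R" using strict_mono_o[OF r r'] by (simp add: R_def[abs_def] o_def)
  have \<tau>lim: "(\<lambda>n. \<tau> (R n)) \<longlonglongrightarrow> \<sigma>" using \<sigma>lim by (simp add: R_def o_def)
  have glim: "(\<lambda>n. f (R n) t) \<longlonglongrightarrow> g t" if "t \<in> {0..T}" for t
    using LIMSEQ_subseq_LIMSEQ[OF g[OF that] r'] by (simp add: R_def o_def)
  have T: "0 \<le> T" using \<sigma> by simp
  \<comment> \<open>For \<open>t < \<sigma>\<close> all but finitely many curves are still running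
    at \<open>t\<close>, so freezing does not interfere. The endpoint \<open>\<sigma>\<close> is
    recovered by continuity below.\<close>
  have q1: "infdist ((g t - g s) /\<^sub>R (t - s)) (G (g s)) \<le> k * M * (t - s)" if st: "0 \<le> s" "s < t" "t < \<sigma>" for s t
  proof (rule quotient_bound_limit[OF kM, where \<Phi> = "\<lambda>n. f (R n)" and g = g and \<epsilon> = "\<lambda>_. 0"])
    have stT: "s \<in> {0..T}" "t \<in> {0..T}" using st \<sigma> by auto
    show "norm (f (R n) s) \<le> \<rho>" for n using fR stT by blast
    show "(\<lambda>n. f (R n) s) \<longlonglongrightarrow> g s" "(\<lambda>n. f (R n) t) \<longlonglongrightarrow> g t" using glim stT by auto
    have "eventually (\<lambda>n. t < \<tau> (R n)) sequentially" using order_tendstoD(1)[OF \<tau>lim st(3)] .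
    then show "\<forall>\<^sub>F n in sequentially. infdist ((f (R n) t - f (R n) s) /\<^sub>R (t - s)) (G (f (R n) s)) \<le> k * M * (t - s) + 0"
    proof (rule eventually_mono)
      fix n assume n: "t < \<tau> (R n)"
      then have "f (R n) t = \<phi> (R n) t" "f (R n) s = \<phi> (R n) s" using st by (auto simp: f_def)
      then show "infdist ((f (R n) t - f (R n) s) /\<^sub>R (t - s)) (G (f (R n) s)) \<le> k * M * (t - s) + 0"
        using q[of "R n"] st n unfolding quotient_bound_def by simp
    qed
  qed simp
  have gcont: "continuous_on {0..T} g"
    by (rule lipschitz_on_continuous_on[of M], rule lipschitz_onI)
       (use gM M in \<open>auto simp: dist_norm norm_minus_commute abs_minus_commute\<close>)
  have "quotient_bound (k * M) \<sigma> g"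
    unfolding quotient_bound_def
  proof (intro allI impI)
    fix s t assume st: "0 \<le> s" "s < t" "t \<le> \<sigma>"
    show "infdist ((g t - g s) /\<^sub>R (t - s)) (G (g s)) \<le> k * M * (t - s)"
    proof (cases "t < \<sigma>")
      case True
      then show ?thesis using q1 st by blast
    next
      case False
      then have t: "t = \<sigma>" using st by simp
      \<comment> \<open>The midpoint keeps the interval of approach away from \<open>s\<close>,
        where the quotient is singular.\<close>
      define m where "m = (s + t) / 2"
      have m: "s < m" "m < t" using st by (auto simp: m_def)
      have cl: "closure {m<..<t} = {m..t}" using m by simp
      have "infdist ((g t - g s) /\<^sub>R (t - s)) (G (g s)) - k * M * (t - s) \<le> 0"
      proof (rule continuous_le_on_closure[of "{m<..<t}" "\<lambda>t. infdist ((g t - g s) /\<^sub>R (t - s)) (G (g s)) - k * M * (t - s)"])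
        have "continuous_on {m..t} g" by (rule continuous_on_subset[OF gcont]) (use m st \<sigma> t in auto)
        then show "continuous_on (closure {m<..<t}) (\<lambda>t. infdist ((g t - g s) /\<^sub>R (t - s)) (G (g s)) - k * M * (t - s))"
          unfolding cl using m by (intro continuous_intros) auto
        show "t \<in> closure {m<..<t}" unfolding cl using m by simp
        fix u assume "u \<in> {m<..<t}"
        then have "infdist ((g u - g s) /\<^sub>R (u - s)) (G (g s)) \<le> k * M * (u - s)" using q1[of s u] st m t by auto
        then show "infdist ((g u - g s) /\<^sub>R (u - s)) (G (g s)) - k * M * (u - s) \<le> 0" by simp
      qed
      then show ?thesis by simp
    qed
  qed
  then have solg: "is_solution G (g 0) {0..\<sigma>} g" using \<sigma> by (intro quotient_bound_imp_solution) auto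
  have "f n 0 = x" for n using sol[of n] \<tau>(1)[of n] by (simp add: f_def is_solution_def)
  then have "g 0 = x" using glim[of 0] T by (simp add: LIMSEQ_const_iff)
  then have "g \<sigma> \<in> reach T x" using reachI[of x \<sigma> g T \<sigma>] solg \<sigma> by simp
  moreover have "l = g \<sigma>"
  proof (rule LIMSEQ_unique)
    show "(\<lambda>n. y (R n)) \<longlonglongrightarrow> l" using LIMSEQ_subseq_LIMSEQ[OF _ R, of y l] y by (simp add: o_def)
    have "(\<lambda>n. f (R n) (\<tau> (R n)) - f (R n) \<sigma>) \<longlonglongrightarrow> 0"
    proof (rule Lim_null_comparison)
      show "\<forall>\<^sub>F n in sequentially. norm (f (R n) (\<tau> (R n)) - f (R n) \<sigma>) \<le> M * \<bar>\<tau> (R n) - \<sigma>\<bar>"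
        using fM \<sigma> \<tau> by (intro always_eventually allI) simp
      have "(\<lambda>n. M * \<bar>\<tau> (R n) - \<sigma>\<bar>) \<longlonglongrightarrow> M * \<bar>\<sigma> - \<sigma>\<bar>" by (intro tendsto_intros \<tau>lim)
      then show "(\<lambda>n. M * \<bar>\<tau> (R n) - \<sigma>\<bar>) \<longlonglongrightarrow> 0" by simp
    qed
    then have "(\<lambda>n. (f (R n) (\<tau> (R n)) - f (R n) \<sigma>) + f (R n) \<sigma>) \<longlonglongrightarrow> 0 + g \<sigma>"
      by (intro tendsto_add glim \<sigma>)
    then show "(\<lambda>n. y (R n)) \<longlonglongrightarrow> g \<sigma>" by (simp add: yn f_def)
  qed
  ultimately show "l \<in> reach T x" by simp
qed

section \<open>The distance from a set to the reachable sets, and its regularity\<close>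

definition reach_dist :: "'a set \<Rightarrow> real \<Rightarrow> 'a \<Rightarrow> real" where
  "reach_dist X t x = Inf ((\<lambda>y. infdist y X) ` reach t x)"

lemma reach_dist_le: "y \<in> reach t x \<Longrightarrow> reach_dist X t x \<le> infdist y X"
  unfolding reach_dist_def by (rule cInf_lower) (auto intro!: bdd_belowI[of _ 0] infdist_nonneg)

lemma le_reach_dist:
  assumes "0 \<le> t" "\<And>y. y \<in> reach t x \<Longrightarrow> c \<le> infdist y X"
  shows "c \<le> reach_dist X t x"
  unfolding reach_dist_def using reach_self[OF assms(1), of x] assms(2) by (intro cInf_greatest) auto

text \<open>Whatever is reachable from \<open>\<phi> s\<close> within \<open>t\<close> is reachable
  from \<open>x\<close> within \<open>s + t\<close>, so the left infimum runs over a larger set. For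
  \<open>G = -F\<close> and a reversed solution of \<open>F\<close> this is the monotonicity of the
  barrier.\<close>

lemma reach_dist_backward:
  assumes "is_solution G x {0..s} \<phi>" "0 \<le> s" "0 \<le> t"
  shows "reach_dist X (s + t) x \<le> reach_dist X t (\<phi> s)"
  using assms reach_dist_le reach_concat by (intro le_reach_dist) blast+

text \<open>Compactness of the reachable set turns an infimum 0 into a point at distance 0, and
  closedness of \<open>X\<close> puts that point in \<open>X\<close>.\<close>

lemma reach_dist_zero_attained:
  assumes bd: "bounded (reach t x)" and t: "0 \<le> t" and X: "closed X" "X \<noteq> {}" and z: "reach_dist X t x = 0"
  shows "\<exists>y\<in>X. y \<in> reach t x"
proof -
  have "compact (reach t x)" using closed_reach[OF bd] bd by (simp add: compact_eq_bounded_closed)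
  moreover have "reach t x \<noteq> {}" using reach_self[OF t] by blast
  moreover have "continuous_on (reach t x) (\<lambda>y. infdist y X)" by (intro continuous_intros)
  ultimately obtain y where y: "y \<in> reach t x" "\<And>w. w \<in> reach t x \<Longrightarrow> infdist y X \<le> infdist w X"
    using continuous_attains_inf by metis
  then have "infdist y X \<le> reach_dist X t x" using t by (intro le_reach_dist) auto
  then have "infdist y X = 0" using z infdist_nonneg[of y X] by simp
  then show ?thesis using y(1) in_closed_iff_infdist_zero[OF X] by blast
qed

lemma reach_mono: "s \<le> t \<Longrightarrow> reach s x \<subseteq> reach t x"
  unfolding reach_def by fastforce

text \<open>Cutting a solution at time \<open>s\<close> moves its endpoint by at most
  \<open>M * (t - s)\<close>; in the other direction the reachable sets only grow.\<close>

lemma reach_dist_lipschitz_time: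
  assumes st: "0 \<le> s" "s \<le> t" and \<rho>: "reach t x \<subseteq> cball 0 \<rho>" and kM: "local_consts \<rho> k M"
  shows "\<bar>reach_dist X t x - reach_dist X s x\<bar> \<le> M * (t - s)"
proof -
  have M: "M > 0" using local_constsD(2)[OF kM] .
  have "reach_dist X t x \<le> reach_dist X s x"
    using st reach_mono[OF st(2), of x] by (intro le_reach_dist reach_dist_le) auto
  moreover have "reach_dist X s x - M * (t - s) \<le> reach_dist X t x"
  proof (rule le_reach_dist)
    fix y assume "y \<in> reach t x"
    then obtain \<phi> \<tau> where \<phi>: "0 \<le> \<tau>" "\<tau> \<le> t" "is_solution G x {0..\<tau>} \<phi>" "y = \<phi> \<tau>" by (auto simp: reach_def)
    have R: "norm (\<phi> u) \<le> \<rho>" if "u \<in> {0..\<tau>}" for u using reachI[OF \<phi>(3,2) that] \<rho> by auto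
    define \<sigma> where "\<sigma> = min s \<tau>"
    have \<sigma>: "\<sigma> \<in> {0..\<tau>}" "\<sigma> \<le> s" using st \<phi> by (auto simp: \<sigma>_def)
    have "\<phi> \<sigma> \<in> reach s x" using reachI[OF is_solution_restrict[OF \<phi>(3) \<sigma>(1)] \<sigma>(2), of \<sigma>] \<sigma>(1) by simp
    then have "reach_dist X s x \<le> infdist (\<phi> \<sigma>) X" by (rule reach_dist_le)
    also have "\<dots> \<le> infdist (\<phi> \<tau>) X + dist (\<phi> \<sigma>) (\<phi> \<tau>)" by (rule infdist_triangle)
    finally have "reach_dist X s x \<le> infdist (\<phi> \<tau>) X + dist (\<phi> \<sigma>) (\<phi> \<tau>)" .
    moreover have "dist (\<phi> \<sigma>) (\<phi> \<tau>) \<le> M * \<bar>\<sigma> - \<tau>\<bar>"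
      unfolding dist_norm by (rule solution_lipschitz[OF \<phi>(3) R kM]) (use \<sigma> \<phi> in auto)
    moreover have "M * \<bar>\<sigma> - \<tau>\<bar> \<le> M * (t - s)"
      using M \<phi> st by (intro mult_left_mono) (auto simp: \<sigma>_def)
    ultimately show "reach_dist X s x - M * (t - s) \<le> infdist y X" using \<phi>(4) by simp
  qed (use st in simp)
  ultimately show ?thesis using M st by simp
qed

text \<open>Each solution from \<open>y\<close> is tracked from \<open>x\<close>, and
  \<open>infdist\<close> is 1-Lipschitz in its point. A bound is required for the solutions from
  \<open>y\<close> only, those being the tracked ones.\<close>

lemma reach_dist_lipschitz_space:
  assumes t: "0 \<le> t" and \<rho>: "reach t y \<subseteq> cball 0 \<rho>" and kM: "local_consts (\<rho> + 1) k M"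
    and xy: "norm (x - y) * exp (k * t) < 1"
  shows "reach_dist X t x \<le> reach_dist X t y + norm (x - y) * exp (k * t)"
proof -
  have k: "k > 0" using local_constsD(1)[OF kM] .
  have "reach_dist X t x - norm (x - y) * exp (k * t) \<le> reach_dist X t y"
  proof (rule le_reach_dist[OF t])
    fix z assume "z \<in> reach t y"
    then obtain \<phi> \<tau> where \<phi>: "0 \<le> \<tau>" "\<tau> \<le> t" "is_solution G y {0..\<tau>} \<phi>" "z = \<phi> \<tau>" by (auto simp: reach_def)
    have \<phi>0: "\<phi> 0 = y" using \<phi>(3) by (simp add: is_solution_def)
    have R: "norm (\<phi> u) \<le> \<rho>" if "u \<in> {0..\<tau>}" for u using reachI[OF \<phi>(3,2) that] \<rho> by auto
    have mono: "norm (x - y) * exp (k * \<tau>) \<le> norm (x - y) * exp (k * t)"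
      using k \<phi>(2) by (intro mult_left_mono) auto
    then have "norm (x - \<phi> 0) * exp (k * \<tau>) < 1" using xy \<phi>0 by simp
    then obtain \<psi> where \<psi>: "is_solution G x {0..\<tau>} \<psi>"
      "\<forall>u\<in>{0..\<tau>}. norm (\<psi> u - \<phi> u) \<le> norm (x - \<phi> 0) * exp (k * u)"
      using solution_tracking[OF \<phi>(3,1) R kM] by blast
    have "reach_dist X t x \<le> infdist (\<psi> \<tau>) X"
      by (rule reach_dist_le[OF reachI[OF \<psi>(1) \<phi>(2)]]) (use \<phi>(1) in simp)
    also have "\<dots> \<le> infdist (\<phi> \<tau>) X + dist (\<psi> \<tau>) (\<phi> \<tau>)" by (rule infdist_triangle)
    also have "dist (\<psi> \<tau>) (\<phi> \<tau>) \<le> norm (x - y) * exp (k * \<tau>)" using \<psi>(2) \<phi>(1) \<phi>0 by (simp add: dist_norm)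
    finally show "reach_dist X t x - norm (x - y) * exp (k * t) \<le> infdist z X" using mono \<phi>(4) by simp
  qed
  then show ?thesis by simp
qed

lemma loc_lipschitz_reach_dist:
  assumes bd: "\<And>T x. bounded (reach T x)" and X: "X \<noteq> {}"
  shows "loc_lipschitz_tv (reach_dist X)"
  unfolding loc_lipschitz_tv_def
proof (intro allI impI)
  fix C :: "(real \<times> 'a) set" assume C: "compact C \<and> C \<subseteq> {0..} \<times> UNIV"
  have "bounded (fst ` C)" "compact (snd ` C)"
    using C by (auto intro!: compact_imp_bounded compact_continuous_image continuous_intros)
  then obtain T0 where T0: "\<forall>t\<in>fst ` C. norm t \<le> T0" unfolding bounded_iff by blast
  define T where "T = max 0 T0"
  have T: "0 \<le> T" "\<And>t x. (t, x) \<in> C \<Longrightarrow> 0 \<le> t \<and> t \<le> T"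
    using T0 C by (force simp: T_def)+
  obtain \<rho> where \<rho>: "\<And>x. x \<in> snd ` C \<Longrightarrow> reach T x \<subseteq> cball 0 \<rho>"
    using bounded_reach_compact[OF bd T(1) \<open>compact (snd ` C)\<close>] by blast
  have \<rho>t: "reach t x \<subseteq> cball 0 \<rho>" if "x \<in> snd ` C" "t \<le> T" for t x
    using \<rho>[OF that(1)] reach_mono[OF that(2), of x] by blast
  obtain k M where kM: "local_consts (\<rho> + 1) k M" using local_consts_exist by blast
  have kM': "local_consts \<rho> k M" by (rule local_consts_mono[OF kM]) auto
  have k: "k > 0" and M: "M > 0" using local_constsD[OF kM] by auto
  obtain a where a: "a \<in> X" using X by blast
  define A where "A = exp (k * T)"
  have A: "A \<ge> 1" using k T by (simp add: A_def)
  define b where "b = \<bar>\<rho>\<bar> + norm a"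
  have b: "b \<ge> 0" by (simp add: b_def)
  have B: "0 \<le> reach_dist X t x" "reach_dist X t x \<le> b" if "x \<in> snd ` C" "0 \<le> t" "t \<le> T" for t x
  proof -
    show "0 \<le> reach_dist X t x" using that by (intro le_reach_dist infdist_nonneg)
    have x: "x \<in> reach t x" using that by (intro reach_self)
    then have "norm x \<le> \<rho>" using \<rho>t[OF that(1,3)] by auto
    have "reach_dist X t x \<le> infdist x X" by (rule reach_dist_le[OF x])
    also have "\<dots> \<le> dist x a" by (rule infdist_le[OF a])
    also have "\<dots> \<le> norm x + norm a" unfolding dist_norm by (rule norm_triangle_ineq4)
    finally show "reach_dist X t x \<le> b" using \<open>norm x \<le> \<rho>\<close> by (simp add: b_def)
  qed
  \<comment> \<open>Tracking covers close points only. Otherwise \<open>norm (x - y)\<close> is at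
    least \<open>1 / A\<close>, and since all values lie between 0 and \<open>b\<close>, the slope
    \<open>b * A\<close> suffices.\<close>
  have space: "reach_dist X t x \<le> reach_dist X t y + (A + b * A) * norm (x - y)"
    if "x \<in> snd ` C" "y \<in> snd ` C" "0 \<le> t" "t \<le> T" for t x y
  proof (cases "norm (x - y) * exp (k * t) < 1")
    case True
    have "reach_dist X t x \<le> reach_dist X t y + norm (x - y) * exp (k * t)"
      by (rule reach_dist_lipschitz_space[OF that(3) \<rho>t[OF that(2,4)] kM True])
    also have "norm (x - y) * exp (k * t) \<le> norm (x - y) * (A + b * A)"
    proof (rule mult_left_mono)
      have "exp (k * t) \<le> A" using that k by (simp add: A_def)
      moreover have "0 \<le> b * A" using b A by simp
      ultimately show "exp (k * t) \<le> A + b * A" by linarith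
    qed simp
    finally show ?thesis by (simp add: mult.commute)
  next
    case False
    then have "1 \<le> norm (x - y) * exp (k * t)" by simp
    also have "\<dots> \<le> norm (x - y) * A" using that k by (intro mult_left_mono) (auto simp: A_def)
    finally have "b * 1 \<le> b * (norm (x - y) * A)" using b by (intro mult_left_mono)
    moreover have "0 \<le> A * norm (x - y)" using A by simp
    ultimately have "b \<le> (A + b * A) * norm (x - y)" by (simp add: algebra_simps)
    then show ?thesis using B[OF that(1,3,4)] B[OF that(2,3,4)] by linarith
  qed
  have "(M + (A + b * A))-lipschitz_on C (\<lambda>(t, x). reach_dist X t x)"
  proof (rule lipschitz_onI)
    show "0 \<le> M + (A + b * A)" using M A b by simp
    fix z w assume zw: "z \<in> C" "w \<in> C"
    obtain t x where z: "z = (t, x)" by (cases z)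
    obtain s y where w: "w = (s, y)" by (cases w)
    have tx: "x \<in> snd ` C" "0 \<le> t" "t \<le> T" and sy: "y \<in> snd ` C" "0 \<le> s" "s \<le> T"
      using zw z w T(2) by (auto simp: image_iff) force+
    \<comment> \<open>The intermediate point \<open>(s, x)\<close> need not lie in \<open>C\<close>;
      for this reason the bounds above were set up for all spatial components of \<open>C\<close>
      combined with all times up to \<open>T\<close>.\<close>
    have "\<bar>reach_dist X t x - reach_dist X s x\<bar> \<le> M * \<bar>t - s\<bar>"
      using reach_dist_lipschitz_time[of s t x \<rho> k M X] reach_dist_lipschitz_time[of t s x \<rho> k M X]
        tx sy \<rho>t[OF tx(1)] kM' by (cases "s \<le> t") (auto simp: abs_minus_commute)
    also have "\<dots> \<le> M * dist z w"
      using M dist_fst_le[of z w] by (intro mult_left_mono) (auto simp: z w dist_real_def)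
    finally have 1: "\<bar>reach_dist X t x - reach_dist X s x\<bar> \<le> M * dist z w" .
    have "\<bar>reach_dist X s x - reach_dist X s y\<bar> \<le> (A + b * A) * norm (x - y)"
      using space[OF tx(1) sy(1,2,3)] space[OF sy(1) tx(1) sy(2,3)] by (auto simp: norm_minus_commute abs_le_iff)
    also have "\<dots> \<le> (A + b * A) * dist z w"
      using A b dist_snd_le[of z w] by (intro mult_left_mono) (auto simp: z w dist_norm)
    finally have 2: "\<bar>reach_dist X s x - reach_dist X s y\<bar> \<le> (A + b * A) * dist z w" .
    show "dist ((\<lambda>(t, x). reach_dist X t x) z) ((\<lambda>(t, x). reach_dist X t x) w) \<le> (M + (A + b * A)) * dist z w"
      using 1 2 by (simp add: z w dist_real_def distrib_right)
  qed
  then show "\<exists>L. L-lipschitz_on C (\<lambda>(t, x). reach_dist X t x)" by blast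
qed

end

section \<open>Barrier functions and safety\<close>

lemma continuous_on_imp_openin_nearby:
  fixes p :: "'a::metric_space \<Rightarrow> 'b::metric_space"
  assumes U: "openin (top_of_set A) U" and p: "continuous_on S p" "p ` S \<subseteq> A" and \<sigma>: "\<sigma> \<in> S" "p \<sigma> \<in> U"
  shows "\<exists>d>0. \<forall>s\<in>S. dist s \<sigma> < d \<longrightarrow> p s \<in> U"
proof -
  obtain V where V: "open V" "U = A \<inter> V" using U by (auto simp: openin_open)
  obtain e where e: "e > 0" "ball (p \<sigma>) e \<subseteq> V" using V \<sigma>(2) open_contains_ball by blast
  obtain d where d: "d > 0" "\<forall>s\<in>S. dist s \<sigma> < d \<longrightarrow> dist (p s) (p \<sigma>) < e"
    using p(1) \<sigma>(1) e(1) unfolding continuous_on_iff by blast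
  have "p s \<in> U" if "s \<in> S" "dist s \<sigma> < d" for s
  proof -
    have "p s \<in> ball (p \<sigma>) e" using d(2) that by (simp add: dist_commute[of "p \<sigma>"])
    then show ?thesis using e(2) V(2) p(2) that(1) by blast
  qed
  then show ?thesis using d(1) by blast
qed

lemma barrier_imp_safe:
  fixes F :: "'a::euclidean_space \<Rightarrow> 'a set"
  assumes lip: "loc_lipschitz_tv B" and cand: "barrier_candidate B Xo Xu" and star: "star_star F B"
  shows "safe F Xo Xu"
  unfolding safe_def
proof (intro allI impI ballI notI)
  fix x0 D \<phi> t
  assume x0: "x0 \<in> Xo \<and> is_solution F x0 D \<phi>" and tD: "t \<in> D" and tu: "\<phi> t \<in> Xu"
  let ?A = "{0..} \<times> (UNIV :: 'a set)"
  have t: "0 \<le> t" using sol_domain_initial_segment[of D t] x0 tD by (auto simp: is_solution_def)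
  have sol: "is_solution F x0 {0..t} \<phi>" using is_solution_restrict x0 tD by blast
  have \<phi>0: "\<phi> 0 = x0" using sol by (simp add: is_solution_def)
  have cont\<phi>: "continuous_on {0..t} \<phi>"
    using sol abs_cont_on_imp_continuous_on by (auto simp: is_solution_segment_iff[OF t])
  define p where "p s = (s, \<phi> s)" for s
  have contp: "continuous_on {0..t} p" unfolding p_def using cont\<phi> by (intro continuous_intros)
  have pA: "p ` {0..t} \<subseteq> ?A" by (auto simp: p_def)
  have "compact (p ` {0..t})" using contp by (intro compact_continuous_image) auto
  then obtain L where "L-lipschitz_on (p ` {0..t}) (\<lambda>(t, x). B t x)"
    using lip pA unfolding loc_lipschitz_tv_def by blast
  then have "continuous_on (p ` {0..t}) (\<lambda>(t, x). B t x)" by (rule lipschitz_on_continuous_on)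
  then have "continuous_on {0..t} ((\<lambda>(t, x). B t x) \<circ> p)" using contp by (intro continuous_on_compose)
  then have contf: "continuous_on {0..t} (\<lambda>s. B s (\<phi> s))" by (simp add: o_def p_def)
  define S where "S = {s \<in> {0..t}. B s (\<phi> s) \<le> 0}"
  have clS: "closed S" unfolding S_def by (intro continuous_on_closed_Collect_le continuous_intros contf)
  have "0 \<in> S" using cand x0 \<phi>0 t by (auto simp: S_def barrier_candidate_def)
  have bddS: "bdd_above S" by (rule bdd_aboveI[of _ t]) (auto simp: S_def)
  define \<sigma> where "\<sigma> = Sup S"
  have \<sigma>S: "\<sigma> \<in> S" unfolding \<sigma>_def using closed_contains_Sup[OF _ bddS clS] \<open>0 \<in> S\<close> by blast
  have after: "B s (\<phi> s) > 0" if "\<sigma> < s" "s \<le> t" for s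
  proof (rule ccontr)
    assume "\<not> B s (\<phi> s) > 0"
    then have "s \<in> S" using that \<sigma>S by (auto simp: S_def)
    then show False using cSup_upper[OF _ bddS, of s] that unfolding \<sigma>_def by simp
  qed
  have "B t (\<phi> t) > 0" using cand tu t by (simp add: barrier_candidate_def)
  then have \<sigma>: "0 \<le> \<sigma>" "\<sigma> < t" "B \<sigma> (\<phi> \<sigma>) \<le> 0"
    using \<sigma>S by (auto simp: S_def order_less_le)
  define K where "K = sublevel_K B"
  define J where "J = (top_of_set ?A) interior_of K"
  obtain U where U: "openin (top_of_set ?A) U" "K \<subseteq> U"
    and mono: "\<forall>z0 D \<psi> I. z0 \<in> U - J \<and> is_solution (augmented F) z0 D \<psi> \<and>
      is_interval I \<and> 0 \<in> I \<and> I \<subseteq> D \<and> (\<forall>s\<in>I. \<psi> s \<in> U - J) \<longrightarrow>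
      (\<forall>s1\<in>I. \<forall>s2\<in>I. s1 \<le> s2 \<longrightarrow> B (fst (\<psi> s2)) (snd (\<psi> s2)) \<le> B (fst (\<psi> s1)) (snd (\<psi> s1)))"
    using star unfolding star_star_def Let_def K_def J_def by (elim exE conjE)
  have p\<sigma>: "p \<sigma> \<in> K" using \<sigma> by (simp add: p_def K_def sublevel_K_def)
  have notK: "p s \<notin> K" if "\<sigma> < s" "s \<le> t" for s using after[OF that] by (simp add: p_def K_def sublevel_K_def)
  have JK: "J \<subseteq> K" unfolding J_def by (rule interior_of_subset)
  have \<sigma>t: "\<sigma> \<in> {0..t}" using \<sigma> by simp
  \<comment> \<open>Just after \<open>\<sigma>\<close> the trajectory is outside \<open>K\<close>,
    so no relative neighbourhood of \<open>p \<sigma>\<close> lies in \<open>K\<close>.\<close>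
  have \<sigma>J: "p \<sigma> \<notin> J"
  proof
    assume "p \<sigma> \<in> J"
    then obtain d where d: "d > 0" "\<forall>s\<in>{0..t}. dist s \<sigma> < d \<longrightarrow> p s \<in> J"
      using continuous_on_imp_openin_nearby[OF openin_interior_of contp pA \<sigma>t, of K] unfolding J_def by blast
    define s where "s = \<sigma> + min (d / 2) (t - \<sigma>)"
    have s: "\<sigma> < s" "s \<le> t" "dist s \<sigma> < d" using d(1) \<sigma> by (auto simp: s_def dist_real_def)
    then have "p s \<in> J" using d(2) \<sigma> by auto
    then show False using notK[OF s(1,2)] JK by blast
  qed
  obtain d where d: "d > 0" "\<forall>s\<in>{0..t}. dist s \<sigma> < d \<longrightarrow> p s \<in> U"
    using continuous_on_imp_openin_nearby[OF U(1) contp pA \<sigma>t] p\<sigma> U(2) by blast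
  define e where "e = min (d / 2) (t - \<sigma>)"
  have e: "0 < e" "e < d" "\<sigma> + e \<le> t" using d(1) \<sigma> by (auto simp: e_def)
  \<comment> \<open>\<open>star_star\<close> concerns solutions that start at parameter 0, so the
    trajectory is restarted at \<open>\<sigma>\<close>; absolute time survives in the first
    component.\<close>
  define \<psi> where "\<psi> s = p (\<sigma> + s)" for s
  have "is_solution F (\<phi> \<sigma>) {0..t - \<sigma>} (\<lambda>s. \<phi> (\<sigma> + s))"
    by (rule is_solution_shift[OF sol]) (use \<sigma> in auto)
  then have "is_solution (augmented F) (\<sigma>, \<phi> \<sigma>) {0..t - \<sigma>} (\<lambda>s. (\<sigma> + s, \<phi> (\<sigma> + s)))"
    using \<sigma> by (intro augmented_solutionI) auto
  then have sol\<psi>: "is_solution (augmented F) (p \<sigma>) {0..t - \<sigma>} \<psi>" by (simp add: \<psi>_def[abs_def] p_def)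
  have inW: "\<psi> s \<in> U - J" if "s \<in> {0..e}" for s
  proof (cases "s = 0")
    case True
    then show ?thesis using p\<sigma> U(2) \<sigma>J by (auto simp: \<psi>_def)
  next
    case False
    then have "\<psi> s \<notin> K" unfolding \<psi>_def using that e by (intro notK) auto
    moreover have "\<psi> s \<in> U"
      unfolding \<psi>_def using d(2) that e \<sigma> by (auto simp: dist_real_def)
    ultimately show ?thesis using JK by blast
  qed
  have "B (fst (\<psi> e)) (snd (\<psi> e)) \<le> B (fst (\<psi> 0)) (snd (\<psi> 0))"
  proof -
    have "p \<sigma> \<in> U - J" using p\<sigma> U(2) \<sigma>J by blast
    moreover have "{0..e} \<subseteq> {0..t - \<sigma>}" "0 \<in> {0..e}" "e \<in> {0..e}" using e by auto
    moreover have "\<forall>s\<in>{0..e}. \<psi> s \<in> U - J" using inW by blast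
    ultimately show ?thesis
      using mono[rule_format, of "p \<sigma>" "{0..t - \<sigma>}" \<psi> "{0..e}" 0 e] sol\<psi> e(1) by (simp add: is_interval_cc)
  qed
  then have "B (\<sigma> + e) (\<phi> (\<sigma> + e)) \<le> 0" using \<sigma>(3) by (simp add: \<psi>_def p_def)
  then show False using after[of "\<sigma> + e"] e by simp
qed

lemma lipschitz_inclusion_uminus:
  assumes lip: "loc_lipschitz_setvalued F" and cc: "\<And>x. compact (F x) \<and> convex (F x)"
    and bc: "backward_complete F"
  shows "lipschitz_inclusion (\<lambda>x. uminus ` F x)"
proof
  show "loc_lipschitz_setvalued (\<lambda>x. uminus ` F x)"
    unfolding loc_lipschitz_setvalued_def
  proof (intro allI impI)
    fix C :: "'a set" assume "compact C"
    then obtain k where k: "k > 0" "\<forall>x1\<in>C. \<forall>x2\<in>C. F x1 \<subseteq> enlarge (F x2) (k * norm (x1 - x2))"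
      using lip unfolding loc_lipschitz_setvalued_def by blast
    have "uminus ` F x1 \<subseteq> enlarge (uminus ` F x2) (k * norm (x1 - x2))" if x12: "x1 \<in> C" "x2 \<in> C" for x1 x2
    proof
      fix v assume "v \<in> uminus ` F x1"
      then obtain w where w: "v = - w" "w \<in> F x1" by blast
      then have "w \<in> enlarge (F x2) (k * norm (x1 - x2))" using k(2) x12 by blast
      then obtain a b where "w = a + b" "a \<in> F x2" "norm b \<le> k * norm (x1 - x2)" by (auto simp: enlarge_def)
      then show "v \<in> enlarge (uminus ` F x2) (k * norm (x1 - x2))"
        unfolding enlarge_def using w by (intro CollectI exI[of _ "- a"] exI[of _ "- b"]) auto
    qed
    then show "\<exists>k>0. \<forall>x1\<in>C. \<forall>x2\<in>C. uminus ` F x1 \<subseteq> enlarge (uminus ` F x2) (k * norm (x1 - x2))"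
      using k(1) by blast
  qed
  \<comment> \<open>Nonempty values are a consequence of completeness of the reversed
    system.\<close>
  then show "uminus ` F x \<noteq> {}" for x
    using forward_complete_imp_nonempty_val bc unfolding backward_complete_def by blast
  show "compact (uminus ` F x)" for x using cc compact_negations by blast
  show "convex (uminus ` F x)" for x using cc convex_negations by blast
qed

lemma safe_imp_barrier:
  fixes F :: "'a::euclidean_space \<Rightarrow> 'a set"
  assumes lip: "loc_lipschitz_setvalued F" and cc: "\<And>x. compact (F x) \<and> convex (F x)"
    and bc: "backward_complete F" and Xo: "closed Xo" and safe: "safe F Xo Xu"
  shows "\<exists>B :: real \<Rightarrow> 'a \<Rightarrow> real. loc_lipschitz_tv B \<and> barrier_candidate B Xo Xu \<and> star_star F B"
proof (cases "Xo = {}")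
  case True
  \<comment> \<open>\<open>infdist\<close> to the empty set is 0, so \<open>reach_dist\<close> would
    not be positive on \<open>Xu\<close>. The constant 1 has an empty \<open>K\<close>, and
    \<open>star_star\<close> holds because it is nonincreasing along any curve.\<close>
  have "loc_lipschitz_tv (\<lambda>_ _::'a. 1 :: real)"
    unfolding loc_lipschitz_tv_def by (intro allI impI exI[of _ 0]) (auto intro!: lipschitz_onI)
  moreover have "barrier_candidate (\<lambda>_ _. 1) Xo Xu" using True by (simp add: barrier_candidate_def)
  moreover have "star_star F (\<lambda>_ _. 1)"
    unfolding star_star_def Let_def by (rule exI[of _ "{0..} \<times> UNIV"]) (auto simp: sublevel_K_def)
  ultimately show ?thesis by blast
next
  case False
  interpret lipschitz_inclusion "\<lambda>x. uminus ` F x" by (rule lipschitz_inclusion_uminus[OF lip cc bc])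
  have bd: "bounded (reach T x)" for T x
    using bc by (intro forward_complete_imp_bounded_reach) (simp add: backward_complete_def)
  have "loc_lipschitz_tv (reach_dist Xo)" by (rule loc_lipschitz_reach_dist[OF bd False])
  moreover have "barrier_candidate (reach_dist Xo) Xo Xu"
    unfolding barrier_candidate_def
  proof (intro conjI allI impI ballI)
    fix t :: real and x assume t: "0 \<le> t" and x: "x \<in> Xo"
    then show "reach_dist Xo t x \<le> 0" using reach_dist_le[OF reach_self[OF t], of Xo x] by simp
  next
    fix t :: real and x assume t: "0 \<le> t" and x: "x \<in> Xu"
    have "reach_dist Xo t x \<noteq> 0"
    proof
      assume "reach_dist Xo t x = 0"
      then obtain y where y: "y \<in> Xo" "y \<in> reach t x"
        using reach_dist_zero_attained[OF bd t Xo False] by blast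
      then obtain \<phi> \<tau> where \<phi>: "0 \<le> \<tau>" "is_solution (\<lambda>x. uminus ` F x) x {0..\<tau>} \<phi>" "y = \<phi> \<tau>"
        by (auto simp: reach_def)
      have "is_solution F y {0..\<tau>} (\<lambda>t. \<phi> (\<tau> - t))"
        using is_solution_reverse[OF \<phi>(2,1)] \<phi>(3) by (simp add: image_image)
      then have "\<phi> (\<tau> - \<tau>) \<notin> Xu" using safe y(1) \<phi>(1) unfolding safe_def by fastforce
      then show False using \<phi>(2) x by (simp add: is_solution_def)
    qed
    moreover have "0 \<le> reach_dist Xo t x" using t by (intro le_reach_dist infdist_nonneg)
    ultimately show "reach_dist Xo t x > 0" by simp
  qed
  \<comment> \<open>\<open>U\<close> is the whole half-space: this barrier is nonincreasing along
    every solution, inside \<open>K\<close> as well.\<close>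
  moreover have "star_star F (reach_dist Xo)"
    unfolding star_star_def Let_def
  proof (intro exI[of _ "{0..} \<times> UNIV"] conjI allI impI ballI)
    show "openin (top_of_set ({0..} \<times> UNIV)) ({0..} \<times> (UNIV :: 'a set))" by simp
    show "sublevel_K (reach_dist Xo) \<subseteq> {0..} \<times> UNIV" by (auto simp: sublevel_K_def)
    fix z0 D \<psi> I s1 s2
    assume A: "z0 \<in> {0..} \<times> UNIV - top_of_set ({0..} \<times> UNIV) interior_of sublevel_K (reach_dist Xo) \<and>
        is_solution (augmented F) z0 D \<psi> \<and> is_interval I \<and> 0 \<in> I \<and> I \<subseteq> D \<and>
        (\<forall>s\<in>I. \<psi> s \<in> {0..} \<times> UNIV - top_of_set ({0..} \<times> UNIV) interior_of sublevel_K (reach_dist Xo))"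
      and s12: "s1 \<in> I" "s2 \<in> I" "s1 \<le> s2"
    have D: "s1 \<in> D" "s2 \<in> D" and sol: "is_solution (augmented F) z0 D \<psi>" using A s12 by auto
    have s1: "0 \<le> s1" using sol_domain_initial_segment(1)[OF _ D(1)] sol by (simp add: is_solution_def)
    have z0: "0 \<le> fst z0" using A by auto
    note sol1 = augmented_solutionD[OF is_solution_restrict[OF sol D(1)] s1]
    have s2: "0 \<le> s2" using s1 s12 by simp
    note sol2 = augmented_solutionD[OF is_solution_restrict[OF sol D(2)] s2]
    \<comment> \<open>The piece between \<open>s1\<close> and \<open>s2\<close>, run backwards,
      solves the inclusion for \<open>-F\<close> from the later state and takes time
      \<open>s2 - s1\<close>. This is exactly the difference of the two time components, so
      \<open>reach_dist_backward\<close> compares the right values.\<close>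
    have "is_solution F (snd (\<psi> s1)) {0..s2 - s1} (\<lambda>t. snd (\<psi> (s1 + t)))"
      using is_solution_shift[OF sol2(1) s1 s12(3)] by simp
    from is_solution_reverse[OF this]
    have "is_solution (\<lambda>x. uminus ` F x) (snd (\<psi> s2)) {0..s2 - s1} (\<lambda>t. snd (\<psi> (s1 + (s2 - s1 - t))))"
      using s12(3) by simp
    from reach_dist_backward[OF this, of "fst (\<psi> s1)" Xo]
    have "reach_dist Xo (s2 - s1 + fst (\<psi> s1)) (snd (\<psi> s2)) \<le> reach_dist Xo (fst (\<psi> s1)) (snd (\<psi> s1))"
      using s12(3) s1 z0 sol1(2) by simp
    moreover have "s2 - s1 + fst (\<psi> s1) = fst (\<psi> s2)" using sol1(2) sol2(2) by simp
    ultimately show "reach_dist Xo (fst (\<psi> s2)) (snd (\<psi> s2)) \<le> reach_dist Xo (fst (\<psi> s1)) (snd (\<psi> s1))" by simp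
  qed
  ultimately show ?thesis by blast
qed

theorem theorem3:
  fixes F :: "'a::euclidean_space \<Rightarrow> 'a set" and Xo Xu :: "'a set"
  assumes "usc_setvalued F"
    and "loc_lipschitz_setvalued F"
    and "\<And>x. compact (F x) \<and> convex (F x)"
    and "backward_complete F"
    and "closed Xo"
    and "Xo \<inter> Xu = {}"
  shows "safe F Xo Xu \<longleftrightarrow>
    (\<exists>B :: real \<Rightarrow> 'a \<Rightarrow> real. loc_lipschitz_tv B \<and> barrier_candidate B Xo Xu \<and> star_star F B)"
  using safe_imp_barrier[OF assms(2-5)] barrier_imp_safe by blast

end
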